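(* Let $(d,h)$ be a minimal higher matrix factorization with respect to a regular sequence $f_1,\dots,f_c$ in a local ring $S$. Then the Poincaré series $\mathcal P^S_M(x)=\sum_{i\ge0}b_i^S(M)x^i$ of the HMF module $M$ of $(d,h)$ is $$\mathcal P^S_M(x)=\sum_{1\le p\le c}(1+x)^{p-1}\Big(x\,\operatorname{rank}(B_1(p))+\operatorname{rank}(B_0(p))\Big).$$
   Context: All rings are commutative and Noetherian, all modules finitely generated. For elements $f_1,\dots,f_c$ of a ring $S$ put $R=S/(f_1,\dots,f_c)$. A higher matrix factorization (HMF) $(d,h)$ with respect to $f_1,\dots,f_c$ consists of: (1) finitely generated free $S$-modules $A_0,A_1$ with filtrations $0=A_s(0)\subseteq A_s(1)\subseteq\cdots\subseteq A_s(c)=A_s$ ($s=0,1$) such that each $A_s(p-1)$ is a free summand of $A_s(p)$; (2) $S$-linear maps $d:A_1\to A_0$ and $h:\bigoplus_{q=1}^cA_0(q)\to A_1$ preserving filtrations, where $\bigoplus_qA_0(q)$ is filtered by the submodules $\bigoplus_{q\le p}A_0(q)$; such that, writing $d_p:A_1(p)\to A_0(p)$ and $h_p:A_0(p)\to A_1(p)$ for the induced maps ($h_p$ is the restriction of $h$ to the $p$-th summand), $B_s(p)=A_s(p)/A_s(p-1)$ (free modules), and $\pi_p:A_1(p)\to B_1(p)$ for the projection, one has for all $1\le p\le c$: (a) $d_ph_p\equiv f_p\,\mathrm{Id}_{A_0(p)}$ modulo $(f_1,\dots,f_{p-1})A_0(p)$; (b) $\pi_ph_pd_p\equiv f_p\,\pi_p$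 modulo $(f_1,\dots,f_{p-1})B_1(p)$. The HMF module of $(d,h)$ is $M=\operatorname{coker}(R\otimes_S d)$. $(d,h)$ is minimal if the images of $d$ and $h$ are contained in the maximal ideal times their targets. $b_i^S(M)=\dim_k\operatorname{Tor}_i^S(M,k)$, $k$ the residue field. *)

theory Defs
  imports
    "HOL-Computational_Algebra.Formal_Power_Series"
    "HOL-Algebra.QuotRing"
    "HOL-Algebra.Ring_Divisibility"
    "Jordan_Normal_Form.Missing_VectorSpace"
begin

section \<open>Noetherian local rings and regular sequences\<close>

locale noetherian_local_ring = noetherian_ring R + cring R for R (structure) +
  assumes unique_maximal: "\<exists>!I. maximalideal I R"

definition max_ideal :: "('a, 'b) ring_scheme \<Rightarrow> 'a set"
  where "max_ideal S = (THE I. maximalideal I S)"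

text \<open>Sequences are indexed from 1: \<open>f_ideal S f p\<close> is the ideal \<open>(f 1, \<dots>, f p)\<close>, so that
  \<open>f_ideal S f 0\<close> is the zero ideal and \<open>f 0\<close> plays no role.\<close>

definition f_ideal :: "('a, 'b) ring_scheme \<Rightarrow> (nat \<Rightarrow> 'a) \<Rightarrow> nat \<Rightarrow> 'a set"
  where "f_ideal S f p = Idl\<^bsub>S\<^esub> (f ` {1..p})"

definition regular_sequence :: "('a, 'b) ring_scheme \<Rightarrow> nat \<Rightarrow> (nat \<Rightarrow> 'a) \<Rightarrow> bool"
  where "regular_sequence S c f \<longleftrightarrow>
    (\<forall>p\<in>{1..c}. f p \<in> carrier S) \<and>
    (\<forall>p\<in>{1..c}. \<forall>x\<in>carrier S.
        f p \<otimes>\<^bsub>S\<^esub> x \<in> f_ideal S f (p - 1) \<longrightarrow> x \<in> f_ideal S f (p - 1)) \<and>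
    f_ideal S f c \<noteq> carrier S"

section \<open>Module constructions\<close>

text \<open>The record type of modules extends that of rings; the components \<open>mult\<close> and \<open>one\<close> are
  irrelevant for modules and are left undefined below. A submodule \<open>N\<close> of \<open>M\<close>, viewed as a
  module, is \<open>M\<lparr>carrier := N\<rparr>\<close>.\<close>

definition regular_module :: "('a, 'b) ring_scheme \<Rightarrow> ('a, 'a) module"
  where "regular_module S =
    \<lparr>carrier = carrier S, mult = undefined, one = undefined,
     zero = \<zero>\<^bsub>S\<^esub>, add = add S, smult = mult S\<rparr>"

definition quot_module :: "('a, 'm, 'c) module_scheme \<Rightarrow> 'm set \<Rightarrow> ('a, 'm set) module"
  where "quot_module M N =
    \<lparr>carrier = a_rcosets\<^bsub>M\<^esub> N, mult = undefined, one = undefined,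
     zero = N, add = set_add M,
     smult = (\<lambda>r X. \<Union>x\<in>X. N +>\<^bsub>M\<^esub> (r \<odot>\<^bsub>M\<^esub> x))\<rparr>"

text \<open>Only used for finite index sets, where the direct sum is the product.\<close>

definition dsum_module :: "'i set \<Rightarrow> ('i \<Rightarrow> ('a, 'm) module) \<Rightarrow> ('a, 'i \<Rightarrow> 'm) module"
  where "dsum_module I M =
    \<lparr>carrier = (\<Pi>\<^sub>E i\<in>I. carrier (M i)), mult = undefined, one = undefined,
     zero = (\<lambda>i\<in>I. \<zero>\<^bsub>M i\<^esub>), add = (\<lambda>u v. \<lambda>i\<in>I. u i \<oplus>\<^bsub>M i\<^esub> v i),
     smult = (\<lambda>r u. \<lambda>i\<in>I. r \<odot>\<^bsub>M i\<^esub> u i)\<rparr>"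

definition ideal_times ::
    "('a, 'b) ring_scheme \<Rightarrow> ('a, 'm, 'c) module_scheme \<Rightarrow> 'a set \<Rightarrow> 'm set \<Rightarrow> 'm set"
  where "ideal_times S M I N = module.span S M {r \<odot>\<^bsub>M\<^esub> x | r x. r \<in> I \<and> x \<in> N}"

definition finite_basis ::
    "('a, 'b) ring_scheme \<Rightarrow> ('a, 'm, 'c) module_scheme \<Rightarrow> 'm set \<Rightarrow> bool"
  where "finite_basis S M B \<longleftrightarrow>
    finite B \<and> B \<subseteq> carrier M \<and> \<not> module.lin_dep S M B \<and> module.span S M B = carrier M"

definition fg_free :: "('a, 'b) ring_scheme \<Rightarrow> ('a, 'm, 'c) module_scheme \<Rightarrow> bool"
  where "fg_free S M \<longleftrightarrow> module S M \<and> (\<exists>B. finite_basis S M B)"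

definition free_rank :: "('a, 'b) ring_scheme \<Rightarrow> ('a, 'm, 'c) module_scheme \<Rightarrow> nat"
  where "free_rank S M = (THE n. \<exists>B. finite_basis S M B \<and> card B = n)"

definition free_summand ::
    "('a, 'b) ring_scheme \<Rightarrow> ('a, 'm, 'c) module_scheme \<Rightarrow> 'm set \<Rightarrow> bool"
  where "free_summand S M N \<longleftrightarrow>
    LinearCombinations.submodule S N M \<and> fg_free S (M\<lparr>carrier := N\<rparr>) \<and>
    (\<exists>C. LinearCombinations.submodule S C M \<and> N \<inter> C = {\<zero>\<^bsub>M\<^esub>} \<and> N <+>\<^bsub>M\<^esub> C = carrier M)"

section \<open>Tensor products\<close>

text \<open>The free module on a possibly infinite set \<open>X\<close>: finitely supported functions.\<close>

definition free_on :: "('a, 'b) ring_scheme \<Rightarrow> 'x set \<Rightarrow> ('a, 'x \<Rightarrow> 'a) module"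
  where "free_on S X =
    (ring.func_space S X)\<lparr>carrier := {u \<in> X \<rightarrow>\<^sub>E carrier S. finite {x \<in> X. u x \<noteq> \<zero>\<^bsub>S\<^esub>}}\<rparr>"

definition free_gen :: "('a, 'b) ring_scheme \<Rightarrow> 'x set \<Rightarrow> 'x \<Rightarrow> 'x \<Rightarrow> 'a"
  where "free_gen S X x = (\<lambda>y\<in>X. if y = x then \<one>\<^bsub>S\<^esub> else \<zero>\<^bsub>S\<^esub>)"

definition tensor_rel ::
    "('a, 'b) ring_scheme \<Rightarrow> ('a, 'm) module \<Rightarrow> ('a, 'n) module \<Rightarrow> ('m \<times> 'n \<Rightarrow> 'a) set"
  where "tensor_rel S M N =
    (let F = free_on S (carrier M \<times> carrier N);
         e = (\<lambda>m n. free_gen S (carrier M \<times> carrier N) (m, n))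
     in module.span S F
      ({e (m \<oplus>\<^bsub>M\<^esub> m') n \<ominus>\<^bsub>F\<^esub> (e m n \<oplus>\<^bsub>F\<^esub> e m' n) | m m' n.
          m \<in> carrier M \<and> m' \<in> carrier M \<and> n \<in> carrier N} \<union>
       {e m (n \<oplus>\<^bsub>N\<^esub> n') \<ominus>\<^bsub>F\<^esub> (e m n \<oplus>\<^bsub>F\<^esub> e m n') | m n n'.
          m \<in> carrier M \<and> n \<in> carrier N \<and> n' \<in> carrier N} \<union>
       {e (r \<odot>\<^bsub>M\<^esub> m) n \<ominus>\<^bsub>F\<^esub> (r \<odot>\<^bsub>F\<^esub> e m n) | r m n.
          r \<in> carrier S \<and> m \<in> carrier M \<and> n \<in> carrier N} \<union>
       {e m (r \<odot>\<^bsub>N\<^esub> n) \<ominus>\<^bsub>F\<^esub> (r \<odot>\<^bsub>F\<^esub> e m n) | r m n.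
          r \<in> carrier S \<and> m \<in> carrier M \<and> n \<in> carrier N}))"

definition tensor_module ::
    "('a, 'b) ring_scheme \<Rightarrow> ('a, 'm) module \<Rightarrow> ('a, 'n) module \<Rightarrow>
     ('a, ('m \<times> 'n \<Rightarrow> 'a) set) module"
  where "tensor_module S M N =
    quot_module (free_on S (carrier M \<times> carrier N)) (tensor_rel S M N)"

definition pure_tensor ::
    "('a, 'b) ring_scheme \<Rightarrow> ('a, 'm) module \<Rightarrow> ('a, 'n) module \<Rightarrow> 'm \<Rightarrow> 'n \<Rightarrow>
     ('m \<times> 'n \<Rightarrow> 'a) set"
  where "pure_tensor S M N m n =
    tensor_rel S M N +>\<^bsub>free_on S (carrier M \<times> carrier N)\<^esub>
      free_gen S (carrier M \<times> carrier N) (m, n)"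

text \<open>The map \<open>\<phi> \<otimes> \<psi>\<close> from \<open>M \<otimes> N\<close> to \<open>M' \<otimes> N'\<close>, for linear maps \<open>\<phi>\<close> from \<open>M\<close> to \<open>M'\<close> and
  \<open>\<psi>\<close> from \<open>N\<close> to \<open>N'\<close>.\<close>

definition tensor_map ::
    "('a, 'b) ring_scheme \<Rightarrow> ('a, 'm) module \<Rightarrow> ('a, 'n) module \<Rightarrow>
     ('a, 'm2) module \<Rightarrow> ('a, 'n2) module \<Rightarrow> ('m \<Rightarrow> 'm2) \<Rightarrow> ('n \<Rightarrow> 'n2) \<Rightarrow>
     ('m \<times> 'n \<Rightarrow> 'a) set \<Rightarrow> ('m2 \<times> 'n2 \<Rightarrow> 'a) set"
  where "tensor_map S M N M' N' \<phi> \<psi> =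
    (THE \<theta>. \<theta> \<in> module_hom S (tensor_module S M N) (tensor_module S M' N') \<and>
       \<theta> \<in> extensional (carrier (tensor_module S M N)) \<and>
       (\<forall>m\<in>carrier M. \<forall>n\<in>carrier N.
          \<theta> (pure_tensor S M N m n) = pure_tensor S M' N' (\<phi> m) (\<psi> n)))"

section \<open>Tor, Betti numbers and Poincare series\<close>

text \<open>A resolution \<open>\<dots> \<rightarrow> S^(n 2) \<rightarrow> S^(n 1) \<rightarrow> S^(n 0) \<rightarrow> M \<rightarrow> 0\<close> by finitely generated free
  modules; \<open>\<delta> i\<close> maps \<open>S^(n (i + 1))\<close> to \<open>S^(n i)\<close>, and \<open>\<epsilon>\<close> is the augmentation.\<close>

definition free_power :: "('a, 'b) ring_scheme \<Rightarrow> nat \<Rightarrow> ('a, nat \<Rightarrow> 'a) module"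
  where "free_power S n = ring.func_space S {..<n}"

definition free_resolution ::
    "('a, 'b) ring_scheme \<Rightarrow> ('a, 'm) module \<Rightarrow> (nat \<Rightarrow> nat) \<Rightarrow>
     (nat \<Rightarrow> (nat \<Rightarrow> 'a) \<Rightarrow> (nat \<Rightarrow> 'a)) \<Rightarrow> ((nat \<Rightarrow> 'a) \<Rightarrow> 'm) \<Rightarrow> bool"
  where "free_resolution S M n \<delta> \<epsilon> \<longleftrightarrow>
    (let F = (\<lambda>i. free_power S (n i)) in
      \<epsilon> \<in> module_hom S (F 0) M \<and>
      (\<forall>i. \<delta> i \<in> module_hom S (F (Suc i)) (F i)) \<and>
      \<epsilon> ` carrier (F 0) = carrier M \<and>
      a_kernel (F 0) M \<epsilon> = \<delta> 0 ` carrier (F 1) \<and>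
      (\<forall>i. a_kernel (F (Suc i)) (F i) (\<delta> i) = \<delta> (Suc i) ` carrier (F (Suc (Suc i)))))"

text \<open>Homology of a complex \<open>\<dots> \<rightarrow> C 1 \<rightarrow> C 0 \<rightarrow> 0\<close> with \<open>\<delta> i\<close> mapping \<open>C (i + 1)\<close> to \<open>C i\<close>.\<close>

definition homology ::
    "(nat \<Rightarrow> ('a, 'm) module) \<Rightarrow> (nat \<Rightarrow> 'm \<Rightarrow> 'm) \<Rightarrow> nat \<Rightarrow> ('a, 'm set) module"
  where "homology C \<delta> i =
    quot_module
      ((C i)\<lparr>carrier := (case i of 0 \<Rightarrow> carrier (C 0)
                               | Suc j \<Rightarrow> a_kernel (C (Suc j)) (C j) (\<delta> j))\<rparr>)
      (\<delta> i ` carrier (C (Suc i)))"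

text \<open>Tor is computed from a chosen free resolution of the first argument. This is meant for finitely
  generated modules \<open>M\<close> over a Noetherian ring, for which such resolutions exist.\<close>

definition tor_module ::
    "('a, 'b) ring_scheme \<Rightarrow> nat \<Rightarrow> ('a, 'm) module \<Rightarrow> ('a, 'n) module \<Rightarrow>
     ('a, ((nat \<Rightarrow> 'a) \<times> 'n \<Rightarrow> 'a) set set) module"
  where "tor_module S i M N =
    (let (n, \<delta>, \<epsilon>) = (SOME (n, \<delta>, \<epsilon>). free_resolution S M n \<delta> \<epsilon>);
         F = (\<lambda>j. free_power S (n j))
     in homology (\<lambda>j. tensor_module S (F j) N)
          (\<lambda>j. tensor_map S (F (Suc j)) N (F j) N (\<delta> j) (\<lambda>x. x)) i)"

text \<open>The \<open>S/I\<close>-module structure on an \<open>S\<close>-module \<open>V\<close> with \<open>I V = 0\<close>; scalars are cosets of \<open>I\<close>.\<close>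

definition coset_scalars :: "('a, 'm) module \<Rightarrow> ('a set, 'm) module"
  where "coset_scalars V =
    \<lparr>carrier = carrier V, mult = undefined, one = undefined,
     zero = \<zero>\<^bsub>V\<^esub>, add = add V,
     smult = (\<lambda>X v. THE w. \<forall>r\<in>X. r \<odot>\<^bsub>V\<^esub> v = w)\<rparr>"

definition betti :: "('a, 'b) ring_scheme \<Rightarrow> nat \<Rightarrow> ('a, 'm) module \<Rightarrow> nat"
  where "betti S i M =
    vectorspace.dim (S Quot max_ideal S)
      (coset_scalars (tor_module S i M (quot_module (regular_module S) (max_ideal S))))"

definition poincare_series :: "('a, 'b) ring_scheme \<Rightarrow> ('a, 'm) module \<Rightarrow> int fps"
  where "poincare_series S M = Abs_fps (\<lambda>i. int (betti S i M))"

section \<open>Higher matrix factorizations\<close>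

text \<open>The subquotient \<open>B(p) = A(p)/A(p - 1)\<close> of a filtration, for \<open>p \<ge> 1\<close>.\<close>

definition graded_piece ::
    "('a, 'm) module \<Rightarrow> (nat \<Rightarrow> 'm set) \<Rightarrow> nat \<Rightarrow> ('a, 'm set) module"
  where "graded_piece A F p = quot_module (A\<lparr>carrier := F p\<rparr>) (F (p - 1))"

definition free_filtration ::
    "('a, 'b) ring_scheme \<Rightarrow> nat \<Rightarrow> ('a, 'm) module \<Rightarrow> (nat \<Rightarrow> 'm set) \<Rightarrow> bool"
  where "free_filtration S c A F \<longleftrightarrow>
    fg_free S A \<and> F 0 = {\<zero>\<^bsub>A\<^esub>} \<and> F c = carrier A \<and>
    (\<forall>p\<in>{1..c}. LinearCombinations.submodule S (F p) A \<and>
       free_summand S (A\<lparr>carrier := F p\<rparr>) (F (p - 1)) \<and>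
       fg_free S (graded_piece A F p))"

text \<open>The direct sum of the \<open>A\<^sub>0(q)\<close> for \<open>1 \<le> q \<le> c\<close>, its filtration, and the inclusion of the
  \<open>p\<close>-th summand.\<close>

definition hmf_source ::
    "nat \<Rightarrow> ('a, 'm) module \<Rightarrow> (nat \<Rightarrow> 'm set) \<Rightarrow> ('a, nat \<Rightarrow> 'm) module"
  where "hmf_source c A F = dsum_module {1..c} (\<lambda>q. A\<lparr>carrier := F q\<rparr>)"

definition hmf_source_filt ::
    "nat \<Rightarrow> ('a, 'm) module \<Rightarrow> (nat \<Rightarrow> 'm set) \<Rightarrow> nat \<Rightarrow> (nat \<Rightarrow> 'm) set"
  where "hmf_source_filt c A F p =
    {u \<in> carrier (hmf_source c A F). \<forall>q\<in>{1..c}. p < q \<longrightarrow> u q = \<zero>\<^bsub>A\<^esub>}"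

definition hmf_incl :: "nat \<Rightarrow> ('a, 'm) module \<Rightarrow> nat \<Rightarrow> 'm \<Rightarrow> nat \<Rightarrow> 'm"
  where "hmf_incl c A p a = (\<lambda>q\<in>{1..c}. if q = p then a else \<zero>\<^bsub>A\<^esub>)"

locale higher_matrix_factorization = cring S
  for S :: "('a, 'b) ring_scheme" (structure)
    and c :: nat and f :: "nat \<Rightarrow> 'a"
    and A0 :: "('a, 'm) module" and F0 :: "nat \<Rightarrow> 'm set"
    and A1 :: "('a, 'n) module" and F1 :: "nat \<Rightarrow> 'n set"
    and d :: "'n \<Rightarrow> 'm" and h :: "(nat \<Rightarrow> 'm) \<Rightarrow> 'n" +
  assumes f_closed: "\<And>p. p \<in> {1..c} \<Longrightarrow> f p \<in> carrier S"
    and filt0: "free_filtration S c A0 F0"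
    and filt1: "free_filtration S c A1 F1"
    and d_hom: "d \<in> module_hom S A1 A0"
    and d_filt: "\<And>p. p \<in> {1..c} \<Longrightarrow> d ` F1 p \<subseteq> F0 p"
    and h_hom: "h \<in> module_hom S (hmf_source c A0 F0) A1"
    and h_filt: "\<And>p. p \<in> {1..c} \<Longrightarrow> h ` hmf_source_filt c A0 F0 p \<subseteq> F1 p"
    and dh: "\<And>p a. \<lbrakk>p \<in> {1..c}; a \<in> F0 p\<rbrakk> \<Longrightarrow>
      d (h (hmf_incl c A0 p a)) \<ominus>\<^bsub>A0\<^esub> (f p \<odot>\<^bsub>A0\<^esub> a)
        \<in> ideal_times S A0 (f_ideal S f (p - 1)) (F0 p)"
    and hd: "\<And>p x. \<lbrakk>p \<in> {1..c}; x \<in> F1 p\<rbrakk> \<Longrightarrow>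
      (let B = graded_piece A1 F1 p;
           proj = (\<lambda>y. F1 (p - 1) +>\<^bsub>A1\<^esub> y)
       in proj (h (hmf_incl c A0 p (d x))) \<ominus>\<^bsub>B\<^esub> (f p \<odot>\<^bsub>B\<^esub> proj x)
            \<in> ideal_times S B (f_ideal S f (p - 1)) (carrier B))"

definition minimal_hmf ::
    "('a, 'b) ring_scheme \<Rightarrow> nat \<Rightarrow> ('a, 'm) module \<Rightarrow> (nat \<Rightarrow> 'm set) \<Rightarrow> ('a, 'n) module \<Rightarrow>
     ('n \<Rightarrow> 'm) \<Rightarrow> ((nat \<Rightarrow> 'm) \<Rightarrow> 'n) \<Rightarrow> bool"
  where "minimal_hmf S c A0 F0 A1 d h \<longleftrightarrow>
    d ` carrier A1 \<subseteq> ideal_times S A0 (max_ideal S) (carrier A0) \<and>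
    h ` carrier (hmf_source c A0 F0) \<subseteq> ideal_times S A1 (max_ideal S) (carrier A1)"

text \<open>The cokernel of \<open>R \<otimes> d\<close> with \<open>R = S/(f 1, \<dots>, f c)\<close>, as an \<open>S\<close>-module.\<close>

definition hmf_module ::
    "('a, 'b) ring_scheme \<Rightarrow> nat \<Rightarrow> (nat \<Rightarrow> 'a) \<Rightarrow> ('a, 'm) module \<Rightarrow> ('a, 'n) module \<Rightarrow>
     ('n \<Rightarrow> 'm) \<Rightarrow> ('a, ('a set \<times> 'm \<Rightarrow> 'a) set set) module"
  where "hmf_module S c f A0 A1 d =
    (let R = quot_module (regular_module S) (f_ideal S f c)
     in quot_module (tensor_module S R A0)
          (tensor_map S R A1 R A0 (\<lambda>x. x) d ` carrier (tensor_module S R A1)))"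

end

theory Submission imports Defs
begin

text \<open>
  The module \<open>M\<close> is reached in \<open>c\<close> steps. Write \<open>R(q) = S/(f 1, \<dots>, f q)\<close> and
  \<open>M(p) = A\<^sub>0(p) / ((f 1, \<dots>, f p) A\<^sub>0(p) + d A\<^sub>1(p))\<close>, so that \<open>M(0) = 0\<close> and \<open>M(c) = M\<close>
  (\<open>hmf_module_presentation\<close>). By the congruence \<open>d h \<equiv> f p\<close>, the element \<open>f p\<close> kills the
  cokernel of \<open>d\<close> on the \<open>p\<close>-th stage over \<open>R(p - 1)\<close>, so this cokernel is \<open>M(p)\<close>
  (\<open>hmf_relations_eq\<close>). Splitting off the previous stage one obtains a sequence
  \<open>0 \<rightarrow> R(p - 1) \<otimes> B\<^sub>1(p) \<rightarrow> M(p - 1) \<oplus> R(p - 1) \<otimes> B\<^sub>0(p) \<rightarrow> M(p) \<rightarrow> 0\<close>,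
  exact in the middle and on the right by construction. It is exact on the left because
  \<open>\<pi> h d \<equiv> f p \<pi>\<close> and \<open>f p\<close> is not a zero divisor on \<open>R(p - 1)\<close> (\<open>relation_coefficients\<close>).

  A minimal resolution of \<open>R(p - 1)\<close> is the Koszul complex, with ranks \<open>p - 1 choose i\<close>. The map
  on the left of the sequence has its image in the maximal ideal times the target, since \<open>d\<close> is minimal and
  the filtrations consist of direct summands (\<open>free_filtration_ideal_times\<close>). Hence it lifts to a
  map of minimal resolutions with entries in the maximal ideal, and the mapping cone of the lift is a
  minimal resolution of \<open>M(p)\<close> (\<open>lift_minimal_map\<close>, \<open>cone_resolution\<close>). So the ranks in the resolution
  of \<open>M(p)\<close> exceed those for \<open>M(p - 1)\<close> by
  \<open>rank B\<^sub>0(p) * (p - 1 choose i) + rank B\<^sub>1(p) * (p - 1 choose i - 1)\<close> in degree \<open>i\<close>, the coefficient of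
  \<open>x^i\<close> in \<open>(1 + x)^(p - 1) * (x * rank B\<^sub>1(p) + rank B\<^sub>0(p))\<close>. This is \<open>hmf_resolution\<close>. The same lemma on
  cones, applied to the ring itself, produces the Koszul complex.

  Finally, the ranks in a minimal resolution are the Betti numbers (\<open>betti_minimal_resolution\<close>). Since Tor
  is computed from an arbitrary resolution, this rests on the comparison of resolutions up to homotopy and
  on the isomorphism \<open>F \<otimes> S/J \<cong> F/JF\<close>.
\<close>

section \<open>Linear maps and submodules\<close>

lemma mod_homI:
  assumes "module R M" "module R N" "\<And>x. x \<in> carrier M \<Longrightarrow> g x \<in> carrier N"
    "\<And>x y. \<lbrakk>x \<in> carrier M; y \<in> carrier M\<rbrakk> \<Longrightarrow> g (x \<oplus>\<^bsub>M\<^esub> y) = g x \<oplus>\<^bsub>N\<^esub> g y"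
    "\<And>r x. \<lbrakk>r \<in> carrier R; x \<in> carrier M\<rbrakk> \<Longrightarrow> g (r \<odot>\<^bsub>M\<^esub> x) = r \<odot>\<^bsub>N\<^esub> g x"
  shows "mod_hom R M N g"
  using assms by (auto simp: mod_hom_def mod_hom_axioms_def module_hom_def)

lemma mod_hom_add:
  "\<lbrakk>mod_hom R M N g; x \<in> carrier M; y \<in> carrier M\<rbrakk> \<Longrightarrow> g (x \<oplus>\<^bsub>M\<^esub> y) = g x \<oplus>\<^bsub>N\<^esub> g y"
  by (auto simp: mod_hom_def mod_hom_axioms_def module_hom_def)

lemma mod_hom_smult:
  "\<lbrakk>mod_hom R M N g; r \<in> carrier R; x \<in> carrier M\<rbrakk> \<Longrightarrow> g (r \<odot>\<^bsub>M\<^esub> x) = r \<odot>\<^bsub>N\<^esub> g x"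
  by (auto simp: mod_hom_def mod_hom_axioms_def module_hom_def)

lemma mod_hom_cong:
  assumes "mod_hom R M N g" "\<And>x. x \<in> carrier M \<Longrightarrow> f x = g x"
  shows "mod_hom R M N f"
proof -
  interpret g: mod_hom R M N g by fact
  show ?thesis
    by (rule mod_homI) (use assms(2) g.M.module_axioms g.N.module_axioms in auto)
qed

lemma mod_hom_comp:
  assumes "mod_hom R L M g" "mod_hom R M N h"
  shows "mod_hom R L N (\<lambda>x. h (g x))"
proof -
  interpret g: mod_hom R L M g by fact
  interpret h: mod_hom R M N h by fact
  show ?thesis by (rule mod_homI) (use g.M.module_axioms h.N.module_axioms in auto)
qed

lemma mod_hom_plus:
  assumes "mod_hom R M N g" "mod_hom R M N h"
  shows "mod_hom R M N (\<lambda>x. g x \<oplus>\<^bsub>N\<^esub> h x)"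
proof -
  interpret g: mod_hom R M N g by fact
  interpret h: mod_hom R M N h by fact
  show ?thesis
    by (rule mod_homI) (use g.M.module_axioms g.N.module_axioms in
        \<open>auto simp: g.N.smult_r_distr g.N.M.a_ac\<close>)
qed

lemma mod_hom_scale:
  assumes "mod_hom R M N g" "a \<in> carrier R"
  shows "mod_hom R M N (\<lambda>x. a \<odot>\<^bsub>N\<^esub> g x)"
proof -
  interpret g: mod_hom R M N g by fact
  show ?thesis
    by (rule mod_homI) (use assms(2) g.M.module_axioms g.N.module_axioms in
        \<open>auto simp: g.N.smult_r_distr g.N.smult_assoc1[symmetric] g.R.m_comm\<close>)
qed

lemma mod_hom_diff:
  assumes "mod_hom R M N g" "mod_hom R M N h"
  shows "mod_hom R M N (\<lambda>x. g x \<ominus>\<^bsub>N\<^esub> h x)"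
proof -
  interpret g: mod_hom R M N g by fact
  interpret h: mod_hom R M N h by fact
  show ?thesis
    by (rule mod_homI) (use g.M.module_axioms g.N.module_axioms in
        \<open>auto simp: g.N.smult_r_distr g.N.M.minus_eq g.N.M.minus_add g.N.M.a_ac g.N.smult_r_minus\<close>)
qed

lemma mod_hom_zero:
  assumes "module R M" "module R N"
  shows "mod_hom R M N (\<lambda>x. \<zero>\<^bsub>N\<^esub>)"
proof -
  interpret N: module R N by fact
  show ?thesis by (rule mod_homI) (use assms in auto)
qed

lemma mod_hom_ident: "module R M \<Longrightarrow> mod_hom R M M (\<lambda>x. x)"
  by (rule mod_homI) auto

lemma (in module) submodule_criterion:
  assumes "W \<subseteq> carrier M" "\<zero>\<^bsub>M\<^esub> \<in> W"
    "\<And>x y. \<lbrakk>x \<in> W; y \<in> W\<rbrakk> \<Longrightarrow> x \<oplus>\<^bsub>M\<^esub> y \<in> W"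
    "\<And>r x. \<lbrakk>r \<in> carrier R; x \<in> W\<rbrakk> \<Longrightarrow> r \<odot>\<^bsub>M\<^esub> x \<in> W"
  shows "submodule R W M"
  using assms module_axioms by (auto simp: submodule_def)

lemma (in module) submodule_carrier: "submodule R (carrier M) M"
  by (rule submodule_criterion) auto

lemma (in module) submodule_singleton_zero: "submodule R {\<zero>\<^bsub>M\<^esub>} M"
  by (rule submodule_criterion) auto

lemma (in module) submodule_neg:
  assumes "submodule R W M" "x \<in> W" shows "\<ominus>\<^bsub>M\<^esub> x \<in> W"
proof -
  have "x \<in> carrier M" using assms submodule.subset by blast
  then have "\<ominus>\<^bsub>M\<^esub> x = (\<ominus> \<one>) \<odot>\<^bsub>M\<^esub> x" by (simp add: smult_minus_1)
  then show ?thesis using submodule.smult_closed[OF assms(1)] assms(2) by simp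
qed

lemma (in module) submodule_diff:
  assumes "submodule R W M" "x \<in> W" "y \<in> W" shows "x \<ominus>\<^bsub>M\<^esub> y \<in> W"
  unfolding M.minus_eq
  using assms submodule_neg submodule.m_closed by metis

lemma (in module) submodule_add_cancel:
  assumes "submodule R W M" "x \<in> carrier M" "y \<in> W"
  shows "x \<oplus>\<^bsub>M\<^esub> y \<in> W \<longleftrightarrow> x \<in> W"
proof
  assume "x \<oplus>\<^bsub>M\<^esub> y \<in> W"
  then have "(x \<oplus>\<^bsub>M\<^esub> y) \<ominus>\<^bsub>M\<^esub> y \<in> W" using assms submodule_diff by blast
  moreover have "y \<in> carrier M" using assms submodule.subset by blast
  ultimately show "x \<in> W" using assms(2) by (simp add: M.minus_eq M.a_assoc M.r_neg)
qed (use assms submodule.m_closed in metis)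

lemma (in module) submodule_diff_iff:
  assumes "submodule R W M" "x \<in> carrier M" "y \<in> carrier M" "x \<ominus>\<^bsub>M\<^esub> y \<in> W"
  shows "x \<in> W \<longleftrightarrow> y \<in> W"
proof -
  have "x = y \<oplus>\<^bsub>M\<^esub> (x \<ominus>\<^bsub>M\<^esub> y)"
    using assms(2,3) by (metis M.a_comm M.add.inv_closed M.minus_eq M.r_neg2 M.add.m_closed)
  then show ?thesis using submodule_add_cancel[OF assms(1,3,4)] by metis
qed

lemma submodule_vimage:
  assumes "mod_hom R M N g" "submodule R W N"
  shows "submodule R {x \<in> carrier M. g x \<in> W} M"
proof -
  interpret g: mod_hom R M N g by fact
  interpret W: submodule R W N by fact
  show ?thesis by (rule g.M.submodule_criterion) auto
qed

lemma submodule_image: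
  assumes "mod_hom R M N g" "submodule R W M"
  shows "submodule R (g ` W) N"
proof -
  interpret g: mod_hom R M N g by fact
  interpret W: submodule R W M by fact
  have W: "x \<in> carrier M" if "x \<in> W" for x using W.subset that by blast
  show ?thesis
  proof (rule g.N.submodule_criterion)
    show "\<zero>\<^bsub>N\<^esub> \<in> g ` W" by (metis W.zero_closed g.f0_is_0 imageI)
    show "x \<oplus>\<^bsub>N\<^esub> y \<in> g ` W" if "x \<in> g ` W" "y \<in> g ` W" for x y
      using that by (auto simp: W g.f_add[symmetric] simp del: g.f_add)
    show "r \<odot>\<^bsub>N\<^esub> x \<in> g ` W" if "r \<in> carrier R" "x \<in> g ` W" for r x
      using that by (auto simp: W g.f_smult[symmetric] simp del: g.f_smult)
  qed (use W in auto)
qed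

lemma (in module) mem_plus_iff: "x \<in> V <+>\<^bsub>M\<^esub> W \<longleftrightarrow> (\<exists>v\<in>V. \<exists>w\<in>W. x = v \<oplus>\<^bsub>M\<^esub> w)"
  by (auto simp: set_add_def')

lemma (in module) submodule_plus:
  assumes "submodule R V M" "submodule R W M"
  shows "submodule R (V <+>\<^bsub>M\<^esub> W) M"
proof -
  interpret V: submodule R V M by fact
  interpret W: submodule R W M by fact
  have V: "x \<in> carrier M" if "x \<in> V" for x using V.subset that by blast
  have W: "x \<in> carrier M" if "x \<in> W" for x using W.subset that by blast
  show ?thesis
  proof (rule submodule_criterion)
    show "V <+>\<^bsub>M\<^esub> W \<subseteq> carrier M" by (auto simp: set_add_def' V W)
    show "\<zero>\<^bsub>M\<^esub> \<in> V <+>\<^bsub>M\<^esub> W" unfolding set_add_def' by (force intro!: bexI[of _ "\<zero>\<^bsub>M\<^esub>"])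
    show "x \<oplus>\<^bsub>M\<^esub> y \<in> V <+>\<^bsub>M\<^esub> W" if "x \<in> V <+>\<^bsub>M\<^esub> W" "y \<in> V <+>\<^bsub>M\<^esub> W" for x y
    proof -
      from that(1) obtain a b where "a \<in> V" "b \<in> W" "x = a \<oplus>\<^bsub>M\<^esub> b"
        unfolding mem_plus_iff by auto
      moreover from that(2) obtain c d where "c \<in> V" "d \<in> W" "y = c \<oplus>\<^bsub>M\<^esub> d"
        unfolding mem_plus_iff by auto
      ultimately have "x \<oplus>\<^bsub>M\<^esub> y = (a \<oplus>\<^bsub>M\<^esub> c) \<oplus>\<^bsub>M\<^esub> (b \<oplus>\<^bsub>M\<^esub> d)"
        by (simp add: V W M.a_ac)
      with \<open>a \<in> V\<close> \<open>b \<in> W\<close> \<open>c \<in> V\<close> \<open>d \<in> W\<close> show ?thesis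
        unfolding mem_plus_iff using V.m_closed W.m_closed by metis
    qed
    show "r \<odot>\<^bsub>M\<^esub> x \<in> V <+>\<^bsub>M\<^esub> W" if "r \<in> carrier R" "x \<in> V <+>\<^bsub>M\<^esub> W" for r x
      using that by (fastforce simp: set_add_def' smult_r_distr V W)
  qed
qed

lemma (in module) subset_plus:
  assumes "submodule R V M" "submodule R W M"
  shows "V \<subseteq> V <+>\<^bsub>M\<^esub> W" "W \<subseteq> V <+>\<^bsub>M\<^esub> W"
proof -
  interpret V: submodule R V M by fact
  interpret W: submodule R W M by fact
  have V: "x \<in> carrier M" if "x \<in> V" for x using V.subset that by blast
  have W: "x \<in> carrier M" if "x \<in> W" for x using W.subset that by blast
  show "V \<subseteq> V <+>\<^bsub>M\<^esub> W"
    using V W.zero_closed M.r_zero unfolding set_add_def' by (smt (verit) UN_I insertI1 subsetI)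
  show "W \<subseteq> V <+>\<^bsub>M\<^esub> W"
    using W V.zero_closed M.l_zero unfolding set_add_def' by (smt (verit) UN_I insertI1 subsetI)
qed

lemma (in module) plus_least:
  assumes "submodule R U M" "V \<subseteq> U" "W \<subseteq> U" shows "V <+>\<^bsub>M\<^esub> W \<subseteq> U"
  using assms submodule.m_closed[OF assms(1)] by (auto simp: set_add_def')

lemma (in module) submodule_cyclic:
  assumes "y \<in> carrier M" "ideal I R"
  shows "submodule R {a \<odot>\<^bsub>M\<^esub> y |a. a \<in> I} M"
proof -
  interpret I: ideal I R by fact
  have I: "a \<in> carrier R" if "a \<in> I" for a using that by (rule I.Icarr)
  show ?thesis
  proof (rule submodule_criterion)
    show "\<zero>\<^bsub>M\<^esub> \<in> {a \<odot>\<^bsub>M\<^esub> y |a. a \<in> I}"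
      using assms(1) by (auto intro!: exI[of _ "\<zero>"])
    show "u \<oplus>\<^bsub>M\<^esub> v \<in> {a \<odot>\<^bsub>M\<^esub> y |a. a \<in> I}"
      if "u \<in> {a \<odot>\<^bsub>M\<^esub> y |a. a \<in> I}" "v \<in> {a \<odot>\<^bsub>M\<^esub> y |a. a \<in> I}" for u v
      using that assms(1) I I.a_closed by (auto simp: smult_l_distr[symmetric])
    show "r \<odot>\<^bsub>M\<^esub> u \<in> {a \<odot>\<^bsub>M\<^esub> y |a. a \<in> I}"
      if "r \<in> carrier R" "u \<in> {a \<odot>\<^bsub>M\<^esub> y |a. a \<in> I}" for r u
      using that assms(1) I I.I_l_closed by (auto simp: smult_assoc1[symmetric])
  qed (use assms I in auto)
qed

subsection \<open>Products of an ideal and a submodule\<close>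

lemma (in module) submodule_ideal_times:
  assumes "I \<subseteq> carrier R" "N \<subseteq> carrier M"
  shows "submodule R (ideal_times R M I N) M"
  unfolding ideal_times_def by (rule span_is_submodule) (use assms in auto)

lemma (in module) ideal_timesI:
  assumes "I \<subseteq> carrier R" "N \<subseteq> carrier M" "a \<in> I" "x \<in> N"
  shows "a \<odot>\<^bsub>M\<^esub> x \<in> ideal_times R M I N"
  unfolding ideal_times_def
  using in_own_span[of "{r \<odot>\<^bsub>M\<^esub> x |r x. r \<in> I \<and> x \<in> N}"] assms by blast

lemma (in module) ideal_times_least:
  assumes "submodule R W M" "\<And>a x. \<lbrakk>a \<in> I; x \<in> N\<rbrakk> \<Longrightarrow> a \<odot>\<^bsub>M\<^esub> x \<in> W"
  shows "ideal_times R M I N \<subseteq> W"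
  unfolding ideal_times_def by (rule span_is_subset) (use assms in auto)

lemma (in module) ideal_times_mono:
  assumes "I \<subseteq> J" "J \<subseteq> carrier R" "N \<subseteq> P" "P \<subseteq> carrier M"
  shows "ideal_times R M I N \<subseteq> ideal_times R M J P"
  by (rule ideal_times_least) (use assms in \<open>auto intro: submodule_ideal_times ideal_timesI\<close>)

lemma (in module) ideal_times_subset:
  assumes "I \<subseteq> carrier R" "submodule R N M"
  shows "ideal_times R M I N \<subseteq> N"
  by (rule ideal_times_least) (use assms submodule.smult_closed[OF assms(2)] in auto)

lemma ideal_times_image:
  assumes "mod_hom R M N g" "I \<subseteq> carrier R" "V \<subseteq> carrier M" "W \<subseteq> carrier N" "g ` V \<subseteq> W"
    "x \<in> ideal_times R M I V"
  shows "g x \<in> ideal_times R N I W"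
proof -
  interpret g: mod_hom R M N g by fact
  have "g (a \<odot>\<^bsub>M\<^esub> v) \<in> ideal_times R N I W" if "a \<in> I" "v \<in> V" for a v
  proof -
    have "a \<in> carrier R" "v \<in> carrier M" "g v \<in> W" using that assms by auto
    then show ?thesis using that assms by (simp add: g.N.ideal_timesI)
  qed
  then have "ideal_times R M I V \<subseteq> {x \<in> carrier M. g x \<in> ideal_times R N I W}"
    using assms(2-4)
    by (intro g.M.ideal_times_least submodule_vimage[OF assms(1)] g.N.submodule_ideal_times) auto
  then show ?thesis using assms(6) by blast
qed

section \<open>Finite free modules\<close>

context cring
begin

abbreviation unit_vec :: "nat \<Rightarrow> nat \<Rightarrow> nat \<Rightarrow> 'a"
  where "unit_vec n j \<equiv> free_gen R {..<n} j"

lemma module_free_power: "module R (free_power R n)"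
  unfolding free_power_def by (rule func_space_is_module)

lemma carrier_free_power: "carrier (free_power R n) = {..<n} \<rightarrow>\<^sub>E carrier R"
  by (simp add: free_power_def func_space_def)

lemma free_power_coord:
  "j < n \<Longrightarrow> (x \<oplus>\<^bsub>free_power R n\<^esub> y) j = x j \<oplus> y j"
  "j < n \<Longrightarrow> (r \<odot>\<^bsub>free_power R n\<^esub> x) j = r \<otimes> x j"
  "j < n \<Longrightarrow> \<zero>\<^bsub>free_power R n\<^esub> j = \<zero>"
  "\<lbrakk>x \<in> carrier (free_power R n); j < n\<rbrakk> \<Longrightarrow> x j \<in> carrier R"
  by (auto simp: free_power_def func_space_def)

lemma free_power_eqI:
  assumes "x \<in> carrier (free_power R n)" "y \<in> carrier (free_power R n)"
    "\<And>j. j < n \<Longrightarrow> x j = y j"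
  shows "x = y"
  using assms unfolding carrier_free_power by (intro PiE_ext) auto

lemma unit_vec_closed: "unit_vec n j \<in> carrier (free_power R n)"
  by (auto simp: carrier_free_power free_gen_def)

lemma unit_vec_coord: "i < n \<Longrightarrow> unit_vec n j i = (if i = j then \<one> else \<zero>)"
  by (auto simp: free_gen_def)

lemma free_power_submodule_coord:
  assumes W: "submodule R W (free_power R n)" and x: "x \<in> carrier (free_power R n)"
    and xW: "\<And>j. j < n \<Longrightarrow> x j \<odot>\<^bsub>free_power R n\<^esub> unit_vec n j \<in> W"
  shows "x \<in> W"
proof -
  interpret F: module R "free_power R n" by (rule module_free_power)
  interpret W: submodule R W "free_power R n" by (rule W)
  have xc: "x j \<in> carrier R" if "j < n" for j using x that by (simp add: free_power_coord)
  \<comment> \<open>\<open>t k\<close> keeps the first \<open>k\<close> coordinates of \<open>x\<close>\<close>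
  define t where "t k = (\<lambda>j\<in>{..<n}. if j < k then x j else \<zero>)" for k
  have tc: "t k \<in> carrier (free_power R n)" for k
    using xc by (auto simp: t_def carrier_free_power)
  have "k \<le> n \<Longrightarrow> t k \<in> W" for k
  proof (induction k)
    case 0
    have "t 0 = \<zero>\<^bsub>free_power R n\<^esub>"
      by (rule free_power_eqI[OF tc]) (auto simp: t_def free_power_coord)
    then show ?case by simp
  next
    case (Suc k)
    have "t (Suc k) = t k \<oplus>\<^bsub>free_power R n\<^esub> (x k \<odot>\<^bsub>free_power R n\<^esub> unit_vec n k)"
      by (rule free_power_eqI[OF tc])
        (use Suc.prems xc tc in \<open>auto simp: t_def free_power_coord unit_vec_coord unit_vec_closed less_Suc_eq\<close>)
    then show ?case using Suc xW by simp
  qed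
  moreover have "t n = x"
    by (rule free_power_eqI[OF tc x]) (simp add: t_def)
  ultimately show ?thesis by auto
qed

lemma free_power_submodule_all:
  assumes "submodule R W (free_power R n)" "\<And>j. j < n \<Longrightarrow> unit_vec n j \<in> W"
    "x \<in> carrier (free_power R n)"
  shows "x \<in> W"
  by (rule free_power_submodule_coord[OF assms(1,3)])
    (use assms submodule.smult_closed[OF assms(1)] free_power_coord(4) in auto)

lemma free_power_hom_into:
  assumes "mod_hom R (free_power R n) M g" "submodule R W M" "\<And>j. j < n \<Longrightarrow> g (unit_vec n j) \<in> W"
    "x \<in> carrier (free_power R n)"
  shows "g x \<in> W"
  using free_power_submodule_all[OF submodule_vimage[OF assms(1,2)] _ assms(4)] assms(3)
  by (auto simp: unit_vec_closed)

lemma free_power_hom_eq: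
  assumes "mod_hom R (free_power R n) M g" "mod_hom R (free_power R n) M h"
    "\<And>j. j < n \<Longrightarrow> g (unit_vec n j) = h (unit_vec n j)" "x \<in> carrier (free_power R n)"
  shows "g x = h x"
proof -
  interpret g: mod_hom R "free_power R n" M g by fact
  interpret h: mod_hom R "free_power R n" M h by fact
  have "g x \<ominus>\<^bsub>M\<^esub> h x \<in> {\<zero>\<^bsub>M\<^esub>}"
    by (rule free_power_hom_into[OF mod_hom_diff[OF assms(1,2)] g.N.submodule_singleton_zero])
      (use assms(3,4) in \<open>auto simp: unit_vec_closed\<close>)
  then show ?thesis using assms(4) by auto
qed

text \<open>The linear map from \<open>R\<^sup>n\<close> that sends the unit vectors to prescribed images.\<close>

definition lin_comb :: "('a, 'm, 'c) module_scheme \<Rightarrow> nat \<Rightarrow> (nat \<Rightarrow> 'm) \<Rightarrow> (nat \<Rightarrow> 'a) \<Rightarrow> 'm"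
  where "lin_comb M n b x = (\<Oplus>\<^bsub>M\<^esub>j\<in>{..<n}. x j \<odot>\<^bsub>M\<^esub> b j)"

lemma lin_comb_hom:
  assumes "module R M" and b: "\<And>j. j < n \<Longrightarrow> b j \<in> carrier M"
  shows "mod_hom R (free_power R n) M (lin_comb M n b)"
    and "j < n \<Longrightarrow> lin_comb M n b (unit_vec n j) = b j"
proof -
  interpret M: module R M by fact
  interpret F: module R "free_power R n" by (rule module_free_power)
  note c = free_power_coord
  show "mod_hom R (free_power R n) M (lin_comb M n b)"
  proof (rule mod_homI[OF F.module_axioms assms(1)])
    fix x assume x: "x \<in> carrier (free_power R n)"
    show "lin_comb M n b x \<in> carrier M"
      unfolding lin_comb_def by (rule M.finsum_closed) (use b x in \<open>auto simp: c\<close>)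
    { fix y assume y: "y \<in> carrier (free_power R n)"
      have "lin_comb M n b (x \<oplus>\<^bsub>free_power R n\<^esub> y)
          = (\<Oplus>\<^bsub>M\<^esub>j\<in>{..<n}. x j \<odot>\<^bsub>M\<^esub> b j \<oplus>\<^bsub>M\<^esub> y j \<odot>\<^bsub>M\<^esub> b j)"
        unfolding lin_comb_def
        by (rule M.finsum_cong') (use b x y in \<open>auto simp: c M.smult_l_distr\<close>)
      also have "\<dots> = lin_comb M n b x \<oplus>\<^bsub>M\<^esub> lin_comb M n b y"
        unfolding lin_comb_def by (rule M.finsum_addf) (use b x y in \<open>auto simp: c\<close>)
      finally show "lin_comb M n b (x \<oplus>\<^bsub>free_power R n\<^esub> y)
        = lin_comb M n b x \<oplus>\<^bsub>M\<^esub> lin_comb M n b y" . }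
    { fix r assume r: "r \<in> carrier R"
      have "lin_comb M n b (r \<odot>\<^bsub>free_power R n\<^esub> x)
          = (\<Oplus>\<^bsub>M\<^esub>j\<in>{..<n}. r \<odot>\<^bsub>M\<^esub> (x j \<odot>\<^bsub>M\<^esub> b j))"
        unfolding lin_comb_def
        by (rule M.finsum_cong') (use b x r in \<open>auto simp: c M.smult_assoc1\<close>)
      also have "\<dots> = r \<odot>\<^bsub>M\<^esub> lin_comb M n b x"
        unfolding lin_comb_def by (rule M.finsum_smult[symmetric]) (use b x r in \<open>auto simp: c\<close>)
      finally show "lin_comb M n b (r \<odot>\<^bsub>free_power R n\<^esub> x) = r \<odot>\<^bsub>M\<^esub> lin_comb M n b x" . }
  qed
  assume j: "j < n"
  have "lin_comb M n b (unit_vec n j) = (\<Oplus>\<^bsub>M\<^esub>i\<in>{..<n}. if j = i then b i else \<zero>\<^bsub>M\<^esub>)"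
    unfolding lin_comb_def by (rule M.finsum_cong') (use b in \<open>auto simp: unit_vec_coord\<close>)
  also have "\<dots> = b j"
    using j b by (subst M.finsum_singleton) auto
  finally show "lin_comb M n b (unit_vec n j) = b j" .
qed

text \<open>Free modules are projective: it suffices to choose preimages of the images of the unit
  vectors. All chain maps, homotopies and bases below come from this.\<close>

lemma free_power_hom_lift:
  assumes f: "mod_hom R (free_power R k) N f" and g: "mod_hom R M N g"
    and sub: "\<And>x. x \<in> carrier (free_power R k) \<Longrightarrow> f x \<in> g ` carrier M"
  shows "\<exists>h. mod_hom R (free_power R k) M h \<and> (\<forall>x\<in>carrier (free_power R k). g (h x) = f x)"
proof -
  interpret g: mod_hom R M N g by fact
  have "\<exists>y\<in>carrier M. g y = f (unit_vec k j)" for j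
    using sub[OF unit_vec_closed, of j] by (simp add: image_iff) metis
  then obtain b where b: "\<And>j. b j \<in> carrier M" "\<And>j. g (b j) = f (unit_vec k j)" by metis
  let ?h = "lin_comb M k b"
  have h: "mod_hom R (free_power R k) M ?h" "\<And>j. j < k \<Longrightarrow> ?h (unit_vec k j) = b j"
    using lin_comb_hom[OF g.M.module_axioms, of k b] b by auto
  have "g (?h x) = f x" if "x \<in> carrier (free_power R k)" for x
    by (rule free_power_hom_eq[OF mod_hom_comp[OF h(1) g] f _ that]) (simp add: h b)
  with h show ?thesis by blast
qed

text \<open>Membership in \<open>I R\<^sup>n\<close> can be tested on coordinates, which turns minimality of a map between
  free modules into a statement about the entries of its matrix.\<close>

lemma ideal_times_free_power:
  assumes "ideal I R"
  shows "ideal_times R (free_power R n) I (carrier (free_power R n)) =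
    {x \<in> carrier (free_power R n). \<forall>j<n. x j \<in> I}"
proof -
  interpret I: ideal I R by fact
  interpret F: module R "free_power R n" by (rule module_free_power)
  have Ic: "I \<subseteq> carrier R" using I.Icarr by blast
  show ?thesis
  proof
    show "ideal_times R (free_power R n) I (carrier (free_power R n)) \<subseteq>
        {x \<in> carrier (free_power R n). \<forall>j<n. x j \<in> I}"
      by (rule F.ideal_times_least[OF F.submodule_criterion])
        (use Ic I.I_l_closed I.I_r_closed in \<open>auto simp: free_power_coord\<close>)
    show "{x \<in> carrier (free_power R n). \<forall>j<n. x j \<in> I} \<subseteq>
        ideal_times R (free_power R n) I (carrier (free_power R n))"
    proof (intro subsetI, elim CollectE conjE)
      fix x assume x: "x \<in> carrier (free_power R n)" "\<forall>j<n. x j \<in> I"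
      show "x \<in> ideal_times R (free_power R n) I (carrier (free_power R n))"
      proof (rule free_power_submodule_coord[OF F.submodule_ideal_times[OF Ic subset_refl] x(1)])
        fix j assume "j < n"
        with x(2) have "x j \<in> I" by blast
        then show "x j \<odot>\<^bsub>free_power R n\<^esub> unit_vec n j
            \<in> ideal_times R (free_power R n) I (carrier (free_power R n))"
          by (rule F.ideal_timesI[OF Ic subset_refl _ unit_vec_closed])
      qed
    qed
  qed
qed

subsection \<open>Concatenation of vectors\<close>

definition vec_inl :: "nat \<Rightarrow> nat \<Rightarrow> (nat \<Rightarrow> 'a) \<Rightarrow> nat \<Rightarrow> 'a"
  where "vec_inl n k x = (\<lambda>j\<in>{..<n + k}. if j < n then x j else \<zero>)"

definition vec_inr :: "nat \<Rightarrow> nat \<Rightarrow> (nat \<Rightarrow> 'a) \<Rightarrow> nat \<Rightarrow> 'a"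
  where "vec_inr n k y = (\<lambda>j\<in>{..<n + k}. if j < n then \<zero> else y (j - n))"

definition vec_fst :: "nat \<Rightarrow> (nat \<Rightarrow> 'a) \<Rightarrow> nat \<Rightarrow> 'a"
  where "vec_fst n w = (\<lambda>j\<in>{..<n}. w j)"

definition vec_snd :: "nat \<Rightarrow> nat \<Rightarrow> (nat \<Rightarrow> 'a) \<Rightarrow> nat \<Rightarrow> 'a"
  where "vec_snd n k w = (\<lambda>j\<in>{..<k}. w (n + j))"

lemma restrict_free_power:
  "(\<And>j. j < m \<Longrightarrow> g j \<in> carrier R) \<Longrightarrow> (\<lambda>j\<in>{..<m}. g j) \<in> carrier (free_power R m)"
  by (simp add: carrier_free_power restrict_PiE_iff)

lemma vec_homs:
  "mod_hom R (free_power R n) (free_power R (n + k)) (vec_inl n k)"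
  "mod_hom R (free_power R k) (free_power R (n + k)) (vec_inr n k)"
  "mod_hom R (free_power R (n + k)) (free_power R n) (vec_fst n)"
  "mod_hom R (free_power R (n + k)) (free_power R k) (vec_snd n k)"
proof -
  note d = vec_inl_def vec_inr_def vec_fst_def vec_snd_def
  note add = abelian_monoid.a_closed[OF abelian_group.axioms(1)[OF module.axioms(2)[OF module_free_power]]]
  note smult = module.smult_closed[OF module_free_power]
  have c: "vec_inl n k x \<in> carrier (free_power R (n + k))" if "x \<in> carrier (free_power R n)" for x
    unfolding d using that by (intro restrict_free_power) (simp add: free_power_coord)
  show "mod_hom R (free_power R n) (free_power R (n + k)) (vec_inl n k)"
    by (rule mod_homI[OF module_free_power module_free_power c]; (intro free_power_eqI[where n="n+k"])?)
      (simp_all add: c add smult, simp_all add: d free_power_coord)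
  have c: "vec_inr n k x \<in> carrier (free_power R (n + k))" if "x \<in> carrier (free_power R k)" for x
    unfolding d using that by (intro restrict_free_power) (simp add: free_power_coord)
  show "mod_hom R (free_power R k) (free_power R (n + k)) (vec_inr n k)"
    by (rule mod_homI[OF module_free_power module_free_power c]; (intro free_power_eqI[where n="n+k"])?)
      (simp_all add: c add smult, simp_all add: d free_power_coord)
  have c: "vec_fst n x \<in> carrier (free_power R n)" if "x \<in> carrier (free_power R (n + k))" for x
    unfolding d using that by (intro restrict_free_power) (simp add: free_power_coord)
  show "mod_hom R (free_power R (n + k)) (free_power R n) (vec_fst n)"
    by (rule mod_homI[OF module_free_power module_free_power c]; (intro free_power_eqI[where n="n"])?)
      (simp_all add: c add smult, simp_all add: d free_power_coord)
  have c: "vec_snd n k x \<in> carrier (free_power R k)" if "x \<in> carrier (free_power R (n + k))" for x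
    unfolding d using that by (intro restrict_free_power) (simp add: free_power_coord)
  show "mod_hom R (free_power R (n + k)) (free_power R k) (vec_snd n k)"
    by (rule mod_homI[OF module_free_power module_free_power c]; (intro free_power_eqI[where n="k"])?)
      (simp_all add: c add smult, simp_all add: d free_power_coord)
qed

lemma vec_simps:
  "x \<in> carrier (free_power R n) \<Longrightarrow> vec_fst n (vec_inl n k x) = x"
  "x \<in> carrier (free_power R n) \<Longrightarrow> vec_snd n k (vec_inl n k x) = \<zero>\<^bsub>free_power R k\<^esub>"
  "y \<in> carrier (free_power R k) \<Longrightarrow> vec_fst n (vec_inr n k y) = \<zero>\<^bsub>free_power R n\<^esub>"
  "y \<in> carrier (free_power R k) \<Longrightarrow> vec_snd n k (vec_inr n k y) = y"
proof -
  note d = vec_inl_def vec_inr_def vec_fst_def vec_snd_def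
  note zero = abelian_monoid.zero_closed[OF abelian_group.axioms(1)[OF module.axioms(2)[OF module_free_power]]]
  have f: "vec_fst n w \<in> carrier (free_power R n)" if "w \<in> carrier (free_power R (n + k))" for w
    using that by (rule mod_hom.f_im[OF vec_homs(3)])
  note cl = mod_hom.f_im[OF vec_homs(1)] mod_hom.f_im[OF vec_homs(2)] f
    mod_hom.f_im[OF vec_homs(4)] zero
  show "x \<in> carrier (free_power R n) \<Longrightarrow> vec_fst n (vec_inl n k x) = x"
    by (rule free_power_eqI[where n = n], simp_all add: cl) (simp add: d)
  show "x \<in> carrier (free_power R n) \<Longrightarrow> vec_snd n k (vec_inl n k x) = \<zero>\<^bsub>free_power R k\<^esub>"
    by (rule free_power_eqI[where n = k], simp_all add: cl) (simp add: d free_power_coord)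
  show "y \<in> carrier (free_power R k) \<Longrightarrow> vec_fst n (vec_inr n k y) = \<zero>\<^bsub>free_power R n\<^esub>"
    by (rule free_power_eqI[where n = n], simp_all add: cl) (simp add: d free_power_coord)
  show "y \<in> carrier (free_power R k) \<Longrightarrow> vec_snd n k (vec_inr n k y) = y"
    by (rule free_power_eqI[where n = k], simp_all add: cl) (simp add: d)
qed

lemma vec_eqI:
  assumes "w \<in> carrier (free_power R (n + k))" "w' \<in> carrier (free_power R (n + k))"
    "vec_fst n w = vec_fst n w'" "vec_snd n k w = vec_snd n k w'"
  shows "w = w'"
proof (rule free_power_eqI[OF assms(1,2)])
  fix j assume j: "j < n + k"
  show "w j = w' j"
  proof (cases "j < n")
    case True
    then show ?thesis using fun_cong[OF assms(3), of j] by (simp add: vec_fst_def)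
  next
    case False
    moreover from this have "j - n < k" using j by linarith
    ultimately show ?thesis using fun_cong[OF assms(4), of "j - n"] j by (simp add: vec_snd_def)
  qed
qed

end

section \<open>Free resolutions of subquotients\<close>

text \<open>The module that is resolved is \<open>P/(P \<inter> N)\<close>, for submodules \<open>P\<close> and \<open>N\<close> of an ambient module
  \<open>M\<close>, and \<open>\<epsilon>\<close> is a lift to \<open>M\<close> of the augmentation. Speaking of pairs of submodules rather than of
  quotient modules keeps a module inside one type while generators (a larger \<open>P\<close>) and relations (a
  larger \<open>N\<close>) are added to it, so that one can argue by induction along a filtration.\<close>

locale subquotient_resolution = module R M
  for R :: "('a, 'b) ring_scheme" (structure) and M :: "('a, 'm) module" +
  fixes P N :: "'m set" and n :: "nat \<Rightarrow> nat"
    and \<delta> :: "nat \<Rightarrow> (nat \<Rightarrow> 'a) \<Rightarrow> (nat \<Rightarrow> 'a)" and \<epsilon> :: "(nat \<Rightarrow> 'a) \<Rightarrow> 'm"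
  assumes sub_P: "submodule R P M" and sub_N: "submodule R N M"
    and eps_hom: "mod_hom R (free_power R (n 0)) M \<epsilon>"
    and eps_P: "\<And>x. x \<in> carrier (free_power R (n 0)) \<Longrightarrow> \<epsilon> x \<in> P"
    and delta_hom: "\<And>i. mod_hom R (free_power R (n (Suc i))) (free_power R (n i)) (\<delta> i)"
    and eps_gen: "\<And>p. p \<in> P \<Longrightarrow> \<exists>x\<in>carrier (free_power R (n 0)). \<epsilon> x \<ominus>\<^bsub>M\<^esub> p \<in> N"
    and eps_exact: "\<And>x. x \<in> carrier (free_power R (n 0)) \<Longrightarrow>
      \<epsilon> x \<in> N \<longleftrightarrow> x \<in> \<delta> 0 ` carrier (free_power R (n (Suc 0)))"
    and delta_exact: "\<And>i x. x \<in> carrier (free_power R (n (Suc i))) \<Longrightarrow>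
      \<delta> i x = \<zero>\<^bsub>free_power R (n i)\<^esub> \<longleftrightarrow> x \<in> \<delta> (Suc i) ` carrier (free_power R (n (Suc (Suc i))))"
begin

abbreviation F :: "nat \<Rightarrow> ('a, nat \<Rightarrow> 'a) module" where "F i \<equiv> free_power R (n i)"

lemma delta_closed: "x \<in> carrier (F (Suc i)) \<Longrightarrow> \<delta> i x \<in> carrier (F i)"
  using mod_hom.f_im[OF delta_hom] .

lemma delta_delta:
  assumes "x \<in> carrier (F (Suc (Suc i)))"
  shows "\<delta> i (\<delta> (Suc i) x) = \<zero>\<^bsub>F i\<^esub>"
  using assms delta_exact delta_closed by blast

lemma eps_delta:
  assumes "x \<in> carrier (F (Suc 0))"
  shows "\<epsilon> (\<delta> 0 x) \<in> N"
  using assms eps_exact delta_closed by blast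

text \<open>The comparison theorem. The complex \<open>\<kappa>\<close> need not be exact: the lift is constructed degree by
  degree, using exactness of the target and projectivity of the source.\<close>

lemma lift_chain_map:
  fixes k :: "nat \<Rightarrow> nat"
  assumes \<kappa>: "\<And>i. mod_hom R (free_power R (k (Suc i))) (free_power R (k i)) (\<kappa> i)"
    and \<kappa>\<kappa>: "\<And>i x. x \<in> carrier (free_power R (k (Suc (Suc i)))) \<Longrightarrow>
      \<kappa> i (\<kappa> (Suc i) x) = \<zero>\<^bsub>free_power R (k i)\<^esub>"
    and \<alpha>: "mod_hom R (free_power R (k 0)) M \<alpha>"
    and \<alpha>P: "\<And>x. x \<in> carrier (free_power R (k 0)) \<Longrightarrow> \<alpha> x \<in> P"
    and \<alpha>N: "\<And>x. x \<in> carrier (free_power R (k (Suc 0))) \<Longrightarrow> \<alpha> (\<kappa> 0 x) \<in> N"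
  shows "\<exists>\<phi>. (\<forall>i. mod_hom R (free_power R (k i)) (F i) (\<phi> i)) \<and>
    (\<forall>x\<in>carrier (free_power R (k 0)). \<epsilon> (\<phi> 0 x) \<ominus>\<^bsub>M\<^esub> \<alpha> x \<in> N) \<and>
    (\<forall>i. \<forall>x\<in>carrier (free_power R (k (Suc i))). \<delta> i (\<phi> (Suc i) x) = \<phi> i (\<kappa> i x))"
proof -
  let ?K = "\<lambda>i. free_power R (k i)"
  interpret e: mod_hom R "F 0" M \<epsilon> by (rule eps_hom)
  interpret d: mod_hom R "F (Suc i)" "F i" "\<delta> i" for i by (rule delta_hom)
  interpret K: mod_hom R "?K (Suc i)" "?K i" "\<kappa> i" for i by (rule \<kappa>)
  interpret a: mod_hom R "?K 0" M \<alpha> by (rule \<alpha>)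
  \<comment> \<open>the invariant of the recursion: a lift in degree \<open>i\<close> sends boundaries to boundaries, which is
    what the next degree needs\<close>
  define good where "good i \<psi> \<longleftrightarrow> mod_hom R (?K i) (F i) \<psi> \<and>
      (i = 0 \<longrightarrow> (\<forall>x\<in>carrier (?K 0). \<epsilon> (\<psi> x) \<ominus>\<^bsub>M\<^esub> \<alpha> x \<in> N)) \<and>
      (\<forall>x\<in>carrier (?K (Suc i)). \<psi> (\<kappa> i x) \<in> \<delta> i ` carrier (F (Suc i)))" for i \<psi>
  have "\<exists>\<phi>. \<forall>i. good i (\<phi> i) \<and> (\<forall>x\<in>carrier (?K (Suc i)). \<delta> i (\<phi> (Suc i) x) = \<phi> i (\<kappa> i x))"
  proof (rule dependent_nat_choice)
    have "\<forall>j. \<exists>y\<in>carrier (F 0). \<epsilon> y \<ominus>\<^bsub>M\<^esub> \<alpha> (unit_vec (k 0) j) \<in> N"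
      using eps_gen \<alpha>P unit_vec_closed by blast
    then obtain b where b: "\<And>j. b j \<in> carrier (F 0)"
      "\<And>j. \<epsilon> (b j) \<ominus>\<^bsub>M\<^esub> \<alpha> (unit_vec (k 0) j) \<in> N" by metis
    let ?h = "lin_comb (F 0) (k 0) b"
    have h: "mod_hom R (?K 0) (F 0) ?h" "\<And>j. j < k 0 \<Longrightarrow> ?h (unit_vec (k 0) j) = b j"
      using lin_comb_hom[OF module_free_power, of "k 0" b] b by auto
    interpret h: mod_hom R "?K 0" "F 0" ?h by (rule h)
    have hN: "\<epsilon> (?h x) \<ominus>\<^bsub>M\<^esub> \<alpha> x \<in> N" if "x \<in> carrier (?K 0)" for x
      by (rule free_power_hom_into[OF mod_hom_diff[OF mod_hom_comp[OF h(1) eps_hom] \<alpha>] sub_N _ that])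
        (simp add: h b)
    have "\<epsilon> (?h (\<kappa> 0 x)) \<in> N" if "x \<in> carrier (?K (Suc 0))" for x
      using submodule_diff_iff[OF sub_N _ _ hN] \<alpha>N that by auto
    then have "good 0 ?h" using h(1) hN eps_exact unfolding good_def by auto
    then show "\<exists>\<psi>. good 0 \<psi>" by blast
  next
    fix \<psi> i assume good: "good i \<psi>"
    then interpret psi: mod_hom R "?K i" "F i" \<psi> by (simp add: good_def)
    obtain h where h: "mod_hom R (?K (Suc i)) (F (Suc i)) h"
      "\<And>x. x \<in> carrier (?K (Suc i)) \<Longrightarrow> \<delta> i (h x) = \<psi> (\<kappa> i x)"
      using free_power_hom_lift[OF mod_hom_comp[OF \<kappa> psi.mod_hom_axioms] delta_hom] good
      unfolding good_def by blast
    interpret h: mod_hom R "?K (Suc i)" "F (Suc i)" h by (rule h)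
    have "h (\<kappa> (Suc i) x) \<in> \<delta> (Suc i) ` carrier (F (Suc (Suc i)))"
      if "x \<in> carrier (?K (Suc (Suc i)))" for x
      using delta_exact[of "h (\<kappa> (Suc i) x)" i] h(2) \<kappa>\<kappa> that by auto
    then show "\<exists>\<psi>'. good (Suc i) \<psi>' \<and> (\<forall>x\<in>carrier (?K (Suc i)). \<delta> i (\<psi>' x) = \<psi> (\<kappa> i x))"
      using h unfolding good_def by auto
  qed
  then obtain \<phi> where \<phi>: "\<And>i. good i (\<phi> i)"
    "\<And>i x. x \<in> carrier (?K (Suc i)) \<Longrightarrow> \<delta> i (\<phi> (Suc i) x) = \<phi> i (\<kappa> i x)" by blast
  then show ?thesis unfolding good_def by (intro exI[of _ \<phi>]) auto
qed

text \<open>A chain map into a resolution that induces the zero map on the resolved modules is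
  null-homotopic. As before, each component of the homotopy exists because the map which it has to lift
  takes values in the boundaries.\<close>

lemma null_homotopy:
  fixes g :: "nat \<Rightarrow> nat"
  assumes \<gamma>: "\<And>i. mod_hom R (free_power R (g (Suc i))) (free_power R (g i)) (\<gamma> i)"
    and \<gamma>\<gamma>: "\<And>i x. x \<in> carrier (free_power R (g (Suc (Suc i)))) \<Longrightarrow>
      \<gamma> i (\<gamma> (Suc i) x) = \<zero>\<^bsub>free_power R (g i)\<^esub>"
    and \<phi>: "\<And>i. mod_hom R (free_power R (g i)) (F i) (\<phi> i)"
    and \<phi>N: "\<And>x. x \<in> carrier (free_power R (g 0)) \<Longrightarrow> \<epsilon> (\<phi> 0 x) \<in> N"
    and chain: "\<And>i x. x \<in> carrier (free_power R (g (Suc i))) \<Longrightarrow> \<delta> i (\<phi> (Suc i) x) = \<phi> i (\<gamma> i x)"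
  shows "\<exists>s. (\<forall>i. mod_hom R (free_power R (g i)) (F (Suc i)) (s i)) \<and>
    (\<forall>x\<in>carrier (free_power R (g 0)). \<phi> 0 x = \<delta> 0 (s 0 x)) \<and>
    (\<forall>i. \<forall>x\<in>carrier (free_power R (g (Suc i))).
       \<phi> (Suc i) x = \<delta> (Suc i) (s (Suc i) x) \<oplus>\<^bsub>F (Suc i)\<^esub> s i (\<gamma> i x))"
proof -
  let ?G = "\<lambda>i. free_power R (g i)"
  interpret e: mod_hom R "F 0" M \<epsilon> by (rule eps_hom)
  interpret d: mod_hom R "F (Suc i)" "F i" "\<delta> i" for i by (rule delta_hom)
  interpret G: mod_hom R "?G (Suc i)" "?G i" "\<gamma> i" for i by (rule \<gamma>)
  interpret p: mod_hom R "?G i" "F i" "\<phi> i" for i by (rule \<phi>)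
  define good where "good i s \<longleftrightarrow> mod_hom R (?G i) (F (Suc i)) s \<and>
      (i = 0 \<longrightarrow> (\<forall>x\<in>carrier (?G 0). \<delta> 0 (s x) = \<phi> 0 x)) \<and>
      (\<forall>x\<in>carrier (?G (Suc i)). \<phi> (Suc i) x \<ominus>\<^bsub>F (Suc i)\<^esub> s (\<gamma> i x)
         \<in> \<delta> (Suc i) ` carrier (F (Suc (Suc i))))" for i s
  have "\<exists>s. \<forall>i. good i (s i) \<and> (\<forall>x\<in>carrier (?G (Suc i)).
      \<delta> (Suc i) (s (Suc i) x) = \<phi> (Suc i) x \<ominus>\<^bsub>F (Suc i)\<^esub> s i (\<gamma> i x))"
  proof (rule dependent_nat_choice)
    obtain h where h: "mod_hom R (?G 0) (F (Suc 0)) h"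
      "\<And>x. x \<in> carrier (?G 0) \<Longrightarrow> \<delta> 0 (h x) = \<phi> 0 x"
      using free_power_hom_lift[OF \<phi>[of 0] delta_hom[of 0]] \<phi>N eps_exact by auto
    interpret h: mod_hom R "?G 0" "F (Suc 0)" h by (rule h)
    have "\<phi> (Suc 0) x \<ominus>\<^bsub>F (Suc 0)\<^esub> h (\<gamma> 0 x) \<in> \<delta> (Suc 0) ` carrier (F (Suc (Suc 0)))"
      if x: "x \<in> carrier (?G (Suc 0))" for x
      using delta_exact[of "\<phi> (Suc 0) x \<ominus>\<^bsub>F (Suc 0)\<^esub> h (\<gamma> 0 x)" 0] x chain h(2) by auto
    then show "\<exists>s. good 0 s" using h unfolding good_def by auto
  next
    fix s i assume good: "good i s"
    then interpret s: mod_hom R "?G i" "F (Suc i)" s by (simp add: good_def)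
    obtain h where h: "mod_hom R (?G (Suc i)) (F (Suc (Suc i))) h"
      "\<And>x. x \<in> carrier (?G (Suc i)) \<Longrightarrow>
        \<delta> (Suc i) (h x) = \<phi> (Suc i) x \<ominus>\<^bsub>F (Suc i)\<^esub> s (\<gamma> i x)"
      using free_power_hom_lift[OF mod_hom_diff[OF \<phi>[of "Suc i"] mod_hom_comp[OF \<gamma> s.mod_hom_axioms]]
          delta_hom] good
      unfolding good_def by blast
    interpret h: mod_hom R "?G (Suc i)" "F (Suc (Suc i))" h by (rule h)
    have "\<phi> (Suc (Suc i)) x \<ominus>\<^bsub>F (Suc (Suc i))\<^esub> h (\<gamma> (Suc i) x)
        \<in> \<delta> (Suc (Suc i)) ` carrier (F (Suc (Suc (Suc i))))"
      if x: "x \<in> carrier (?G (Suc (Suc i)))" for x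
    proof -
      have "\<delta> (Suc i) (h (\<gamma> (Suc i) x)) = \<phi> (Suc i) (\<gamma> (Suc i) x)"
        using h(2)[of "\<gamma> (Suc i) x"] \<gamma>\<gamma>[OF x] x by (simp add: d.N.M.minus_eq)
      then show ?thesis
        using delta_exact[of "\<phi> (Suc (Suc i)) x \<ominus>\<^bsub>F (Suc (Suc i))\<^esub> h (\<gamma> (Suc i) x)" "Suc i"]
          x chain[OF x] by simp
    qed
    then show "\<exists>s'. good (Suc i) s' \<and> (\<forall>x\<in>carrier (?G (Suc i)).
        \<delta> (Suc i) (s' x) = \<phi> (Suc i) x \<ominus>\<^bsub>F (Suc i)\<^esub> s (\<gamma> i x))"
      using h unfolding good_def by auto
  qed
  then obtain s where s: "\<And>i. good i (s i)" "\<And>i x. x \<in> carrier (?G (Suc i)) \<Longrightarrow>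
      \<delta> (Suc i) (s (Suc i) x) = \<phi> (Suc i) x \<ominus>\<^bsub>F (Suc i)\<^esub> s i (\<gamma> i x)" by blast
  then interpret s: mod_hom R "?G i" "F (Suc i)" "s i" for i by (simp add: good_def)
  have "\<phi> (Suc i) x = \<delta> (Suc i) (s (Suc i) x) \<oplus>\<^bsub>F (Suc i)\<^esub> s i (\<gamma> i x)"
    if "x \<in> carrier (?G (Suc i))" for i x
    using that s(2) by (simp add: d.N.M.minus_eq d.N.M.a_assoc d.N.M.l_neg)
  then show ?thesis using s unfolding good_def by (intro exI[of _ s]) auto
qed

end

section \<open>Building minimal resolutions\<close>

lemma (in abelian_group) minus_telescope:
  assumes "z \<in> carrier G" "a \<in> carrier G" "c \<in> carrier G" "e \<in> carrier G"
  shows "z \<oplus> (\<ominus> (a \<ominus> c) \<oplus> \<ominus> (e \<ominus> a)) = (z \<oplus> c) \<ominus> e"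
proof -
  have "\<ominus> (a \<ominus> c) = c \<oplus> \<ominus> a" "\<ominus> (e \<ominus> a) = a \<oplus> \<ominus> e"
    using assms by (simp_all add: minus_eq minus_add a_comm)
  then show ?thesis using assms by (simp add: minus_eq a_assoc r_neg1)
qed

lemma (in cring) module_regular: "module R (regular_module R)"
  by (rule module_criteria)
    (auto simp: regular_module_def is_cring a_ac m_assoc l_distr r_distr
      intro!: bexI[of _ "\<ominus> _"] r_neg)

lemma regular_module_simps:
  "carrier (regular_module R) = carrier R" "x \<oplus>\<^bsub>regular_module R\<^esub> y = x \<oplus>\<^bsub>R\<^esub> y"
  "a \<odot>\<^bsub>regular_module R\<^esub> x = a \<otimes>\<^bsub>R\<^esub> x" "\<zero>\<^bsub>regular_module R\<^esub> = \<zero>\<^bsub>R\<^esub>"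
  by (simp_all add: regular_module_def)

lemma (in cring) regular_module_minus:
  assumes "x \<in> carrier R" "y \<in> carrier R"
  shows "x \<ominus>\<^bsub>regular_module R\<^esub> y = x \<ominus> y"
proof -
  interpret M: module R "regular_module R" by (rule module_regular)
  have "\<ominus>\<^bsub>regular_module R\<^esub> y = \<ominus> y"
    using assms by (intro M.minus_equality) (auto simp: regular_module_simps l_neg)
  then show ?thesis by (simp add: M.minus_eq minus_eq regular_module_simps)
qed

lemma (in cring) submodule_regular:
  assumes "ideal I R" shows "submodule R I (regular_module R)"
proof -
  interpret I: ideal I R by fact
  interpret M: module R "regular_module R" by (rule module_regular)
  show ?thesis
    by (rule M.submodule_criterion) (auto simp: regular_module_simps I.Icarr I.I_l_closed)
qed

lemma (in module) smult_left_hom: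
  assumes "y \<in> carrier M"
  shows "mod_hom R (regular_module R) M (\<lambda>a. a \<odot>\<^bsub>M\<^esub> y)"
  by (rule mod_homI) (use assms module_regular module_axioms in
      \<open>auto simp: regular_module_simps smult_l_distr smult_assoc1\<close>)

text \<open>The matrix of \<open>g\<close> has its entries in \<open>J\<close>.\<close>

definition minimal_map :: "('a, 'b) ring_scheme \<Rightarrow> 'a set \<Rightarrow> nat \<Rightarrow> nat \<Rightarrow> ((nat \<Rightarrow> 'a) \<Rightarrow> nat \<Rightarrow> 'a) \<Rightarrow> bool"
  where "minimal_map R J k n g \<longleftrightarrow> (\<forall>x\<in>carrier (free_power R k).
    g x \<in> ideal_times R (free_power R n) J (carrier (free_power R n)))"

locale minimal_resolution = subquotient_resolution +
  fixes J :: "'a set"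
  assumes J_ideal: "ideal J R"
    and delta_minimal: "\<And>i. minimal_map R J (n (Suc i)) (n i) (\<delta> i)"

lemma minimal_resolutionI:
  assumes "module R M" "submodule R P M" "submodule R N M" "mod_hom R (free_power R (n 0)) M \<epsilon>"
    "\<And>x. x \<in> carrier (free_power R (n 0)) \<Longrightarrow> \<epsilon> x \<in> P"
    "\<And>i. mod_hom R (free_power R (n (Suc i))) (free_power R (n i)) (\<delta> i)"
    "\<And>p. p \<in> P \<Longrightarrow> \<exists>x\<in>carrier (free_power R (n 0)). \<epsilon> x \<ominus>\<^bsub>M\<^esub> p \<in> N"
    "\<And>x. x \<in> carrier (free_power R (n 0)) \<Longrightarrow>
      \<epsilon> x \<in> N \<longleftrightarrow> x \<in> \<delta> 0 ` carrier (free_power R (n (Suc 0)))"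
    "\<And>i x. x \<in> carrier (free_power R (n (Suc i))) \<Longrightarrow>
      \<delta> i x = \<zero>\<^bsub>free_power R (n i)\<^esub> \<longleftrightarrow> x \<in> \<delta> (Suc i) ` carrier (free_power R (n (Suc (Suc i))))"
    "ideal J R" "\<And>i. minimal_map R J (n (Suc i)) (n i) (\<delta> i)"
  shows "minimal_resolution R M P N n \<delta> \<epsilon> J"
  using assms
  by (intro minimal_resolution.intro subquotient_resolution.intro subquotient_resolution_axioms.intro
      minimal_resolution_axioms.intro)

definition has_minimal_resolution ::
    "('a, 'b) ring_scheme \<Rightarrow> 'a set \<Rightarrow> ('a, 'm) module \<Rightarrow> 'm set \<Rightarrow> 'm set \<Rightarrow> (nat \<Rightarrow> nat) \<Rightarrow> bool"
  where "has_minimal_resolution R J M P N n \<longleftrightarrow> (\<exists>\<delta> \<epsilon>. minimal_resolution R M P N n \<delta> \<epsilon> J)"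

context cring
begin

lemma free_power_0: "x \<in> carrier (free_power R 0) \<Longrightarrow> x = \<zero>\<^bsub>free_power R 0\<^esub>"
  by (rule free_power_eqI) (auto intro: abelian_monoid.zero_closed[OF abelian_group.axioms(1)[OF module.axioms(2)[OF module_free_power]]])

lemma submodule_ideal_times_free_power:
  assumes "ideal J R"
  shows "submodule R (ideal_times R (free_power R n) J (carrier (free_power R n))) (free_power R n)"
proof -
  interpret J: ideal J R by fact
  show ?thesis by (rule module.submodule_ideal_times[OF module_free_power J.a_subset subset_refl])
qed

lemma minimal_map_zero:
  assumes "ideal J R" shows "minimal_map R J k n (\<lambda>x. \<zero>\<^bsub>free_power R n\<^esub>)"
  using submodule.zero_closed[OF submodule_ideal_times_free_power[OF assms]] by (auto simp: minimal_map_def)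

lemma minimal_map_plus:
  assumes "ideal J R" "minimal_map R J k n g" "minimal_map R J k n h"
  shows "minimal_map R J k n (\<lambda>x. g x \<oplus>\<^bsub>free_power R n\<^esub> h x)"
  using assms(2,3) submodule.m_closed[OF submodule_ideal_times_free_power[OF assms(1)]]
  by (auto simp: minimal_map_def)

lemma minimal_map_diff:
  assumes "ideal J R" "minimal_map R J k n g" "minimal_map R J k n h"
  shows "minimal_map R J k n (\<lambda>x. g x \<ominus>\<^bsub>free_power R n\<^esub> h x)"
  using assms(2,3) module.submodule_diff[OF module_free_power submodule_ideal_times_free_power[OF assms(1)]]
  by (auto simp: minimal_map_def)

lemma minimal_map_scale:
  assumes "ideal J R" "minimal_map R J k n g" "a \<in> carrier R"
  shows "minimal_map R J k n (\<lambda>x. a \<odot>\<^bsub>free_power R n\<^esub> g x)"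
  using assms(2,3) submodule.smult_closed[OF submodule_ideal_times_free_power[OF assms(1)]]
  by (auto simp: minimal_map_def)

lemma minimal_map_scale_ideal:
  assumes "ideal J R" "mod_hom R (free_power R k) (free_power R n) g" "a \<in> J"
  shows "minimal_map R J k n (\<lambda>x. a \<odot>\<^bsub>free_power R n\<^esub> g x)"
proof -
  interpret g: mod_hom R "free_power R k" "free_power R n" g by fact
  interpret J: ideal J R by fact
  show ?thesis unfolding minimal_map_def
    using assms(3) J.Icarr by (auto intro!: g.N.ideal_timesI)
qed

lemma minimal_map_comp:
  assumes "ideal J R" "minimal_map R J k n g" "mod_hom R (free_power R l) (free_power R k) p"
    "mod_hom R (free_power R n) (free_power R m) q"
  shows "minimal_map R J l m (\<lambda>x. q (g (p x)))"
proof -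
  interpret p: mod_hom R "free_power R l" "free_power R k" p by fact
  interpret q: mod_hom R "free_power R n" "free_power R m" q by fact
  interpret J: ideal J R by fact
  show ?thesis unfolding minimal_map_def
    using assms(2) J.Icarr by (auto simp: minimal_map_def intro!: ideal_times_image[OF assms(4)])
qed

text \<open>The resolution of a free module by itself is needed for the ring (\<open>m = 1\<close>) and for the zero
  module (\<open>m = 0\<close>), where inductions start, and for arbitrary \<open>m\<close> in the invariance of the rank.\<close>

lemma minimal_resolution_free:
  assumes "ideal J R" "submodule R P M" "submodule R N M" "mod_hom R (free_power R m) M \<epsilon>"
    "\<And>x. x \<in> carrier (free_power R m) \<Longrightarrow> \<epsilon> x \<in> P"
    "\<And>p. p \<in> P \<Longrightarrow> \<exists>x\<in>carrier (free_power R m). \<epsilon> x \<ominus>\<^bsub>M\<^esub> p \<in> N"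
    "\<And>x. x \<in> carrier (free_power R m) \<Longrightarrow> \<epsilon> x \<in> N \<longleftrightarrow> x = \<zero>\<^bsub>free_power R m\<^esub>"
  shows "has_minimal_resolution R J M P N (\<lambda>i. if i = 0 then m else 0)"
proof -
  let ?n = "\<lambda>i::nat. if i = 0 then m else 0"
  let ?\<delta> = "\<lambda>i (x::nat \<Rightarrow> 'a). \<zero>\<^bsub>free_power R (?n i)\<^esub>"
  interpret e: mod_hom R "free_power R m" M \<epsilon> by fact
  interpret F: module R "free_power R k" for k by (rule module_free_power)
  have ne: "carrier (free_power R k) \<noteq> {}" for k using F.M.zero_closed by blast
  have "minimal_resolution R M P N ?n ?\<delta> \<epsilon> J"
  proof (rule minimal_resolutionI)
    show "module R M" by (rule e.N.module_axioms)
    fix i x assume "x \<in> carrier (free_power R (?n (Suc i)))"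
    then have "x = \<zero>\<^bsub>free_power R 0\<^esub>" by (simp add: free_power_0)
    then show "?\<delta> i x = \<zero>\<^bsub>free_power R (?n i)\<^esub> \<longleftrightarrow>
        x \<in> ?\<delta> (Suc i) ` carrier (free_power R (?n (Suc (Suc i))))"
      using ne by auto
  qed (use assms ne in \<open>auto intro!: mod_hom_zero module_free_power minimal_map_zero\<close>)
  then show ?thesis unfolding has_minimal_resolution_def by blast
qed

end

context minimal_resolution
begin

text \<open>Let \<open>I\<close> annihilate the resolved module. Then multiplication by \<open>y\<close> is a linear map to it from \<open>R/I\<close>,
  and it has a lift to a map of resolutions. If \<open>y\<close> lies in \<open>J P\<close>, the lift can be chosen with entries in
  \<open>J\<close>: the elements \<open>y\<close> for which there is such a lift form a submodule, and for \<open>y = a p\<close> with \<open>a\<close> in \<open>J\<close>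
  one can take \<open>a\<close> times any lift of the multiplication by \<open>p\<close>.\<close>

lemma lift_minimal_map:
  assumes K: "subquotient_resolution R (regular_module R) (carrier R) I k \<kappa> \<eta>"
    and I: "\<And>a p. \<lbrakk>a \<in> I; p \<in> P\<rbrakk> \<Longrightarrow> a \<odot>\<^bsub>M\<^esub> p \<in> N"
    and y: "y \<in> ideal_times R M J P"
  shows "\<exists>\<phi>. (\<forall>i. mod_hom R (free_power R (k i)) (F i) (\<phi> i) \<and> minimal_map R J (k i) (n i) (\<phi> i)) \<and>
    (\<forall>x\<in>carrier (free_power R (k 0)). \<epsilon> (\<phi> 0 x) \<ominus>\<^bsub>M\<^esub> \<eta> x \<odot>\<^bsub>M\<^esub> y \<in> N) \<and>
    (\<forall>i. \<forall>x\<in>carrier (free_power R (k (Suc i))). \<delta> i (\<phi> (Suc i) x) = \<phi> i (\<kappa> i x))"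
proof -
  let ?K = "\<lambda>i. free_power R (k i)"
  interpret K: subquotient_resolution R "regular_module R" "carrier R" I k \<kappa> \<eta> by fact
  interpret J: ideal J R by (rule J_ideal)
  interpret e: mod_hom R "F 0" M \<epsilon> by (rule eps_hom)
  interpret d: mod_hom R "F (Suc i)" "F i" "\<delta> i" for i by (rule delta_hom)
  interpret Kd: mod_hom R "?K (Suc i)" "?K i" "\<kappa> i" for i by (rule K.delta_hom)
  interpret Ke: mod_hom R "?K 0" "regular_module R" "\<eta>" by (rule K.eps_hom)
  interpret P: submodule R P M by (rule sub_P)
  interpret N: submodule R N M by (rule sub_N)
  have eta: "\<eta> x \<in> carrier R" if "x \<in> carrier (?K 0)" for x
    using Ke.f_im[OF that] by (simp add: regular_module_simps)
  have Pc: "p \<in> carrier M" if "p \<in> P" for p using P.subset that by blast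
  define good where "good y \<phi> \<longleftrightarrow>
    (\<forall>i. mod_hom R (?K i) (F i) (\<phi> i) \<and> minimal_map R J (k i) (n i) (\<phi> i)) \<and>
    (\<forall>x\<in>carrier (?K 0). \<epsilon> (\<phi> 0 x) \<ominus>\<^bsub>M\<^esub> \<eta> x \<odot>\<^bsub>M\<^esub> y \<in> N) \<and>
    (\<forall>i. \<forall>x\<in>carrier (?K (Suc i)). \<delta> i (\<phi> (Suc i) x) = \<phi> i (\<kappa> i x))" for y \<phi>
  let ?W = "{y \<in> P. \<exists>\<phi>. good y \<phi>}"
  have zeroW: "\<zero>\<^bsub>M\<^esub> \<in> ?W"
  proof -
    have "good \<zero>\<^bsub>M\<^esub> (\<lambda>i x. \<zero>\<^bsub>F i\<^esub>)"
      using submodule_neg[OF sub_N submodule.zero_closed[OF sub_N]] eta J_ideal unfolding good_def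
      by (auto simp: M.minus_eq intro!: mod_hom_zero module_free_power minimal_map_zero)
    then show ?thesis by auto
  qed
  have addW: "x \<oplus>\<^bsub>M\<^esub> y \<in> ?W" if "x \<in> ?W" "y \<in> ?W" for x y
  proof -
    from that obtain \<phi> \<psi> where g: "good x \<phi>" "good y \<psi>" "x \<in> P" "y \<in> P" by blast
    then interpret p: mod_hom R "?K i" "F i" "\<phi> i" for i by (simp add: good_def)
    from g interpret q: mod_hom R "?K i" "F i" "\<psi> i" for i by (simp add: good_def)
    have "\<epsilon> (\<phi> 0 z \<oplus>\<^bsub>F 0\<^esub> \<psi> 0 z) \<ominus>\<^bsub>M\<^esub> \<eta> z \<odot>\<^bsub>M\<^esub> (x \<oplus>\<^bsub>M\<^esub> y) \<in> N" if "z \<in> carrier (?K 0)" for z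
    proof -
      have "\<epsilon> (\<phi> 0 z \<oplus>\<^bsub>F 0\<^esub> \<psi> 0 z) \<ominus>\<^bsub>M\<^esub> \<eta> z \<odot>\<^bsub>M\<^esub> (x \<oplus>\<^bsub>M\<^esub> y) =
          (\<epsilon> (\<phi> 0 z) \<ominus>\<^bsub>M\<^esub> \<eta> z \<odot>\<^bsub>M\<^esub> x) \<oplus>\<^bsub>M\<^esub> (\<epsilon> (\<psi> 0 z) \<ominus>\<^bsub>M\<^esub> \<eta> z \<odot>\<^bsub>M\<^esub> y)"
        using that g(3,4) Pc eta by (simp add: smult_r_distr M.minus_eq M.minus_add M.a_ac)
      then show ?thesis using g that unfolding good_def by auto
    qed
    then have "good (x \<oplus>\<^bsub>M\<^esub> y) (\<lambda>i z. \<phi> i z \<oplus>\<^bsub>F i\<^esub> \<psi> i z)"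
      using g J_ideal unfolding good_def by (auto intro!: mod_hom_plus minimal_map_plus)
    with g show ?thesis by auto
  qed
  have smultW: "a \<odot>\<^bsub>M\<^esub> x \<in> ?W" if "a \<in> carrier R" "x \<in> ?W" for a x
  proof -
    from that(2) obtain \<phi> where g: "good x \<phi>" "x \<in> P" by blast
    then interpret p: mod_hom R "?K i" "F i" "\<phi> i" for i by (simp add: good_def)
    have "\<epsilon> (a \<odot>\<^bsub>F 0\<^esub> \<phi> 0 z) \<ominus>\<^bsub>M\<^esub> \<eta> z \<odot>\<^bsub>M\<^esub> (a \<odot>\<^bsub>M\<^esub> x) \<in> N" if "z \<in> carrier (?K 0)" for z
    proof -
      have "\<epsilon> (a \<odot>\<^bsub>F 0\<^esub> \<phi> 0 z) \<ominus>\<^bsub>M\<^esub> \<eta> z \<odot>\<^bsub>M\<^esub> (a \<odot>\<^bsub>M\<^esub> x) = a \<odot>\<^bsub>M\<^esub> (\<epsilon> (\<phi> 0 z) \<ominus>\<^bsub>M\<^esub> \<eta> z \<odot>\<^bsub>M\<^esub> x)"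
        using that g(2) Pc eta \<open>a \<in> carrier R\<close>
        by (simp add: smult_r_distr M.minus_eq smult_r_minus smult_assoc1[symmetric] R.m_comm)
      then show ?thesis using g that \<open>a \<in> carrier R\<close> unfolding good_def by auto
    qed
    then have "good (a \<odot>\<^bsub>M\<^esub> x) (\<lambda>i z. a \<odot>\<^bsub>F i\<^esub> \<phi> i z)"
      using g J_ideal \<open>a \<in> carrier R\<close> unfolding good_def
      by (auto intro!: mod_hom_scale minimal_map_scale)
    with g \<open>a \<in> carrier R\<close> show ?thesis by auto
  qed
  have subW: "submodule R ?W M"
    by (rule submodule_criterion) (use zeroW addW smultW Pc in auto)
  have JW: "a \<odot>\<^bsub>M\<^esub> p \<in> ?W" if a: "a \<in> J" and p: "p \<in> P" for a p
  proof -
    have ac: "a \<in> carrier R" using a J.Icarr by blast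
    have "\<exists>\<phi>. (\<forall>i. mod_hom R (?K i) (F i) (\<phi> i)) \<and>
      (\<forall>x\<in>carrier (?K 0). \<epsilon> (\<phi> 0 x) \<ominus>\<^bsub>M\<^esub> \<eta> x \<odot>\<^bsub>M\<^esub> p \<in> N) \<and>
      (\<forall>i. \<forall>x\<in>carrier (?K (Suc i)). \<delta> i (\<phi> (Suc i) x) = \<phi> i (\<kappa> i x))"
    proof (rule lift_chain_map)
      show "mod_hom R (?K 0) M (\<lambda>x. \<eta> x \<odot>\<^bsub>M\<^esub> p)"
        by (rule mod_hom_comp[OF K.eps_hom smult_left_hom]) (use p Pc in auto)
      show "\<eta> (\<kappa> 0 x) \<odot>\<^bsub>M\<^esub> p \<in> N" if "x \<in> carrier (?K (Suc 0))" for x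
        using I[OF _ p] K.eps_delta that by blast
    qed (use K.delta_hom K.delta_delta eta p in auto)
    then obtain \<phi> where \<phi>: "\<And>i. mod_hom R (?K i) (F i) (\<phi> i)"
      "\<And>x. x \<in> carrier (?K 0) \<Longrightarrow> \<epsilon> (\<phi> 0 x) \<ominus>\<^bsub>M\<^esub> \<eta> x \<odot>\<^bsub>M\<^esub> p \<in> N"
      "\<And>i x. x \<in> carrier (?K (Suc i)) \<Longrightarrow> \<delta> i (\<phi> (Suc i) x) = \<phi> i (\<kappa> i x)" by blast
    interpret p: mod_hom R "?K i" "F i" "\<phi> i" for i by (rule \<phi>)
    have "\<epsilon> (a \<odot>\<^bsub>F 0\<^esub> \<phi> 0 z) \<ominus>\<^bsub>M\<^esub> \<eta> z \<odot>\<^bsub>M\<^esub> (a \<odot>\<^bsub>M\<^esub> p) \<in> N" if "z \<in> carrier (?K 0)" for z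
    proof -
      have "\<epsilon> (a \<odot>\<^bsub>F 0\<^esub> \<phi> 0 z) \<ominus>\<^bsub>M\<^esub> \<eta> z \<odot>\<^bsub>M\<^esub> (a \<odot>\<^bsub>M\<^esub> p) = a \<odot>\<^bsub>M\<^esub> (\<epsilon> (\<phi> 0 z) \<ominus>\<^bsub>M\<^esub> \<eta> z \<odot>\<^bsub>M\<^esub> p)"
        using that p Pc eta ac
        by (simp add: smult_r_distr M.minus_eq smult_r_minus smult_assoc1[symmetric] R.m_comm)
      then show ?thesis using \<phi>(2) that ac by auto
    qed
    then have "good (a \<odot>\<^bsub>M\<^esub> p) (\<lambda>i z. a \<odot>\<^bsub>F i\<^esub> \<phi> i z)"
      using \<phi> J_ideal a ac unfolding good_def
      by (auto intro!: mod_hom_scale minimal_map_scale_ideal)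
    with p ac show ?thesis by auto
  qed
  have "ideal_times R M J P \<subseteq> ?W"
    by (rule ideal_times_least[OF subW JW])
  then show ?thesis using y unfolding good_def by blast
qed

text \<open>Adding one relation \<open>y\<close>. The annihilator of the class of \<open>y\<close> is exactly \<open>I\<close>, so multiplication by
  \<open>y\<close> embeds \<open>R/I\<close> into the resolved module. The cokernel is the module with the relation added, and the
  mapping cone of a lift of the embedding resolves it. The differentials of the cone consist of those of the
  two resolutions and of the lift, so the cone is minimal if the lift is. In degree \<open>Suc j\<close> the cone is the sum of
  \<open>R^(n (j + 1))\<close> and \<open>R^(k j)\<close>.\<close>

lemma cone_resolution:
  assumes K: "minimal_resolution R (regular_module R) (carrier R) I k \<kappa> \<eta> J"
    and I: "\<And>a p. \<lbrakk>a \<in> I; p \<in> P\<rbrakk> \<Longrightarrow> a \<odot>\<^bsub>M\<^esub> p \<in> N"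
    and y: "y \<in> ideal_times R M J P"
    and ann: "\<And>a. \<lbrakk>a \<in> carrier R; a \<odot>\<^bsub>M\<^esub> y \<in> N\<rbrakk> \<Longrightarrow> a \<in> I"
  shows "has_minimal_resolution R J M P (N <+>\<^bsub>M\<^esub> {a \<odot>\<^bsub>M\<^esub> y |a. a \<in> carrier R})
    (\<lambda>i. case i of 0 \<Rightarrow> n 0 | Suc j \<Rightarrow> n (Suc j) + k j)"
proof -
  let ?K = "\<lambda>i. free_power R (k i)"
  interpret K: minimal_resolution R "regular_module R" "carrier R" I k \<kappa> \<eta> J by fact
  interpret J: ideal J R by (rule J_ideal)
  interpret FF: module R "free_power R m" for m by (rule module_free_power)
  interpret e: mod_hom R "F 0" M \<epsilon> by (rule eps_hom)
  interpret d: mod_hom R "F (Suc i)" "F i" "\<delta> i" for i by (rule delta_hom)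
  interpret Kd: mod_hom R "?K (Suc i)" "?K i" "\<kappa> i" for i by (rule K.delta_hom)
  interpret Ke: mod_hom R "?K 0" "regular_module R" "\<eta>" by (rule K.eps_hom)
  interpret P: submodule R P M by (rule sub_P)
  interpret N: submodule R N M by (rule sub_N)
  have eta: "\<eta> x \<in> carrier R" if "x \<in> carrier (?K 0)" for x
    using Ke.f_im[OF that] by (simp add: regular_module_simps)
  have yP: "y \<in> P" using ideal_times_subset[OF J.a_subset sub_P] y by blast
  then have yM: "y \<in> carrier M" using P.subset by blast
  have Nc: "z \<in> carrier M" if "z \<in> N" for z using N.subset that by blast
  obtain \<phi> where \<phi>: "\<And>i. mod_hom R (?K i) (F i) (\<phi> i)" "\<And>i. minimal_map R J (k i) (n i) (\<phi> i)"
    "\<And>x. x \<in> carrier (?K 0) \<Longrightarrow> \<epsilon> (\<phi> 0 x) \<ominus>\<^bsub>M\<^esub> \<eta> x \<odot>\<^bsub>M\<^esub> y \<in> N"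
    "\<And>i x. x \<in> carrier (?K (Suc i)) \<Longrightarrow> \<delta> i (\<phi> (Suc i) x) = \<phi> i (\<kappa> i x)"
    using lift_minimal_map[OF K.subquotient_resolution_axioms I y] by blast
  interpret p: mod_hom R "?K i" "F i" "\<phi> i" for i by (rule \<phi>)
  define N' where "N' = N <+>\<^bsub>M\<^esub> {a \<odot>\<^bsub>M\<^esub> y |a. a \<in> carrier R}"
  define r where "r i = (case i of 0 \<Rightarrow> n 0 | Suc j \<Rightarrow> n (Suc j) + k j)" for i
  have r: "r 0 = n 0" "r (Suc i) = n (Suc i) + k i" for i by (simp_all add: r_def)
  \<comment> \<open>the components \<open>a\<close>, \<open>b\<close> of a vector in degree \<open>Suc i\<close>; the differential of the cone sends it to
    \<open>(\<delta> a + \<phi> b, - \<kappa> b)\<close>, where the second component is absent in degree 0\<close>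
  define a where "a i = vec_fst (n (Suc i))" for i
  define b where "b i = vec_snd (n (Suc i)) (k i)" for i
  define G where "G i w = \<delta> i (a i w) \<oplus>\<^bsub>F i\<^esub> \<phi> i (b i w)" for i w
  define D where "D i = (case i of 0 \<Rightarrow> G 0 | Suc j \<Rightarrow> (\<lambda>w. vec_inl (n (Suc j)) (k j) (G (Suc j) w)
      \<ominus>\<^bsub>free_power R (r (Suc j))\<^esub> vec_inr (n (Suc j)) (k j) (\<kappa> j (b (Suc j) w))))" for i
  have a_hom: "mod_hom R (free_power R (r (Suc i))) (F (Suc i)) (a i)" for i
    unfolding a_def r by (rule vec_homs)
  have b_hom: "mod_hom R (free_power R (r (Suc i))) (?K i) (b i)" for i
    unfolding b_def r by (rule vec_homs)
  interpret a: mod_hom R "free_power R (r (Suc i))" "F (Suc i)" "a i" for i by (rule a_hom)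
  interpret b: mod_hom R "free_power R (r (Suc i))" "?K i" "b i" for i by (rule b_hom)
  have inl_hom: "mod_hom R (F (Suc i)) (free_power R (r (Suc i))) (vec_inl (n (Suc i)) (k i))" for i
    unfolding r by (rule vec_homs)
  have inr_hom: "mod_hom R (?K i) (free_power R (r (Suc i))) (vec_inr (n (Suc i)) (k i))" for i
    unfolding r by (rule vec_homs)
  interpret inl: mod_hom R "F (Suc i)" "free_power R (r (Suc i))" "vec_inl (n (Suc i)) (k i)" for i
    by (rule inl_hom)
  interpret inr: mod_hom R "?K i" "free_power R (r (Suc i))" "vec_inr (n (Suc i)) (k i)" for i
    by (rule inr_hom)
  have ab: "a i (vec_inl (n (Suc i)) (k i) x) = x" "b i (vec_inl (n (Suc i)) (k i) x) = \<zero>\<^bsub>?K i\<^esub>"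
    if "x \<in> carrier (F (Suc i))" for i x using that by (simp_all add: a_def b_def vec_simps)
  have ab': "a i (vec_inr (n (Suc i)) (k i) x) = \<zero>\<^bsub>F (Suc i)\<^esub>" "b i (vec_inr (n (Suc i)) (k i) x) = x"
    if "x \<in> carrier (?K i)" for i x using that by (simp_all add: a_def b_def vec_simps)
  have split: "w = w'" if "w \<in> carrier (free_power R (r (Suc i)))" "w' \<in> carrier (free_power R (r (Suc i)))"
    "a i w = a i w'" "b i w = b i w'" for i w w'
    using that unfolding r a_def b_def by (rule vec_eqI)
  have G_hom: "mod_hom R (free_power R (r (Suc i))) (F i) (G i)" for i
    unfolding G_def by (intro mod_hom_plus mod_hom_comp[OF a_hom delta_hom] mod_hom_comp[OF b_hom \<phi>(1)])
  interpret G: mod_hom R "free_power R (r (Suc i))" "F i" "G i" for i by (rule G_hom)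
  have G_min: "minimal_map R J (r (Suc i)) (n i) (G i)" for i
    unfolding G_def
    using minimal_map_comp[OF J_ideal delta_minimal a_hom mod_hom_ident[OF module_free_power]]
      minimal_map_comp[OF J_ideal \<phi>(2) b_hom mod_hom_ident[OF module_free_power]]
    by (intro minimal_map_plus J_ideal) auto
  have D0: "D 0 = G 0" by (simp add: D_def)
  have DS: "D (Suc j) = (\<lambda>w. vec_inl (n (Suc j)) (k j) (G (Suc j) w)
      \<ominus>\<^bsub>free_power R (r (Suc j))\<^esub> vec_inr (n (Suc j)) (k j) (\<kappa> j (b (Suc j) w)))" for j
    by (simp add: D_def)
  have D_hom: "mod_hom R (free_power R (r (Suc i))) (free_power R (r i)) (D i)" for i
  proof (cases i)
    case 0
    then show ?thesis using G_hom[of 0] by (simp add: D0 r(1))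
  next
    case (Suc j)
    show ?thesis unfolding Suc DS
      by (intro mod_hom_diff mod_hom_comp[OF G_hom inl_hom]
          mod_hom_comp[OF mod_hom_comp[OF b_hom K.delta_hom] inr_hom])
  qed
  have D_min: "minimal_map R J (r (Suc i)) (r i) (D i)" for i
  proof (cases i)
    case 0
    then show ?thesis using G_min[of 0] by (simp add: D0 r(1))
  next
    case (Suc j)
    show ?thesis unfolding Suc DS
      using minimal_map_comp[OF J_ideal G_min mod_hom_ident[OF module_free_power] inl_hom]
        minimal_map_comp[OF J_ideal K.delta_minimal b_hom inr_hom]
      by (intro minimal_map_diff J_ideal) auto
  qed
  interpret D: mod_hom R "free_power R (r (Suc i))" "free_power R (r i)" "D i" for i by (rule D_hom)
  have aD: "a j (D (Suc j) w) = G (Suc j) w" and bD: "b j (D (Suc j) w) = \<ominus>\<^bsub>?K j\<^esub> \<kappa> j (b (Suc j) w)"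
    if "w \<in> carrier (free_power R (r (Suc (Suc j))))" for j w
    using that by (simp_all add: DS ab ab' FF.M.minus_eq)
  have GD: "G i (D (Suc i) w) = \<zero>\<^bsub>F i\<^esub>" if "w \<in> carrier (free_power R (r (Suc (Suc i))))" for i w
    unfolding G_def[of i] using that
    by (simp add: aD bD \<phi>(4) G_def delta_delta FF.M.r_neg)
  have neg0: "\<ominus>\<^bsub>free_power R m\<^esub> x = \<zero>\<^bsub>free_power R m\<^esub> \<longleftrightarrow> x = \<zero>\<^bsub>free_power R m\<^esub>"
    if "x \<in> carrier (free_power R m)" for m x
    using that by (rule FF.M.add.inv_eq_1_iff)
  \<comment> \<open>the diagram chase common to all degrees: if the component \<open>b\<close> of a cycle is a boundary \<open>\<kappa> v\<close>, then
    \<open>a + \<phi> v\<close> is a cycle of \<open>\<delta>\<close>, hence a boundary \<open>\<delta> u\<close>, and \<open>(u, - v)\<close> is a preimage\<close>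
  have exact: "w \<in> D (Suc i) ` carrier (free_power R (r (Suc (Suc i))))"
    if w: "w \<in> carrier (free_power R (r (Suc i)))" and Gw: "G i w = \<zero>\<^bsub>F i\<^esub>"
      and v: "v \<in> carrier (?K (Suc i))" "b i w = \<kappa> i v" for i w v
  proof -
    have "\<delta> i (a i w \<oplus>\<^bsub>F (Suc i)\<^esub> \<phi> (Suc i) v) = \<zero>\<^bsub>F i\<^esub>"
      using w v Gw by (simp add: \<phi>(4) G_def)
    then obtain u where u: "u \<in> carrier (F (Suc (Suc i)))" "\<delta> (Suc i) u = a i w \<oplus>\<^bsub>F (Suc i)\<^esub> \<phi> (Suc i) v"
      using delta_exact[of "a i w \<oplus>\<^bsub>F (Suc i)\<^esub> \<phi> (Suc i) v" i] w v(1) by auto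
    define z where "z = vec_inl (n (Suc (Suc i))) (k (Suc i)) u \<ominus>\<^bsub>free_power R (r (Suc (Suc i)))\<^esub>
      vec_inr (n (Suc (Suc i))) (k (Suc i)) v"
    have z: "z \<in> carrier (free_power R (r (Suc (Suc i))))" "a (Suc i) z = u" "b (Suc i) z = \<ominus>\<^bsub>?K (Suc i)\<^esub> v"
      using u v by (simp_all add: z_def ab ab' FF.M.minus_eq)
    have "D (Suc i) z = w"
      by (rule split[of _ i]) (use z w u v in \<open>simp_all add: aD bD G_def FF.M.a_assoc FF.M.r_neg\<close>)
    with z(1) show ?thesis by (metis imageI)
  qed
  have "minimal_resolution R M P N' r D \<epsilon> J"
  proof (rule minimal_resolutionI)
    have cyc: "submodule R {a \<odot>\<^bsub>M\<^esub> y |a. a \<in> carrier R} M"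
      by (rule submodule_cyclic[OF yM oneideal])
    then show N'_sub: "submodule R N' M" unfolding N'_def by (rule submodule_plus[OF sub_N])
    have NN': "N \<subseteq> N'" unfolding N'_def by (rule subset_plus[OF sub_N cyc])
    have yN': "c \<odot>\<^bsub>M\<^esub> y \<in> N'" if "c \<in> carrier R" for c
      using subset_plus(2)[OF sub_N cyc] that unfolding N'_def by auto
    show "\<exists>x\<in>carrier (free_power R (r 0)). \<epsilon> x \<ominus>\<^bsub>M\<^esub> p \<in> N'" if "p \<in> P" for p
      using eps_gen[OF that] NN' by (auto simp: r(1))
    fix x assume "x \<in> carrier (free_power R (r 0))"
    then have x: "x \<in> carrier (F 0)" by (simp add: r(1))
    show "\<epsilon> x \<in> N' \<longleftrightarrow> x \<in> D 0 ` carrier (free_power R (r (Suc 0)))"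
    proof
      assume "\<epsilon> x \<in> N'"
      then obtain z c where z: "z \<in> N" "c \<in> carrier R" "\<epsilon> x = z \<oplus>\<^bsub>M\<^esub> c \<odot>\<^bsub>M\<^esub> y"
        unfolding N'_def mem_plus_iff by auto
      obtain u where u: "u \<in> carrier (?K 0)" "\<eta> u \<ominus> c \<in> I"
        using K.eps_gen[of c] z(2) eta by (auto simp: regular_module_minus)
      have "(\<eta> u \<ominus> c) \<odot>\<^bsub>M\<^esub> y \<in> N" using I[OF u(2) yP] .
      then have "z \<oplus>\<^bsub>M\<^esub> (\<ominus>\<^bsub>M\<^esub> ((\<eta> u \<ominus> c) \<odot>\<^bsub>M\<^esub> y) \<oplus>\<^bsub>M\<^esub> \<ominus>\<^bsub>M\<^esub> (\<epsilon> (\<phi> 0 u) \<ominus>\<^bsub>M\<^esub> \<eta> u \<odot>\<^bsub>M\<^esub> y)) \<in> N"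
        using \<phi>(3)[OF u(1)] z(1) submodule_neg[OF sub_N] by blast
      moreover have "z \<oplus>\<^bsub>M\<^esub> (\<ominus>\<^bsub>M\<^esub> ((\<eta> u \<ominus> c) \<odot>\<^bsub>M\<^esub> y) \<oplus>\<^bsub>M\<^esub> \<ominus>\<^bsub>M\<^esub> (\<epsilon> (\<phi> 0 u) \<ominus>\<^bsub>M\<^esub> \<eta> u \<odot>\<^bsub>M\<^esub> y))
          = \<epsilon> (x \<ominus>\<^bsub>F 0\<^esub> \<phi> 0 u)"
      proof -
        have "(\<eta> u \<ominus> c) \<odot>\<^bsub>M\<^esub> y = \<eta> u \<odot>\<^bsub>M\<^esub> y \<ominus>\<^bsub>M\<^esub> c \<odot>\<^bsub>M\<^esub> y"
          using z yM eta[OF u(1)] by (simp add: R.minus_eq smult_l_distr smult_l_minus M.minus_eq)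
        then show ?thesis using x u(1) z yM eta[OF u(1)] Nc[OF z(1)] by (simp add: M.minus_telescope)
      qed
      ultimately obtain v where v: "v \<in> carrier (F (Suc 0))" "\<delta> 0 v = x \<ominus>\<^bsub>F 0\<^esub> \<phi> 0 u"
        using eps_exact[of "x \<ominus>\<^bsub>F 0\<^esub> \<phi> 0 u"] x u(1) by auto
      let ?w = "vec_inl (n (Suc 0)) (k 0) v \<oplus>\<^bsub>free_power R (r (Suc 0))\<^esub> vec_inr (n (Suc 0)) (k 0) u"
      have "?w \<in> carrier (free_power R (r (Suc 0)))" "G 0 ?w = x"
        using v x u(1) by (simp_all add: G_def ab ab' FF.M.minus_eq FF.M.a_assoc FF.M.l_neg)
      then show "x \<in> D 0 ` carrier (free_power R (r (Suc 0)))" unfolding D0 by (metis imageI)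
    next
      assume "x \<in> D 0 ` carrier (free_power R (r (Suc 0)))"
      then obtain w where w: "w \<in> carrier (free_power R (r (Suc 0)))" "x = G 0 w" unfolding D0 by blast
      have "\<epsilon> (\<delta> 0 (a 0 w)) \<in> N'" using eps_delta[of "a 0 w"] w(1) NN' by auto
      moreover have "\<epsilon> (\<phi> 0 (b 0 w)) \<in> N'"
        using submodule_diff_iff[OF N'_sub _ _ subsetD[OF NN' \<phi>(3)]] yN' w(1) eta yM by simp
      ultimately show "\<epsilon> x \<in> N'"
        using submodule.m_closed[OF N'_sub] w by (simp add: G_def)
    qed
  next
    fix i x assume x: "x \<in> carrier (free_power R (r (Suc i)))"
    show "D i x = \<zero>\<^bsub>free_power R (r i)\<^esub> \<longleftrightarrow> x \<in> D (Suc i) ` carrier (free_power R (r (Suc (Suc i))))"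
    proof (cases i)
      case 0
      \<comment> \<open>the only place where injectivity of the map from \<open>R/I\<close> enters: \<open>\<eta> b\<close> annihilates the class of
        \<open>y\<close>, so it lies in \<open>I\<close>\<close>
      have "b 0 x \<in> \<kappa> 0 ` carrier (?K (Suc 0))" if "G 0 x = \<zero>\<^bsub>F 0\<^esub>"
      proof -
        have bx: "b 0 x \<in> carrier (?K 0)" using x 0 by simp
        have "\<epsilon> (\<delta> 0 (a 0 x)) \<oplus>\<^bsub>M\<^esub> \<epsilon> (\<phi> 0 (b 0 x)) = \<zero>\<^bsub>M\<^esub>"
          using that x 0 by (simp add: G_def e.f_add[symmetric] del: e.f_add)
        then have "\<epsilon> (\<phi> 0 (b 0 x)) \<oplus>\<^bsub>M\<^esub> \<epsilon> (\<delta> 0 (a 0 x)) \<in> N"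
          using x 0 by (simp add: M.a_comm)
        then have "\<epsilon> (\<phi> 0 (b 0 x)) \<in> N"
          using submodule_add_cancel[OF sub_N _ eps_delta[of "a 0 x"]] x 0 by simp
        then have "\<eta> (b 0 x) \<odot>\<^bsub>M\<^esub> y \<in> N"
          using submodule_diff_iff[OF sub_N _ _ \<phi>(3)] bx eta yM by simp
        then show ?thesis using ann K.eps_exact bx eta by blast
      qed
      then show ?thesis using exact[of x 0] GD[of _ 0] x unfolding 0 D0 r(1) by auto
    next
      case (Suc j)
      have "x \<in> D (Suc i) ` carrier (free_power R (r (Suc (Suc i))))" if D: "D i x = \<zero>\<^bsub>free_power R (r i)\<^esub>"
      proof -
        have "G i x = \<zero>\<^bsub>F i\<^esub>" "\<kappa> j (b i x) = \<zero>\<^bsub>?K j\<^esub>"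
          using aD[of x j, symmetric] bD[of x j, symmetric] D x neg0[of "\<kappa> j (b i x)"]
          unfolding Suc by simp_all
        then show ?thesis using exact[of x i] K.delta_exact[of "b i x" j] x unfolding Suc by auto
      qed
      moreover have "D i (D (Suc i) w) = \<zero>\<^bsub>free_power R (r i)\<^esub>"
        if w: "w \<in> carrier (free_power R (r (Suc (Suc i))))" for w
      proof -
        have "a j (D i (D (Suc i) w)) = \<zero>\<^bsub>F i\<^esub>" "b j (D i (D (Suc i) w)) = \<zero>\<^bsub>?K j\<^esub>"
          using w unfolding Suc by (simp_all add: aD bD GD K.delta_delta)
        from this[unfolded Suc] show ?thesis
          unfolding Suc by (intro split[of _ j "\<zero>\<^bsub>free_power R (r (Suc j))\<^esub>"]) (use w[unfolded Suc] in simp_all)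
      qed
      ultimately show ?thesis by auto
    qed
  qed (use sub_P eps_hom eps_P D_hom D_min J_ideal module_axioms in \<open>simp_all add: r(1)\<close>)
  then show ?thesis unfolding has_minimal_resolution_def N'_def r_def by blast
qed

text \<open>Adding one generator \<open>e\<close> that is independent of \<open>P\<close>, with the relations \<open>I e\<close>: the new module is the direct
  sum of the old one and \<open>R/I\<close>, and direct sums of minimal resolutions are minimal resolutions.\<close>

lemma direct_sum_resolution:
  assumes K: "minimal_resolution R (regular_module R) (carrier R) I k \<kappa> \<eta> J" "ideal I R"
    and e: "e \<in> carrier M" and indep: "\<And>a. \<lbrakk>a \<in> carrier R; a \<odot>\<^bsub>M\<^esub> e \<in> P\<rbrakk> \<Longrightarrow> a = \<zero>"
    and NP: "N \<subseteq> P"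
  shows "has_minimal_resolution R J M (P <+>\<^bsub>M\<^esub> {a \<odot>\<^bsub>M\<^esub> e |a. a \<in> carrier R})
    (N <+>\<^bsub>M\<^esub> {a \<odot>\<^bsub>M\<^esub> e |a. a \<in> I}) (\<lambda>i. n i + k i)"
proof -
  let ?K = "\<lambda>i. free_power R (k i)"
  interpret K: minimal_resolution R "regular_module R" "carrier R" I k \<kappa> \<eta> J by fact
  interpret I: ideal I R by fact
  interpret FF: module R "free_power R m" for m by (rule module_free_power)
  interpret e: mod_hom R "F 0" M \<epsilon> by (rule eps_hom)
  interpret d: mod_hom R "F (Suc i)" "F i" "\<delta> i" for i by (rule delta_hom)
  interpret Kd: mod_hom R "?K (Suc i)" "?K i" "\<kappa> i" for i by (rule K.delta_hom)
  interpret Ke: mod_hom R "?K 0" "regular_module R" "\<eta>" by (rule K.eps_hom)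
  interpret P: submodule R P M by (rule sub_P)
  interpret N: submodule R N M by (rule sub_N)
  have eta: "\<eta> x \<in> carrier R" if "x \<in> carrier (?K 0)" for x
    using Ke.f_im[OF that] by (simp add: regular_module_simps)
  have Pc: "z \<in> carrier M" if "z \<in> P" for z using P.subset that by blast
  have Ic: "c \<in> carrier R" if "c \<in> I" for c using that by (rule I.Icarr)
  define P' where "P' = P <+>\<^bsub>M\<^esub> {a \<odot>\<^bsub>M\<^esub> e |a. a \<in> carrier R}"
  define N' where "N' = N <+>\<^bsub>M\<^esub> {a \<odot>\<^bsub>M\<^esub> e |a. a \<in> I}"
  define r where "r i = n i + k i" for i
  define a where "a i = vec_fst (n i)" for i
  define b where "b i = vec_snd (n i) (k i)" for i
  define D where "D i w = vec_inl (n i) (k i) (\<delta> i (a (Suc i) w))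
      \<oplus>\<^bsub>free_power R (r i)\<^esub> vec_inr (n i) (k i) (\<kappa> i (b (Suc i) w))" for i w
  define \<epsilon>' where "\<epsilon>' w = \<epsilon> (a 0 w) \<oplus>\<^bsub>M\<^esub> \<eta> (b 0 w) \<odot>\<^bsub>M\<^esub> e" for w
  have a_hom: "mod_hom R (free_power R (r i)) (F i) (a i)" for i
    unfolding a_def r_def by (rule vec_homs)
  have b_hom: "mod_hom R (free_power R (r i)) (?K i) (b i)" for i
    unfolding b_def r_def by (rule vec_homs)
  interpret a: mod_hom R "free_power R (r i)" "F i" "a i" for i by (rule a_hom)
  interpret b: mod_hom R "free_power R (r i)" "?K i" "b i" for i by (rule b_hom)
  have inl_hom: "mod_hom R (F i) (free_power R (r i)) (vec_inl (n i) (k i))" for i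
    unfolding r_def by (rule vec_homs)
  have inr_hom: "mod_hom R (?K i) (free_power R (r i)) (vec_inr (n i) (k i))" for i
    unfolding r_def by (rule vec_homs)
  interpret inl: mod_hom R "F i" "free_power R (r i)" "vec_inl (n i) (k i)" for i by (rule inl_hom)
  interpret inr: mod_hom R "?K i" "free_power R (r i)" "vec_inr (n i) (k i)" for i by (rule inr_hom)
  have ab: "a i (vec_inl (n i) (k i) x) = x" "b i (vec_inl (n i) (k i) x) = \<zero>\<^bsub>?K i\<^esub>"
    if "x \<in> carrier (F i)" for i x using that by (simp_all add: a_def b_def vec_simps)
  have ab': "a i (vec_inr (n i) (k i) x) = \<zero>\<^bsub>F i\<^esub>" "b i (vec_inr (n i) (k i) x) = x"
    if "x \<in> carrier (?K i)" for i x using that by (simp_all add: a_def b_def vec_simps)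
  have split: "w = w'" if "w \<in> carrier (free_power R (r i))" "w' \<in> carrier (free_power R (r i))"
    "a i w = a i w'" "b i w = b i w'" for i w w'
    using that unfolding r_def a_def b_def by (rule vec_eqI)
  have D_hom: "mod_hom R (free_power R (r (Suc i))) (free_power R (r i)) (D i)" for i
    unfolding D_def
    by (intro mod_hom_plus mod_hom_comp[OF mod_hom_comp[OF a_hom delta_hom] inl_hom]
        mod_hom_comp[OF mod_hom_comp[OF b_hom K.delta_hom] inr_hom])
  have D_min: "minimal_map R J (r (Suc i)) (r i) (D i)" for i
    unfolding D_def
    using minimal_map_comp[OF J_ideal delta_minimal a_hom inl_hom]
      minimal_map_comp[OF J_ideal K.delta_minimal b_hom inr_hom]
    by (intro minimal_map_plus J_ideal) auto
  interpret D: mod_hom R "free_power R (r (Suc i))" "free_power R (r i)" "D i" for i by (rule D_hom)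
  have aD: "a i (D i w) = \<delta> i (a (Suc i) w)" and bD: "b i (D i w) = \<kappa> i (b (Suc i) w)"
    if "w \<in> carrier (free_power R (r (Suc i)))" for i w
    using that by (simp_all add: D_def ab ab')
  have D_image: "w \<in> D i ` carrier (free_power R (r (Suc i))) \<longleftrightarrow>
      a i w \<in> \<delta> i ` carrier (F (Suc i)) \<and> b i w \<in> \<kappa> i ` carrier (?K (Suc i))"
    if w: "w \<in> carrier (free_power R (r i))" for i w
  proof
    assume "w \<in> D i ` carrier (free_power R (r (Suc i)))"
    then show "a i w \<in> \<delta> i ` carrier (F (Suc i)) \<and> b i w \<in> \<kappa> i ` carrier (?K (Suc i))"
      using aD bD by auto
  next
    assume "a i w \<in> \<delta> i ` carrier (F (Suc i)) \<and> b i w \<in> \<kappa> i ` carrier (?K (Suc i))"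
    then obtain u v where u: "u \<in> carrier (F (Suc i))" "a i w = \<delta> i u"
      and v: "v \<in> carrier (?K (Suc i))" "b i w = \<kappa> i v" by blast
    define z where "z = vec_inl (n (Suc i)) (k (Suc i)) u \<oplus>\<^bsub>free_power R (r (Suc i))\<^esub>
      vec_inr (n (Suc i)) (k (Suc i)) v"
    have z: "z \<in> carrier (free_power R (r (Suc i)))" "a (Suc i) z = u" "b (Suc i) z = v"
      using u v by (simp_all add: z_def ab ab')
    have "D i z = w"
      by (rule split[of _ i]) (use z w u v in \<open>simp_all add: aD bD\<close>)
    with z(1) show "w \<in> D i ` carrier (free_power R (r (Suc i)))" by blast
  qed
  have cyc: "submodule R {a \<odot>\<^bsub>M\<^esub> e |a. a \<in> carrier R} M" "submodule R {a \<odot>\<^bsub>M\<^esub> e |a. a \<in> I} M"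
    by (rule submodule_cyclic[OF e oneideal], rule submodule_cyclic[OF e \<open>ideal I R\<close>])
  have "minimal_resolution R M P' N' r D \<epsilon>' J"
  proof (rule minimal_resolutionI)
    show "submodule R P' M" unfolding P'_def by (rule submodule_plus[OF sub_P cyc(1)])
    show "submodule R N' M" unfolding N'_def by (rule submodule_plus[OF sub_N cyc(2)])
    show eps': "mod_hom R (free_power R (r 0)) M \<epsilon>'"
      unfolding \<epsilon>'_def
      by (intro mod_hom_plus mod_hom_comp[OF a_hom eps_hom]
          mod_hom_comp[OF mod_hom_comp[OF b_hom K.eps_hom] smult_left_hom[OF e]])
    show "\<epsilon>' x \<in> P'" if "x \<in> carrier (free_power R (r 0))" for x
      unfolding P'_def \<epsilon>'_def mem_plus_iff using that eta eps_P by blast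
    show "\<exists>x\<in>carrier (free_power R (r 0)). \<epsilon>' x \<ominus>\<^bsub>M\<^esub> p \<in> N'" if "p \<in> P'" for p
    proof -
      from that obtain q c where q: "q \<in> P" "c \<in> carrier R" "p = q \<oplus>\<^bsub>M\<^esub> c \<odot>\<^bsub>M\<^esub> e"
        unfolding P'_def mem_plus_iff by auto
      obtain u where u: "u \<in> carrier (F 0)" "\<epsilon> u \<ominus>\<^bsub>M\<^esub> q \<in> N" using eps_gen[OF q(1)] by blast
      obtain v where v: "v \<in> carrier (?K 0)" "\<eta> v \<ominus> c \<in> I"
        using K.eps_gen[of c] q(2) eta by (auto simp: regular_module_minus)
      define z where "z = vec_inl (n 0) (k 0) u \<oplus>\<^bsub>free_power R (r 0)\<^esub> vec_inr (n 0) (k 0) v"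
      have z: "z \<in> carrier (free_power R (r 0))" "a 0 z = u" "b 0 z = v"
        using u v by (simp_all add: z_def ab ab')
      have "\<epsilon>' z \<ominus>\<^bsub>M\<^esub> p = (\<epsilon> u \<ominus>\<^bsub>M\<^esub> q) \<oplus>\<^bsub>M\<^esub> (\<eta> v \<ominus> c) \<odot>\<^bsub>M\<^esub> e"
        using z u v q e Pc eta
        by (simp add: \<epsilon>'_def M.minus_eq R.minus_eq M.minus_add smult_l_distr smult_l_minus M.a_ac)
      then have "\<epsilon>' z \<ominus>\<^bsub>M\<^esub> p \<in> N'" unfolding N'_def mem_plus_iff using u(2) v(2) by blast
      with z(1) show ?thesis by blast
    qed
    fix x assume x: "x \<in> carrier (free_power R (r 0))"
    have "\<epsilon>' x \<in> N' \<longleftrightarrow> \<epsilon> (a 0 x) \<in> N \<and> \<eta> (b 0 x) \<in> I"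
    proof
      assume "\<epsilon>' x \<in> N'"
      then obtain z c where z: "z \<in> N" "c \<in> I" "\<epsilon> (a 0 x) \<oplus>\<^bsub>M\<^esub> \<eta> (b 0 x) \<odot>\<^bsub>M\<^esub> e = z \<oplus>\<^bsub>M\<^esub> c \<odot>\<^bsub>M\<^esub> e"
        unfolding N'_def mem_plus_iff \<epsilon>'_def by auto
      have car: "\<epsilon> (a 0 x) \<in> P" "z \<in> P" "\<eta> (b 0 x) \<in> carrier R" "c \<in> carrier R"
        using x z NP eps_P eta Ic by auto
      have "\<epsilon> (a 0 x) \<oplus>\<^bsub>M\<^esub> (\<eta> (b 0 x) \<ominus> c) \<odot>\<^bsub>M\<^esub> e
          = (\<epsilon> (a 0 x) \<oplus>\<^bsub>M\<^esub> \<eta> (b 0 x) \<odot>\<^bsub>M\<^esub> e) \<oplus>\<^bsub>M\<^esub> \<ominus>\<^bsub>M\<^esub> (c \<odot>\<^bsub>M\<^esub> e)"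
        using car e Pc by (simp add: R.minus_eq smult_l_distr smult_l_minus M.a_assoc)
      also have "\<dots> = z" unfolding z(3) using car e Pc by (simp add: M.a_assoc M.r_neg)
      finally have eq: "\<epsilon> (a 0 x) \<oplus>\<^bsub>M\<^esub> (\<eta> (b 0 x) \<ominus> c) \<odot>\<^bsub>M\<^esub> e = z" .
      then have "(\<eta> (b 0 x) \<ominus> c) \<odot>\<^bsub>M\<^esub> e \<oplus>\<^bsub>M\<^esub> \<epsilon> (a 0 x) \<in> P"
        using car e Pc by (simp add: M.a_comm)
      then have "(\<eta> (b 0 x) \<ominus> c) \<odot>\<^bsub>M\<^esub> e \<in> P"
        using submodule_add_cancel[OF sub_P _ car(1)] car e by simp
      then have "\<eta> (b 0 x) = c" using indep[of "\<eta> (b 0 x) \<ominus> c"] car by simp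
      with eq z car e Pc show "\<epsilon> (a 0 x) \<in> N \<and> \<eta> (b 0 x) \<in> I"
        by (simp add: R.minus_eq R.r_neg)
    next
      assume "\<epsilon> (a 0 x) \<in> N \<and> \<eta> (b 0 x) \<in> I"
      then show "\<epsilon>' x \<in> N'" unfolding N'_def mem_plus_iff \<epsilon>'_def by blast
    qed
    then show "\<epsilon>' x \<in> N' \<longleftrightarrow> x \<in> D 0 ` carrier (free_power R (r (Suc 0)))"
      using D_image[OF x] x eps_exact K.eps_exact by simp
  next
    fix i x assume x: "x \<in> carrier (free_power R (r (Suc i)))"
    have "D i x = \<zero>\<^bsub>free_power R (r i)\<^esub> \<longleftrightarrow>
        \<delta> i (a (Suc i) x) = \<zero>\<^bsub>F i\<^esub> \<and> \<kappa> i (b (Suc i) x) = \<zero>\<^bsub>?K i\<^esub>"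
      using split[of "D i x" i "\<zero>\<^bsub>free_power R (r i)\<^esub>"] aD[OF x] bD[OF x] x by auto
    then show "D i x = \<zero>\<^bsub>free_power R (r i)\<^esub> \<longleftrightarrow> x \<in> D (Suc i) ` carrier (free_power R (r (Suc (Suc i))))"
      using D_image[OF x] x delta_exact K.delta_exact by simp
  qed (use D_hom D_min J_ideal module_axioms in simp_all)
  then show ?thesis unfolding has_minimal_resolution_def N'_def P'_def r_def by blast
qed

end

text \<open>A resolution of a subquotient of \<open>M\<close> with \<open>P = M\<close> resolves every module that is isomorphic to
  \<open>M/N\<close>; this is the way back from pairs of submodules to modules.\<close>

lemma (in cring) minimal_resolution_quotient:
  fixes M :: "('a, 'm) module" and Q :: "('a, 'q) module"
  assumes res: "has_minimal_resolution R J M (carrier M) N n"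
    and q: "mod_hom R M Q q" "q ` carrier M = carrier Q"
    and ker: "\<And>x. x \<in> carrier M \<Longrightarrow> q x = \<zero>\<^bsub>Q\<^esub> \<longleftrightarrow> x \<in> N"
  shows "has_minimal_resolution R J Q (carrier Q) {\<zero>\<^bsub>Q\<^esub>} n"
proof -
  obtain \<delta> \<epsilon> where min: "minimal_resolution R M (carrier M) N n \<delta> \<epsilon> J"
    using res unfolding has_minimal_resolution_def by blast
  interpret F: minimal_resolution R M "carrier M" N n \<delta> \<epsilon> J by (rule min)
  interpret q: mod_hom R M Q q by (rule q)
  interpret e: mod_hom R "F.F 0" M \<epsilon> by (rule F.eps_hom)
  have "minimal_resolution R Q (carrier Q) {\<zero>\<^bsub>Q\<^esub>} n \<delta> (\<lambda>x. q (\<epsilon> x)) J"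
  proof (rule minimal_resolutionI)
    show "mod_hom R (F.F 0) Q (\<lambda>x. q (\<epsilon> x))" by (rule mod_hom_comp[OF F.eps_hom q(1)])
    fix p assume "p \<in> carrier Q"
    then obtain z where z: "z \<in> carrier M" "p = q z" using q(2) by blast
    obtain x where x: "x \<in> carrier (F.F 0)" "\<epsilon> x \<ominus>\<^bsub>M\<^esub> z \<in> N" using F.eps_gen[OF z(1)] by blast
    have "q (\<epsilon> x \<ominus>\<^bsub>M\<^esub> z) = \<zero>\<^bsub>Q\<^esub>" by (rule ker[THEN iffD2]) (use x z in simp_all)
    then show "\<exists>x\<in>carrier (F.F 0). q (\<epsilon> x) \<ominus>\<^bsub>Q\<^esub> p \<in> {\<zero>\<^bsub>Q\<^esub>}" using x z by auto
  qed (use F.delta_hom F.eps_exact F.delta_exact F.J_ideal F.delta_minimal ker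
      q.N.module_axioms q.N.submodule_carrier q.N.submodule_singleton_zero in simp_all)
  then show ?thesis unfolding has_minimal_resolution_def by blast
qed

section \<open>Quotient modules\<close>

text \<open>The module laws pass to images under maps that respect the operations. The modules below
  whose elements are cosets obtain their laws in this way.\<close>

lemma module_surj_image:
  assumes M: "module R M" and c: "carrier Q = g ` carrier M" and z: "\<zero>\<^bsub>Q\<^esub> = g \<zero>\<^bsub>M\<^esub>"
    and a: "\<And>x y. \<lbrakk>x \<in> carrier M; y \<in> carrier M\<rbrakk> \<Longrightarrow> g (x \<oplus>\<^bsub>M\<^esub> y) = g x \<oplus>\<^bsub>Q\<^esub> g y"
    and s: "\<And>r x. \<lbrakk>r \<in> carrier R; x \<in> carrier M\<rbrakk> \<Longrightarrow> g (r \<odot>\<^bsub>M\<^esub> x) = r \<odot>\<^bsub>Q\<^esub> g x"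
  shows "module R Q" "mod_hom R M Q g"
proof -
  interpret M: module R M by fact
  note as = a[symmetric] s[symmetric]
  show Q: "module R Q"
  proof (rule module_criteria)
    show "\<forall>v\<in>carrier Q. \<exists>neg_v\<in>carrier Q. v \<oplus>\<^bsub>Q\<^esub> neg_v = \<zero>\<^bsub>Q\<^esub>"
    proof
      fix v assume "v \<in> carrier Q"
      then obtain x where x: "x \<in> carrier M" "v = g x" by (auto simp: c)
      then have "v \<oplus>\<^bsub>Q\<^esub> g (\<ominus>\<^bsub>M\<^esub> x) = \<zero>\<^bsub>Q\<^esub>" by (simp add: as z M.r_neg)
      then show "\<exists>neg_v\<in>carrier Q. v \<oplus>\<^bsub>Q\<^esub> neg_v = \<zero>\<^bsub>Q\<^esub>" using x by (auto simp: c)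
    qed
  qed (auto simp: c z as M.R.is_cring M.M.a_ac M.smult_assoc1 M.smult_l_distr M.smult_r_distr)
  show "mod_hom R M Q g" by (rule mod_homI[OF M Q]) (auto simp: c a s)
qed

lemma factor_hom:
  assumes g: "mod_hom R M Q g" "carrier Q = g ` carrier M" and f: "mod_hom R M P f"
    and ker: "\<And>x. \<lbrakk>x \<in> carrier M; g x = \<zero>\<^bsub>Q\<^esub>\<rbrakk> \<Longrightarrow> f x = \<zero>\<^bsub>P\<^esub>"
  shows "\<exists>h. mod_hom R Q P h \<and> (\<forall>x\<in>carrier M. h (g x) = f x)"
proof -
  interpret g: mod_hom R M Q g by fact
  interpret f: mod_hom R M P f by fact
  define h where "h q = f (SOME x. x \<in> carrier M \<and> g x = q)" for q
  have h: "h (g x) = f x" if x: "x \<in> carrier M" for x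
  proof -
    define y where "y = (SOME y. y \<in> carrier M \<and> g y = g x)"
    have y: "y \<in> carrier M \<and> g y = g x" unfolding y_def by (rule someI[of _ x]) (use x in simp)
    then have "f (y \<ominus>\<^bsub>M\<^esub> x) = \<zero>\<^bsub>P\<^esub>" using x by (intro ker) simp_all
    then show ?thesis using x y by (simp add: h_def y_def)
  qed
  have "mod_hom R Q P h"
  proof (rule mod_homI)
    show "h (x \<oplus>\<^bsub>Q\<^esub> y) = h x \<oplus>\<^bsub>P\<^esub> h y" if "x \<in> carrier Q" "y \<in> carrier Q" for x y
      using that h g(2) by (auto simp: g.f_add[symmetric] simp del: g.f_add)
    show "h (r \<odot>\<^bsub>Q\<^esub> x) = r \<odot>\<^bsub>P\<^esub> h x" if "r \<in> carrier R" "x \<in> carrier Q" for r x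
      using that h g(2) by (auto simp: g.f_smult[symmetric] simp del: g.f_smult)
  qed (use h g(2) g.N.module_axioms f.N.module_axioms in auto)
  with h show ?thesis by blast
qed

context module
begin

lemma submodule_abelian_subgroup:
  assumes "submodule R N M" shows "abelian_subgroup N M"
proof (rule abelian_subgroupI3)
  interpret N: submodule R N M by fact
  show "additive_subgroup N M"
  proof (rule additive_subgroupI, unfold_locales)
    fix x assume "x \<in> N"
    then show "inv\<^bsub>add_monoid M\<^esub> x \<in> N"
      using submodule_neg[OF assms] by (simp add: a_inv_def)
  qed (use N.subset in auto)
qed (rule M.abelian_group_axioms)

lemma quot_module_facts:
  assumes "submodule R N M"
  shows "module R (quot_module M N)"
    and "mod_hom R M (quot_module M N) (\<lambda>x. N +>\<^bsub>M\<^esub> x)"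
    and "carrier (quot_module M N) = (\<lambda>x. N +>\<^bsub>M\<^esub> x) ` carrier M"
    and "x \<in> carrier M \<Longrightarrow> N +>\<^bsub>M\<^esub> x = \<zero>\<^bsub>quot_module M N\<^esub> \<longleftrightarrow> x \<in> N"
proof -
  interpret N: submodule R N M by fact
  interpret N: abelian_subgroup N M by (rule submodule_abelian_subgroup[OF assms])
  have c: "carrier (quot_module M N) = (\<lambda>x. N +>\<^bsub>M\<^esub> x) ` carrier M"
    by (auto simp: quot_module_def A_RCOSETS_def')
  then show "carrier (quot_module M N) = (\<lambda>x. N +>\<^bsub>M\<^esub> x) ` carrier M" .
  have eq: "N +>\<^bsub>M\<^esub> x = N +>\<^bsub>M\<^esub> y \<longleftrightarrow> x \<ominus>\<^bsub>M\<^esub> y \<in> N" if "x \<in> carrier M" "y \<in> carrier M" for x y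
  proof
    assume "N +>\<^bsub>M\<^esub> x = N +>\<^bsub>M\<^esub> y"
    then have "x \<in> N +>\<^bsub>M\<^esub> y" using N.a_rcos_self[OF that(1)] by simp
    then show "x \<ominus>\<^bsub>M\<^esub> y \<in> N" using N.a_rcos_module_imp[OF that(2)] by (simp add: M.minus_eq)
  next
    assume "x \<ominus>\<^bsub>M\<^esub> y \<in> N"
    then have "x \<in> N +>\<^bsub>M\<^esub> y" using N.a_rcos_module_rev[OF that(2,1)] by (simp add: M.minus_eq)
    then show "N +>\<^bsub>M\<^esub> x = N +>\<^bsub>M\<^esub> y" using N.a_repr_independence'[OF _ that(2)] by simp
  qed
  have s: "N +>\<^bsub>M\<^esub> (r \<odot>\<^bsub>M\<^esub> x) = r \<odot>\<^bsub>quot_module M N\<^esub> (N +>\<^bsub>M\<^esub> x)"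
    if r: "r \<in> carrier R" and x: "x \<in> carrier M" for r x
  proof -
    have "N +>\<^bsub>M\<^esub> (r \<odot>\<^bsub>M\<^esub> x') = N +>\<^bsub>M\<^esub> (r \<odot>\<^bsub>M\<^esub> x)" if x': "x' \<in> N +>\<^bsub>M\<^esub> x" for x'
    proof -
      have x'M: "x' \<in> carrier M" using N.a_elemrcos_carrier[OF x x'] .
      have "x' \<oplus>\<^bsub>M\<^esub> \<ominus>\<^bsub>M\<^esub> x \<in> N" using N.a_rcos_module_imp[OF x x'] .
      then have "r \<odot>\<^bsub>M\<^esub> (x' \<oplus>\<^bsub>M\<^esub> \<ominus>\<^bsub>M\<^esub> x) \<in> N" using r by simp
      then show ?thesis using r x x'M by (simp add: eq M.minus_eq smult_r_distr smult_r_minus)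
    qed
    moreover have "x \<in> N +>\<^bsub>M\<^esub> x" using x by (simp add: N.a_rcos_self)
    ultimately have "(\<Union>x'\<in>N +>\<^bsub>M\<^esub> x. N +>\<^bsub>M\<^esub> (r \<odot>\<^bsub>M\<^esub> x')) = N +>\<^bsub>M\<^esub> (r \<odot>\<^bsub>M\<^esub> x)" by blast
    then show ?thesis by (simp add: quot_module_def)
  qed
  have a: "N +>\<^bsub>M\<^esub> (x \<oplus>\<^bsub>M\<^esub> y) = (N +>\<^bsub>M\<^esub> x) \<oplus>\<^bsub>quot_module M N\<^esub> (N +>\<^bsub>M\<^esub> y)"
    if "x \<in> carrier M" "y \<in> carrier M" for x y
    using that N.a_rcos_sum by (simp add: quot_module_def)
  have z: "\<zero>\<^bsub>quot_module M N\<^esub> = N +>\<^bsub>M\<^esub> \<zero>\<^bsub>M\<^esub>"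
    using N.a_subset by (simp add: quot_module_def)
  show "module R (quot_module M N)" "mod_hom R M (quot_module M N) (\<lambda>x. N +>\<^bsub>M\<^esub> x)"
    by (rule module_surj_image[OF module_axioms c z a s]; assumption)+
  show "x \<in> carrier M \<Longrightarrow> N +>\<^bsub>M\<^esub> x = \<zero>\<^bsub>quot_module M N\<^esub> \<longleftrightarrow> x \<in> N"
    unfolding z using eq[of x "\<zero>\<^bsub>M\<^esub>"] M.minus_equality[of "\<zero>\<^bsub>M\<^esub>" "\<zero>\<^bsub>M\<^esub>"] by (simp add: M.minus_eq)
qed

end

section \<open>Tensor products\<close>

subsection \<open>Free modules on a set\<close>

context cring
begin

lemma free_on_submodule:
  "submodule R {u \<in> X \<rightarrow>\<^sub>E carrier R. finite {x \<in> X. u x \<noteq> \<zero>}} (func_space X)"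
proof -
  interpret F: module R "func_space X" by (rule func_space_is_module)
  show ?thesis
  proof (rule F.submodule_criterion)
    fix u v assume uv: "u \<in> {u \<in> X \<rightarrow>\<^sub>E carrier R. finite {x \<in> X. u x \<noteq> \<zero>}}"
      "v \<in> {u \<in> X \<rightarrow>\<^sub>E carrier R. finite {x \<in> X. u x \<noteq> \<zero>}}"
    have "finite {x \<in> X. (u \<oplus>\<^bsub>func_space X\<^esub> v) x \<noteq> \<zero>}"
      by (rule finite_subset[of _ "{x \<in> X. u x \<noteq> \<zero>} \<union> {x \<in> X. v x \<noteq> \<zero>}"])
        (use uv in \<open>auto simp: func_space_def\<close>)
    moreover have "u \<oplus>\<^bsub>func_space X\<^esub> v \<in> carrier (func_space X)"
      using uv by (intro F.M.a_closed) (auto simp: func_space_def)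
    ultimately show "u \<oplus>\<^bsub>func_space X\<^esub> v \<in> {u \<in> X \<rightarrow>\<^sub>E carrier R. finite {x \<in> X. u x \<noteq> \<zero>}}"
      by (simp add: func_space_def)
  next
    fix r u assume uv: "r \<in> carrier R" "u \<in> {u \<in> X \<rightarrow>\<^sub>E carrier R. finite {x \<in> X. u x \<noteq> \<zero>}}"
    have "finite {x \<in> X. (r \<odot>\<^bsub>func_space X\<^esub> u) x \<noteq> \<zero>}"
      by (rule finite_subset[of _ "{x \<in> X. u x \<noteq> \<zero>}"])
        (use uv in \<open>auto simp: func_space_def\<close>)
    moreover have "r \<odot>\<^bsub>func_space X\<^esub> u \<in> carrier (func_space X)"
      using uv by (intro F.smult_closed) (auto simp: func_space_def)
    ultimately show "r \<odot>\<^bsub>func_space X\<^esub> u \<in> {u \<in> X \<rightarrow>\<^sub>E carrier R. finite {x \<in> X. u x \<noteq> \<zero>}}"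
      by (simp add: func_space_def)
  qed (auto simp: func_space_def)
qed

lemma module_free_on: "module R (free_on R X)"
  unfolding free_on_def
  by (rule module.submodule_is_module[OF func_space_is_module free_on_submodule])

lemma free_on_simps:
  "carrier (free_on R X) = {u \<in> X \<rightarrow>\<^sub>E carrier R. finite {x \<in> X. u x \<noteq> \<zero>}}"
  "x \<in> X \<Longrightarrow> (u \<oplus>\<^bsub>free_on R X\<^esub> v) x = u x \<oplus> v x"
  "x \<in> X \<Longrightarrow> (r \<odot>\<^bsub>free_on R X\<^esub> u) x = r \<otimes> u x"
  "x \<in> X \<Longrightarrow> \<zero>\<^bsub>free_on R X\<^esub> x = \<zero>"
  by (simp_all add: free_on_def func_space_def)

lemma free_gen_closed: "free_gen R X x \<in> carrier (free_on R X)"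
proof -
  have "finite {y \<in> X. free_gen R X x y \<noteq> \<zero>}"
    by (rule finite_subset[of _ "{x}"]) (auto simp: free_gen_def)
  then show ?thesis by (simp add: free_on_simps free_gen_def)
qed

lemma free_on_eqI:
  assumes "u \<in> carrier (free_on R X)" "v \<in> carrier (free_on R X)" "\<And>x. x \<in> X \<Longrightarrow> u x = v x"
  shows "u = v"
  by (rule PiE_ext[where k = X and s = "\<lambda>_. carrier R"]) (use assms in \<open>simp_all add: free_on_simps(1)\<close>)

text \<open>Induction on a finite set that contains the support: subtracting the coordinate at one point, times
  the generator there, removes that point from the support.\<close>

lemma free_on_generated:
  assumes W: "submodule R W (free_on R X)" and gen: "\<And>x. x \<in> X \<Longrightarrow> free_gen R X x \<in> W"
    and u: "u \<in> carrier (free_on R X)"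
  shows "u \<in> W"
proof -
  interpret F: module R "free_on R X" by (rule module_free_on)
  interpret W: submodule R W "free_on R X" by (rule W)
  have "finite A \<Longrightarrow> \<forall>u\<in>carrier (free_on R X). {x \<in> X. u x \<noteq> \<zero>} \<subseteq> A \<longrightarrow> u \<in> W" for A
  proof (induction A rule: finite_induct)
    case empty
    show ?case
    proof (intro ballI impI)
      fix u assume u: "u \<in> carrier (free_on R X)" "{x \<in> X. u x \<noteq> \<zero>} \<subseteq> {}"
      have "u = \<zero>\<^bsub>free_on R X\<^esub>" by (rule free_on_eqI) (use u in \<open>auto simp: free_on_simps(4)\<close>)
      then show "u \<in> W" by simp
    qed
  next
    case (insert a A)
    show ?case
    proof (intro ballI impI)
      fix u assume u: "u \<in> carrier (free_on R X)" "{x \<in> X. u x \<noteq> \<zero>} \<subseteq> insert a A"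
      show "u \<in> W"
      proof (cases "a \<in> X")
        case False
        then show ?thesis using insert.IH u by blast
      next
        case True
        let ?v = "\<lambda>x\<in>X. if x = a then \<zero> else u x"
        have fin: "finite {x \<in> X. ?v x \<noteq> \<zero>}"
          by (rule finite_subset[of _ "{x \<in> X. u x \<noteq> \<zero>}"]) (use u(1) in \<open>auto simp: free_on_simps(1)\<close>)
        have uc: "u x \<in> carrier R" if "x \<in> X" for x using u(1) that by (auto simp: free_on_simps(1))
        then have v: "?v \<in> carrier (free_on R X)"
          using fin by (simp add: free_on_simps(1) restrict_PiE_iff)
        have "{x \<in> X. ?v x \<noteq> \<zero>} \<subseteq> A" using u(2) by auto
        then have "?v \<in> W" using insert.IH v by blast
        moreover have "u = ?v \<oplus>\<^bsub>free_on R X\<^esub> u a \<odot>\<^bsub>free_on R X\<^esub> free_gen R X a"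
        proof (rule free_on_eqI[OF u(1)])
          show "?v \<oplus>\<^bsub>free_on R X\<^esub> u a \<odot>\<^bsub>free_on R X\<^esub> free_gen R X a \<in> carrier (free_on R X)"
            by (intro F.M.a_closed F.smult_closed v uc True free_gen_closed)
        qed (use uc True in \<open>simp add: free_on_simps(2-4) free_gen_def\<close>)
        moreover have "u a \<odot>\<^bsub>free_on R X\<^esub> free_gen R X a \<in> W" using gen[OF True] uc[OF True] by simp
        ultimately show ?thesis using W.m_closed by metis
      qed
    qed
  qed
  then show ?thesis using u by (auto simp: free_on_simps(1))
qed

lemma free_on_universal:
  assumes P: "module R P" and b: "\<And>x. x \<in> X \<Longrightarrow> b x \<in> carrier P"
  shows "\<exists>h. mod_hom R (free_on R X) P h \<and> (\<forall>x\<in>X. h (free_gen R X x) = b x)"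
proof -
  interpret P: module R P by fact
  interpret F: module R "free_on R X" by (rule module_free_on)
  define supp where "supp u = {x \<in> X. u x \<noteq> \<zero>}" for u
  define h where "h u = (\<Oplus>\<^bsub>P\<^esub>x\<in>supp u. u x \<odot>\<^bsub>P\<^esub> b x)" for u
  have c: "u x \<in> carrier R" if "u \<in> carrier (free_on R X)" "x \<in> X" for u x
    using that by (auto simp: free_on_simps(1))
  have fs: "finite (supp u)" if "u \<in> carrier (free_on R X)" for u
    using that by (auto simp: supp_def free_on_simps(1))
  have hA: "h u = (\<Oplus>\<^bsub>P\<^esub>x\<in>A. u x \<odot>\<^bsub>P\<^esub> b x)"
    if "u \<in> carrier (free_on R X)" "finite A" "supp u \<subseteq> A" "A \<subseteq> X" for u A
    unfolding h_def
    by (rule P.M.add.finprod_mono_neutral_cong_left) (use that c b in \<open>auto simp: supp_def\<close>)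
  have "mod_hom R (free_on R X) P h"
  proof (rule mod_homI[OF module_free_on P])
    fix u assume u: "u \<in> carrier (free_on R X)"
    have sX: "supp v \<subseteq> X" for v by (auto simp: supp_def)
    have sX': "x \<in> X" if "x \<in> supp v" for x v using that sX by blast
    show "h u \<in> carrier P"
      unfolding h_def by (rule P.finsum_closed) (use c[OF u] b sX' in auto)
    { fix v assume v: "v \<in> carrier (free_on R X)"
      let ?A = "supp u \<union> supp v"
      have A: "finite ?A" "?A \<subseteq> X" using fs u v sX by auto
      have "supp (u \<oplus>\<^bsub>free_on R X\<^esub> v) \<subseteq> ?A" by (auto simp: supp_def free_on_simps)
      then have "h (u \<oplus>\<^bsub>free_on R X\<^esub> v) = (\<Oplus>\<^bsub>P\<^esub>x\<in>?A. (u \<oplus>\<^bsub>free_on R X\<^esub> v) x \<odot>\<^bsub>P\<^esub> b x)"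
        using u v A by (intro hA) auto
      also have "\<dots> = (\<Oplus>\<^bsub>P\<^esub>x\<in>?A. u x \<odot>\<^bsub>P\<^esub> b x \<oplus>\<^bsub>P\<^esub> v x \<odot>\<^bsub>P\<^esub> b x)"
      proof (rule P.finsum_cong')
        fix x assume "x \<in> ?A"
        then have "x \<in> X" using A by blast
        then show "(u \<oplus>\<^bsub>free_on R X\<^esub> v) x \<odot>\<^bsub>P\<^esub> b x = u x \<odot>\<^bsub>P\<^esub> b x \<oplus>\<^bsub>P\<^esub> v x \<odot>\<^bsub>P\<^esub> b x"
          using c u v b by (simp add: free_on_simps(2) P.smult_l_distr)
      qed (use c u v b sX' in auto)
      also have "\<dots> = (\<Oplus>\<^bsub>P\<^esub>x\<in>?A. u x \<odot>\<^bsub>P\<^esub> b x) \<oplus>\<^bsub>P\<^esub> (\<Oplus>\<^bsub>P\<^esub>x\<in>?A. v x \<odot>\<^bsub>P\<^esub> b x)"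
        by (rule P.finsum_addf) (use c u v b sX' in auto)
      also have "\<dots> = h u \<oplus>\<^bsub>P\<^esub> h v"
        using hA[OF u A(1) _ A(2)] hA[OF v A(1) _ A(2)] by simp
      finally show "h (u \<oplus>\<^bsub>free_on R X\<^esub> v) = h u \<oplus>\<^bsub>P\<^esub> h v" . }
    { fix r assume r: "r \<in> carrier R"
      have "supp (r \<odot>\<^bsub>free_on R X\<^esub> u) \<subseteq> supp u" using r by (auto simp: supp_def free_on_simps)
      then have "h (r \<odot>\<^bsub>free_on R X\<^esub> u) = (\<Oplus>\<^bsub>P\<^esub>x\<in>supp u. (r \<odot>\<^bsub>free_on R X\<^esub> u) x \<odot>\<^bsub>P\<^esub> b x)"
        using u r fs sX by (intro hA) auto
      also have "\<dots> = (\<Oplus>\<^bsub>P\<^esub>x\<in>supp u. r \<odot>\<^bsub>P\<^esub> (u x \<odot>\<^bsub>P\<^esub> b x))"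
      proof (rule P.finsum_cong')
        fix x assume "x \<in> supp u"
        then have "x \<in> X" using sX by blast
        then show "(r \<odot>\<^bsub>free_on R X\<^esub> u) x \<odot>\<^bsub>P\<^esub> b x = r \<odot>\<^bsub>P\<^esub> (u x \<odot>\<^bsub>P\<^esub> b x)"
          using c u b r by (simp add: free_on_simps(3) P.smult_assoc1)
      qed (use c u b r sX' in auto)
      also have "\<dots> = r \<odot>\<^bsub>P\<^esub> h u"
        unfolding h_def by (rule P.finsum_smult[symmetric]) (use c u b r sX' in auto)
      finally show "h (r \<odot>\<^bsub>free_on R X\<^esub> u) = r \<odot>\<^bsub>P\<^esub> h u" . }
  qed
  moreover have "h (free_gen R X x) = b x" if x: "x \<in> X" for x
  proof -
    have "h (free_gen R X x) = (\<Oplus>\<^bsub>P\<^esub>y\<in>{x}. free_gen R X x y \<odot>\<^bsub>P\<^esub> b y)"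
      by (rule hA[OF free_gen_closed]) (use x in \<open>auto simp: supp_def free_gen_def split: if_splits\<close>)
    also have "\<dots> = b x" using x b by (simp add: free_gen_def)
    finally show ?thesis .
  qed
  ultimately show ?thesis by blast
qed

subsection \<open>The universal property\<close>

definition bilinear_map ::
    "('a, 'm) module \<Rightarrow> ('a, 'n) module \<Rightarrow> ('a, 'p) module \<Rightarrow> ('m \<Rightarrow> 'n \<Rightarrow> 'p) \<Rightarrow> bool"
  where "bilinear_map M N P \<beta> \<longleftrightarrow>
    (\<forall>n\<in>carrier N. mod_hom R M P (\<lambda>m. \<beta> m n)) \<and> (\<forall>m\<in>carrier M. mod_hom R N P (\<beta> m))"

lemma submodule_tensor_rel:
  fixes M :: "('a, 'm) module" and N :: "('a, 'n) module"
  assumes M: "module R M" and N: "module R N"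
  shows "submodule R (tensor_rel R M N) (free_on R (carrier M \<times> carrier N))"
proof -
  interpret M: module R M by fact
  interpret N: module R N by fact
  interpret F: module R "free_on R (carrier M \<times> carrier N)" by (rule module_free_on)
  show ?thesis unfolding tensor_rel_def Let_def
    by (rule F.span_is_submodule) (auto simp: free_gen_closed)
qed

lemma tensor_rel_least:
  fixes M :: "('a, 'm) module" and N :: "('a, 'n) module"
  assumes M: "module R M" and N: "module R N" and P: "module R P"
    and h: "mod_hom R (free_on R (carrier M \<times> carrier N)) P h" and \<beta>: "bilinear_map M N P \<beta>"
    and eq: "\<And>m n. \<lbrakk>m \<in> carrier M; n \<in> carrier N\<rbrakk> \<Longrightarrow>
      h (free_gen R (carrier M \<times> carrier N) (m, n)) = \<beta> m n"
    and u: "u \<in> tensor_rel R M N"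
  shows "h u = \<zero>\<^bsub>P\<^esub>"
proof -
  interpret M: module R M by fact
  interpret N: module R N by fact
  interpret h: mod_hom R "free_on R (carrier M \<times> carrier N)" P h by fact
  have l: "mod_hom R M P (\<lambda>m. \<beta> m n)" if "n \<in> carrier N" for n using \<beta> that by (simp add: bilinear_map_def)
  have r: "mod_hom R N P (\<beta> m)" if "m \<in> carrier M" for m using \<beta> that by (simp add: bilinear_map_def)
  have cl: "\<beta> m n \<in> carrier P" if "m \<in> carrier M" "n \<in> carrier N" for m n
    using mod_hom.f_im[OF l] that by blast
  have rules: "\<beta> (m \<oplus>\<^bsub>M\<^esub> m') n = \<beta> m n \<oplus>\<^bsub>P\<^esub> \<beta> m' n" "\<beta> (c \<odot>\<^bsub>M\<^esub> m) n = c \<odot>\<^bsub>P\<^esub> \<beta> m n"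
    if "m \<in> carrier M" "m' \<in> carrier M" "n \<in> carrier N" "c \<in> carrier R" for m m' n c
    using mod_hom_add[OF l[OF that(3)] that(1,2)] mod_hom_smult[OF l[OF that(3)] that(4,1)] by auto
  have rules': "\<beta> m (n \<oplus>\<^bsub>N\<^esub> n') = \<beta> m n \<oplus>\<^bsub>P\<^esub> \<beta> m n'" "\<beta> m (c \<odot>\<^bsub>N\<^esub> n) = c \<odot>\<^bsub>P\<^esub> \<beta> m n"
    if "m \<in> carrier M" "n' \<in> carrier N" "n \<in> carrier N" "c \<in> carrier R" for m n' n c
    using mod_hom_add[OF r[OF that(1)] that(3,2)] mod_hom_smult[OF r[OF that(1)] that(4,3)] by auto
  have "tensor_rel R M N \<subseteq> {u \<in> carrier (free_on R (carrier M \<times> carrier N)). h u \<in> {\<zero>\<^bsub>P\<^esub>}}"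
    unfolding tensor_rel_def Let_def
    by (rule h.M.span_is_subset[OF _ submodule_vimage[OF h h.N.submodule_singleton_zero]])
      (auto simp: free_gen_closed eq rules[OF _ _ _ zero_closed] rules(2)[OF _ M.M.zero_closed]
        rules'[OF _ _ _ zero_closed] rules'(2)[OF _ N.M.zero_closed] cl)
  with u show ?thesis by blast
qed

lemma tensor_relators:
  fixes M :: "('a, 'm) module" and N :: "('a, 'n) module"
  assumes M: "module R M" and N: "module R N" and n: "n \<in> carrier N" and m: "m \<in> carrier M"
  defines "F \<equiv> free_on R (carrier M \<times> carrier N)"
  defines "e \<equiv> \<lambda>m n. free_gen R (carrier M \<times> carrier N) (m, n)"
  shows "m' \<in> carrier M \<Longrightarrow> e (m \<oplus>\<^bsub>M\<^esub> m') n \<ominus>\<^bsub>F\<^esub> (e m n \<oplus>\<^bsub>F\<^esub> e m' n) \<in> tensor_rel R M N"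
    and "n' \<in> carrier N \<Longrightarrow> e m (n \<oplus>\<^bsub>N\<^esub> n') \<ominus>\<^bsub>F\<^esub> (e m n \<oplus>\<^bsub>F\<^esub> e m n') \<in> tensor_rel R M N"
    and "r \<in> carrier R \<Longrightarrow> e (r \<odot>\<^bsub>M\<^esub> m) n \<ominus>\<^bsub>F\<^esub> (r \<odot>\<^bsub>F\<^esub> e m n) \<in> tensor_rel R M N"
    and "r \<in> carrier R \<Longrightarrow> e m (r \<odot>\<^bsub>N\<^esub> n) \<ominus>\<^bsub>F\<^esub> (r \<odot>\<^bsub>F\<^esub> e m n) \<in> tensor_rel R M N"
proof -
  interpret M: module R M by fact
  interpret N: module R N by fact
  interpret F: module R F unfolding F_def by (rule module_free_on)
  let ?G1 = "{e (m \<oplus>\<^bsub>M\<^esub> m') n \<ominus>\<^bsub>F\<^esub> (e m n \<oplus>\<^bsub>F\<^esub> e m' n) | m m' n.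
          m \<in> carrier M \<and> m' \<in> carrier M \<and> n \<in> carrier N}"
  let ?G2 = "{e m (n \<oplus>\<^bsub>N\<^esub> n') \<ominus>\<^bsub>F\<^esub> (e m n \<oplus>\<^bsub>F\<^esub> e m n') | m n n'.
          m \<in> carrier M \<and> n \<in> carrier N \<and> n' \<in> carrier N}"
  let ?G3 = "{e (r \<odot>\<^bsub>M\<^esub> m) n \<ominus>\<^bsub>F\<^esub> (r \<odot>\<^bsub>F\<^esub> e m n) | r m n.
          r \<in> carrier R \<and> m \<in> carrier M \<and> n \<in> carrier N}"
  let ?G4 = "{e m (r \<odot>\<^bsub>N\<^esub> n) \<ominus>\<^bsub>F\<^esub> (r \<odot>\<^bsub>F\<^esub> e m n) | r m n.
          r \<in> carrier R \<and> m \<in> carrier M \<and> n \<in> carrier N}"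
  have T: "tensor_rel R M N = F.span (?G1 \<union> ?G2 \<union> ?G3 \<union> ?G4)"
    unfolding tensor_rel_def Let_def e_def F_def ..
  have e: "e m n \<in> carrier F" for m n unfolding e_def F_def by (rule free_gen_closed)
  have "?G1 \<union> ?G2 \<union> ?G3 \<union> ?G4 \<subseteq> carrier F" using e by auto
  then have sub: "?G1 \<union> ?G2 \<union> ?G3 \<union> ?G4 \<subseteq> tensor_rel R M N"
    unfolding T by (rule F.in_own_span)
  show "m' \<in> carrier M \<Longrightarrow> e (m \<oplus>\<^bsub>M\<^esub> m') n \<ominus>\<^bsub>F\<^esub> (e m n \<oplus>\<^bsub>F\<^esub> e m' n) \<in> tensor_rel R M N"
    by (rule subsetD[OF sub]) (use m n in blast)
  show "n' \<in> carrier N \<Longrightarrow> e m (n \<oplus>\<^bsub>N\<^esub> n') \<ominus>\<^bsub>F\<^esub> (e m n \<oplus>\<^bsub>F\<^esub> e m n') \<in> tensor_rel R M N"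
    by (rule subsetD[OF sub]) (use m n in blast)
  show "r \<in> carrier R \<Longrightarrow> e (r \<odot>\<^bsub>M\<^esub> m) n \<ominus>\<^bsub>F\<^esub> (r \<odot>\<^bsub>F\<^esub> e m n) \<in> tensor_rel R M N"
    by (rule subsetD[OF sub]) (use m n in blast)
  show "r \<in> carrier R \<Longrightarrow> e m (r \<odot>\<^bsub>N\<^esub> n) \<ominus>\<^bsub>F\<^esub> (r \<odot>\<^bsub>F\<^esub> e m n) \<in> tensor_rel R M N"
    by (rule subsetD[OF sub]) (use m n in blast)
qed

text \<open>The four facts by which tensor products are used: the third says that pure tensors generate, the
  fourth is the universal property, by which bilinear maps factor through the tensor product.\<close>

lemma tensor_facts:
  fixes M :: "('a, 'm) module" and N :: "('a, 'n) module"
  assumes M: "module R M" and N: "module R N"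
  shows "module R (tensor_module R M N)"
    and "bilinear_map M N (tensor_module R M N) (pure_tensor R M N)"
    and "\<lbrakk>submodule R W (tensor_module R M N);
      \<And>m n. \<lbrakk>m \<in> carrier M; n \<in> carrier N\<rbrakk> \<Longrightarrow> pure_tensor R M N m n \<in> W;
      t \<in> carrier (tensor_module R M N)\<rbrakk> \<Longrightarrow> t \<in> W"
    and "\<lbrakk>module R P; bilinear_map M N P \<beta>\<rbrakk> \<Longrightarrow>
      \<exists>\<theta>. mod_hom R (tensor_module R M N) P \<theta> \<and>
        (\<forall>m\<in>carrier M. \<forall>n\<in>carrier N. \<theta> (pure_tensor R M N m n) = \<beta> m n)"
proof -
  interpret M: module R M by fact
  interpret N: module R N by fact
  let ?F = "free_on R (carrier M \<times> carrier N)" and ?K = "tensor_rel R M N"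
  let ?e = "\<lambda>m n. free_gen R (carrier M \<times> carrier N) (m, n)"
  interpret F: module R ?F by (rule module_free_on)
  note rel = submodule_tensor_rel[OF M N]
  note T = F.quot_module_facts[OF rel, folded tensor_module_def]
  show TM: "module R (tensor_module R M N)" by (rule T(1))
  interpret g: mod_hom R ?F "tensor_module R M N" "\<lambda>x. ?K +>\<^bsub>?F\<^esub> x" by (rule T(2))
  have pt: "pure_tensor R M N m n = ?K +>\<^bsub>?F\<^esub> ?e m n" for m n by (simp add: pure_tensor_def)
  have eqI: "?K +>\<^bsub>?F\<^esub> x = ?K +>\<^bsub>?F\<^esub> y"
    if "x \<in> carrier ?F" "y \<in> carrier ?F" "x \<ominus>\<^bsub>?F\<^esub> y \<in> ?K" for x y
  proof -
    have "(?K +>\<^bsub>?F\<^esub> x) \<ominus>\<^bsub>tensor_module R M N\<^esub> (?K +>\<^bsub>?F\<^esub> y) = \<zero>\<^bsub>tensor_module R M N\<^esub>"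
      using T(4)[of "x \<ominus>\<^bsub>?F\<^esub> y"] that by simp
    then show ?thesis using that by simp
  qed
  note rels = tensor_relators[OF M N]
  note [simp] = free_gen_closed
  show "bilinear_map M N (tensor_module R M N) (pure_tensor R M N)"
    unfolding bilinear_map_def pt
  proof (intro conjI ballI)
    fix n assume n: "n \<in> carrier N"
    show "mod_hom R M (tensor_module R M N) (\<lambda>m. ?K +>\<^bsub>?F\<^esub> ?e m n)"
      by (rule mod_homI[OF M TM])
        (simp_all add: n rels eqI g.f_add[symmetric] g.f_smult[symmetric] del: g.f_add g.f_smult)
  next
    fix m assume m: "m \<in> carrier M"
    show "mod_hom R N (tensor_module R M N) (\<lambda>n. ?K +>\<^bsub>?F\<^esub> ?e m n)"
      by (rule mod_homI[OF N TM])
        (simp_all add: m rels eqI g.f_add[symmetric] g.f_smult[symmetric] del: g.f_add g.f_smult)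
  qed
  {
    assume W: "submodule R W (tensor_module R M N)" and t: "t \<in> carrier (tensor_module R M N)"
      and gen: "\<And>m n. \<lbrakk>m \<in> carrier M; n \<in> carrier N\<rbrakk> \<Longrightarrow> pure_tensor R M N m n \<in> W"
    obtain u where u: "u \<in> carrier ?F" "t = ?K +>\<^bsub>?F\<^esub> u" using t T(3) by auto
    have "u \<in> {u \<in> carrier ?F. ?K +>\<^bsub>?F\<^esub> u \<in> W}"
      by (rule free_on_generated[OF submodule_vimage[OF T(2) W] _ u(1)])
        (use gen in \<open>auto simp: pt\<close>)
    then show "t \<in> W" using u by blast
  }
  assume P: "module R P" and \<beta>: "bilinear_map M N P \<beta>"
  have cl: "\<beta> m n \<in> carrier P" if "m \<in> carrier M" "n \<in> carrier N" for m n
    using \<beta> that mod_hom.f_im[of R N P "\<beta> m" n] by (simp add: bilinear_map_def)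
  obtain h where h: "mod_hom R ?F P h"
    "\<And>x. x \<in> carrier M \<times> carrier N \<Longrightarrow> h (free_gen R (carrier M \<times> carrier N) x) = (\<lambda>(m, n). \<beta> m n) x"
    using free_on_universal[OF P, of "carrier M \<times> carrier N" "\<lambda>(m, n). \<beta> m n"] cl by auto
  have "h u = \<zero>\<^bsub>P\<^esub>" if "u \<in> carrier ?F" "?K +>\<^bsub>?F\<^esub> u = \<zero>\<^bsub>tensor_module R M N\<^esub>" for u
    using that T(4) h(2) by (intro tensor_rel_least[OF M N P h(1) \<beta>]) auto
  then obtain \<theta> where "mod_hom R (tensor_module R M N) P \<theta>" "\<forall>x\<in>carrier ?F. \<theta> (?K +>\<^bsub>?F\<^esub> x) = h x"
    using factor_hom[OF T(2,3) h(1)] by blast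
  then show "\<exists>\<theta>. mod_hom R (tensor_module R M N) P \<theta> \<and>
      (\<forall>m\<in>carrier M. \<forall>n\<in>carrier N. \<theta> (pure_tensor R M N m n) = \<beta> m n)"
    using h(2) by (intro exI[of _ \<theta>]) (auto simp: pt)
qed

lemma pure_tensor_closed:
  assumes "module R M" "module R N" "m \<in> carrier M" "n \<in> carrier N"
  shows "pure_tensor R M N m n \<in> carrier (tensor_module R M N)"
  using tensor_facts(2)[OF assms(1,2)] assms(3,4) mod_hom.f_im
  unfolding bilinear_map_def by metis

text \<open>The map \<open>\<phi> \<otimes> \<psi>\<close> is defined by a definite description. Existence comes from the universal
  property, uniqueness from generation by pure tensors together with extensionality.\<close>

lemma tensor_map_facts:
  assumes M: "module R M" and N: "module R N" and M': "module R M'" and N': "module R N'"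
    and \<phi>: "mod_hom R M M' \<phi>" and \<psi>: "mod_hom R N N' \<psi>"
  defines "\<theta> \<equiv> tensor_map R M N M' N' \<phi> \<psi>"
  shows "mod_hom R (tensor_module R M N) (tensor_module R M' N') \<theta>"
    and "\<lbrakk>m \<in> carrier M; n \<in> carrier N\<rbrakk> \<Longrightarrow> \<theta> (pure_tensor R M N m n) = pure_tensor R M' N' (\<phi> m) (\<psi> n)"
proof -
  let ?T = "tensor_module R M N" and ?T' = "tensor_module R M' N'"
  interpret p: mod_hom R M M' \<phi> by fact
  interpret q: mod_hom R N N' \<psi> by fact
  note T = tensor_facts[OF M N] and T' = tensor_facts[OF M' N']
  interpret T: module R ?T by (rule T)
  interpret T': module R ?T' by (rule T')
  have "bilinear_map M N ?T' (\<lambda>m n. pure_tensor R M' N' (\<phi> m) (\<psi> n))"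
    unfolding bilinear_map_def
  proof (intro conjI ballI)
    fix n assume "n \<in> carrier N"
    then show "mod_hom R M ?T' (\<lambda>m. pure_tensor R M' N' (\<phi> m) (\<psi> n))"
      using T'(2) by (intro mod_hom_comp[OF \<phi>]) (simp add: bilinear_map_def)
  next
    fix m assume "m \<in> carrier M"
    then show "mod_hom R N ?T' (\<lambda>n. pure_tensor R M' N' (\<phi> m) (\<psi> n))"
      using T'(2) by (intro mod_hom_comp[OF \<psi>]) (simp add: bilinear_map_def)
  qed
  from T(4)[OF T'(1) this] obtain h where h: "mod_hom R ?T ?T' h"
    "\<And>m n. \<lbrakk>m \<in> carrier M; n \<in> carrier N\<rbrakk> \<Longrightarrow> h (pure_tensor R M N m n) = pure_tensor R M' N' (\<phi> m) (\<psi> n)"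
    by blast
  interpret h: mod_hom R ?T ?T' h by (rule h)
  let ?Q = "\<lambda>\<theta>. \<theta> \<in> module_hom R ?T ?T' \<and> \<theta> \<in> extensional (carrier ?T) \<and>
    (\<forall>m\<in>carrier M. \<forall>n\<in>carrier N. \<theta> (pure_tensor R M N m n) = pure_tensor R M' N' (\<phi> m) (\<psi> n))"
  have hom: "mod_hom R ?T ?T' \<theta>" if "?Q \<theta>" for \<theta>
    using that T.module_axioms T'.module_axioms by (simp add: mod_hom_def mod_hom_axioms_def)
  have "?Q (restrict h (carrier ?T))"
    using h by (auto simp: module_hom_def pure_tensor_closed[OF M N])
  moreover have "\<theta>1 = \<theta>2" if 1: "?Q \<theta>1" and 2: "?Q \<theta>2" for \<theta>1 \<theta>2
  proof (rule extensionalityI[of _ "carrier ?T"])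
    fix t assume t: "t \<in> carrier ?T"
    interpret h1: mod_hom R ?T ?T' \<theta>1 by (rule hom[OF 1])
    interpret h2: mod_hom R ?T ?T' \<theta>2 by (rule hom[OF 2])
    have "t \<in> {t \<in> carrier ?T. \<theta>1 t \<ominus>\<^bsub>?T'\<^esub> \<theta>2 t \<in> {\<zero>\<^bsub>?T'\<^esub>}}"
      by (rule T(3)[OF submodule_vimage[OF mod_hom_diff[OF hom[OF 1] hom[OF 2]] T'.submodule_singleton_zero] _ t])
        (use 1 2 in \<open>auto simp: pure_tensor_closed[OF M N] pure_tensor_closed[OF M' N']\<close>)
    then show "\<theta>1 t = \<theta>2 t" using t by simp
  qed (use 1 2 in auto)
  ultimately have "\<exists>!\<theta>. ?Q \<theta>" by (intro ex1I)
  from theI'[OF this] have "?Q \<theta>" unfolding \<theta>_def tensor_map_def .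
  then show "mod_hom R ?T ?T' \<theta>" "\<lbrakk>m \<in> carrier M; n \<in> carrier N\<rbrakk> \<Longrightarrow>
      \<theta> (pure_tensor R M N m n) = pure_tensor R M' N' (\<phi> m) (\<psi> n)"
    using hom by auto
qed

end

subsection \<open>Tensoring with a quotient of the ring\<close>

context cring
begin

definition quot_one :: "'a set \<Rightarrow> 'a set" where "quot_one I = I +>\<^bsub>regular_module R\<^esub> \<one>"

text \<open>The isomorphism \<open>M \<otimes> R/I \<cong> M/IM\<close>, in the form of a surjection from \<open>M\<close> with kernel \<open>I M\<close>. A
  tensor \<open>m \<otimes> [c]\<close> equals \<open>c m \<otimes> [1]\<close>, which gives surjectivity, and the kernel is not larger than
  \<open>I M\<close> because \<open>(m, [c]) \<mapsto> [c m]\<close> is a well-defined bilinear map to \<open>M/IM\<close>. The map \<open>\<tau>\<close> stands for the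
  tensor product in either order of the factors, since the quotient ring occurs on the right in Tor and on
  the left in the reduction of a matrix factorization modulo a regular sequence.\<close>

lemma tensor_quot_ring:
  fixes M :: "('a, 'm) module" and T :: "('a, 't) module"
  assumes M: "module R M" and I: "ideal I R" and T: "module R T"
    and \<tau>: "bilinear_map M (quot_module (regular_module R) I) T \<tau>"
    and gen: "\<And>W t. \<lbrakk>submodule R W T;
      \<And>m q. \<lbrakk>m \<in> carrier M; q \<in> carrier (quot_module (regular_module R) I)\<rbrakk> \<Longrightarrow> \<tau> m q \<in> W;
      t \<in> carrier T\<rbrakk> \<Longrightarrow> t \<in> W"
    and univ: "\<And>\<beta>. bilinear_map M (quot_module (regular_module R) I)
        (quot_module M (ideal_times R M I (carrier M))) \<beta> \<Longrightarrow>
      \<exists>\<theta>. mod_hom R T (quot_module M (ideal_times R M I (carrier M))) \<theta> \<and>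
        (\<forall>m\<in>carrier M. \<forall>q\<in>carrier (quot_module (regular_module R) I). \<theta> (\<tau> m q) = \<beta> m q)"
  shows "mod_hom R M T (\<lambda>x. \<tau> x (quot_one I))"
    and "carrier T = (\<lambda>x. \<tau> x (quot_one I)) ` carrier M"
    and "x \<in> carrier M \<Longrightarrow> \<tau> x (quot_one I) = \<zero>\<^bsub>T\<^esub> \<longleftrightarrow> x \<in> ideal_times R M I (carrier M)"
proof -
  interpret M: module R M by fact
  interpret T: module R T by fact
  interpret S: module R "regular_module R" by (rule module_regular)
  interpret I: ideal I R by fact
  let ?k = "quot_module (regular_module R) I" and ?IM = "ideal_times R M I (carrier M)"
  have Ic: "I \<subseteq> carrier R" using I.Icarr by blast
  note k = S.quot_module_facts[OF submodule_regular[OF I], unfolded regular_module_simps]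
  note Q = M.quot_module_facts[OF M.submodule_ideal_times[OF Ic subset_refl]]
  interpret k: mod_hom R "regular_module R" ?k "\<lambda>c. I +>\<^bsub>regular_module R\<^esub> c" by (rule k(2))
  have one: "quot_one I \<in> carrier ?k" by (auto simp: quot_one_def k(3))
  have coset: "I +>\<^bsub>regular_module R\<^esub> c = c \<odot>\<^bsub>?k\<^esub> quot_one I" if "c \<in> carrier R" for c
    using k.f_smult[of c \<one>] that by (simp add: quot_one_def regular_module_simps)
  have l: "mod_hom R M T (\<lambda>m. \<tau> m q)" if "q \<in> carrier ?k" for q using \<tau> that by (simp add: bilinear_map_def)
  have r: "mod_hom R ?k T (\<tau> m)" if "m \<in> carrier M" for m using \<tau> that by (simp add: bilinear_map_def)
  show hom: "mod_hom R M T (\<lambda>x. \<tau> x (quot_one I))" by (rule l[OF one])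
  interpret t: mod_hom R M T "\<lambda>x. \<tau> x (quot_one I)" by (rule hom)
  have move: "\<tau> x (c \<odot>\<^bsub>?k\<^esub> quot_one I) = \<tau> (c \<odot>\<^bsub>M\<^esub> x) (quot_one I)" if "x \<in> carrier M" "c \<in> carrier R" for x c
    using that mod_hom_smult[OF r _ one] mod_hom_smult[OF l[OF one]] by simp
  show "carrier T = (\<lambda>x. \<tau> x (quot_one I)) ` carrier M"
  proof
    show "carrier T \<subseteq> (\<lambda>x. \<tau> x (quot_one I)) ` carrier M"
    proof
      fix t assume t: "t \<in> carrier T"
      show "t \<in> (\<lambda>x. \<tau> x (quot_one I)) ` carrier M"
      proof (rule gen[OF submodule_image[OF hom M.submodule_carrier] _ t])
        fix m q assume "m \<in> carrier M" "q \<in> carrier ?k"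
        then obtain c where "c \<in> carrier R" "q = c \<odot>\<^bsub>?k\<^esub> quot_one I" using k(3) coset by auto
        then show "\<tau> m q \<in> (\<lambda>x. \<tau> x (quot_one I)) ` carrier M"
          using move[OF \<open>m \<in> carrier M\<close>, of c] \<open>m \<in> carrier M\<close> M.smult_closed by blast
      qed
    qed
  qed auto
  assume x: "x \<in> carrier M"
  show "\<tau> x (quot_one I) = \<zero>\<^bsub>T\<^esub> \<longleftrightarrow> x \<in> ?IM"
  proof
    assume "x \<in> ?IM"
    moreover have "\<tau> (a \<odot>\<^bsub>M\<^esub> y) (quot_one I) = \<zero>\<^bsub>T\<^esub>" if "a \<in> I" "y \<in> carrier M" for a y
    proof -
      have a: "a \<in> carrier R" using that Ic by blast
      then have "a \<odot>\<^bsub>?k\<^esub> quot_one I = \<zero>\<^bsub>?k\<^esub>" using k(4)[of a] that coset by simp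
      then show ?thesis using move[OF that(2) a] mod_hom.f0_is_0[OF r[OF that(2)]] by simp
    qed
    then have "?IM \<subseteq> {x \<in> carrier M. \<tau> x (quot_one I) \<in> {\<zero>\<^bsub>T\<^esub>}}"
      by (intro M.ideal_times_least submodule_vimage[OF hom T.submodule_singleton_zero])
        (use Ic in auto)
    ultimately show "\<tau> x (quot_one I) = \<zero>\<^bsub>T\<^esub>" by blast
  next
    assume zero: "\<tau> x (quot_one I) = \<zero>\<^bsub>T\<^esub>"
    interpret q: mod_hom R M "quot_module M ?IM" "\<lambda>x. ?IM +>\<^bsub>M\<^esub> x" by (rule Q(2))
    have "\<exists>h. mod_hom R ?k (quot_module M ?IM) h \<and>
        (\<forall>c\<in>carrier R. h (I +>\<^bsub>regular_module R\<^esub> c) = ?IM +>\<^bsub>M\<^esub> (c \<odot>\<^bsub>M\<^esub> m))" if m: "m \<in> carrier M" for m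
    proof -
      have "?IM +>\<^bsub>M\<^esub> (c \<odot>\<^bsub>M\<^esub> m) = \<zero>\<^bsub>quot_module M ?IM\<^esub>"
        if "c \<in> carrier (regular_module R)" "I +>\<^bsub>regular_module R\<^esub> c = \<zero>\<^bsub>?k\<^esub>" for c
      proof -
        have c: "c \<in> carrier R" using that(1) by (simp add: regular_module_simps)
        then have "c \<in> I" using k(4) that(2) by blast
        then show ?thesis
          using Q(4)[OF M.smult_closed[OF c m]] M.ideal_timesI[OF Ic subset_refl _ m] by blast
      qed
      from factor_hom[OF k(2) S.quot_module_facts(3)[OF submodule_regular[OF I]]
          mod_hom_comp[OF M.smult_left_hom[OF m] Q(2)] this]
      obtain h where "mod_hom R ?k (quot_module M ?IM) h"
        "\<forall>c\<in>carrier (regular_module R). h (I +>\<^bsub>regular_module R\<^esub> c) = ?IM +>\<^bsub>M\<^esub> (c \<odot>\<^bsub>M\<^esub> m)"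
        by blast
      then show ?thesis unfolding regular_module_simps(1) by blast
    qed
    then obtain \<beta> where \<beta>: "\<And>m. m \<in> carrier M \<Longrightarrow> mod_hom R ?k (quot_module M ?IM) (\<beta> m)"
      "\<And>m c. \<lbrakk>m \<in> carrier M; c \<in> carrier R\<rbrakk> \<Longrightarrow>
        \<beta> m (I +>\<^bsub>regular_module R\<^esub> c) = ?IM +>\<^bsub>M\<^esub> (c \<odot>\<^bsub>M\<^esub> m)" by metis
    have "bilinear_map M ?k (quot_module M ?IM) \<beta>"
      unfolding bilinear_map_def
    proof (intro conjI ballI)
      fix q assume "q \<in> carrier ?k"
      then obtain c where c: "c \<in> carrier R" "q = I +>\<^bsub>regular_module R\<^esub> c" using k(3) by auto
      have "mod_hom R M (quot_module M ?IM) (\<lambda>m. ?IM +>\<^bsub>M\<^esub> (c \<odot>\<^bsub>M\<^esub> m))"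
        by (rule mod_hom_comp[OF mod_hom_scale[OF mod_hom_ident[OF M] c(1)] Q(2)])
      then show "mod_hom R M (quot_module M ?IM) (\<lambda>m. \<beta> m q)"
        by (rule mod_hom_cong) (simp add: c \<beta>(2))
    qed (use \<beta>(1) in auto)
    then obtain \<theta> where \<theta>: "mod_hom R T (quot_module M ?IM) \<theta>" "\<theta> (\<tau> x (quot_one I)) = \<beta> x (quot_one I)"
      using univ[of \<beta>] x one by blast
    have "?IM +>\<^bsub>M\<^esub> x = \<zero>\<^bsub>quot_module M ?IM\<^esub>"
      using \<theta>(2) \<beta>(2)[OF x one_closed] x mod_hom.f0_is_0[OF \<theta>(1)] zero by (simp add: quot_one_def)
    then show "x \<in> ?IM" using Q(4)[OF x] by simp
  qed
qed

lemma tensor_quot_right: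
  fixes M :: "('a, 'm) module"
  assumes M: "module R M" and I: "ideal I R"
  defines "k \<equiv> quot_module (regular_module R) I"
  shows "mod_hom R M (tensor_module R M k) (\<lambda>x. pure_tensor R M k x (quot_one I))"
    and "carrier (tensor_module R M k) = (\<lambda>x. pure_tensor R M k x (quot_one I)) ` carrier M"
    and "x \<in> carrier M \<Longrightarrow> pure_tensor R M k x (quot_one I) = \<zero>\<^bsub>tensor_module R M k\<^esub> \<longleftrightarrow>
      x \<in> ideal_times R M I (carrier M)"
proof -
  have "module R k" unfolding k_def
    by (rule module.quot_module_facts(1)[OF module_regular submodule_regular[OF I]])
  note T = tensor_facts[OF M this]
  have Q: "module R (quot_module M (ideal_times R M I (carrier M)))"
    using ideal.Icarr[OF I]
    by (intro module.quot_module_facts(1)[OF M] module.submodule_ideal_times[OF M]) auto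
  note aux = tensor_quot_ring[OF M I T(1,2)[unfolded k_def] T(3)[unfolded k_def] T(4)[OF Q, unfolded k_def], folded k_def]
  show "mod_hom R M (tensor_module R M k) (\<lambda>x. pure_tensor R M k x (quot_one I))"
    "carrier (tensor_module R M k) = (\<lambda>x. pure_tensor R M k x (quot_one I)) ` carrier M"
    "x \<in> carrier M \<Longrightarrow> pure_tensor R M k x (quot_one I) = \<zero>\<^bsub>tensor_module R M k\<^esub> \<longleftrightarrow>
      x \<in> ideal_times R M I (carrier M)"
    by (rule aux; assumption)+
qed

lemma tensor_quot_left:
  fixes M :: "('a, 'm) module"
  assumes M: "module R M" and I: "ideal I R"
  defines "k \<equiv> quot_module (regular_module R) I"
  shows "mod_hom R M (tensor_module R k M) (pure_tensor R k M (quot_one I))"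
    and "carrier (tensor_module R k M) = pure_tensor R k M (quot_one I) ` carrier M"
    and "x \<in> carrier M \<Longrightarrow> pure_tensor R k M (quot_one I) x = \<zero>\<^bsub>tensor_module R k M\<^esub> \<longleftrightarrow>
      x \<in> ideal_times R M I (carrier M)"
proof -
  have k: "module R k" unfolding k_def
    by (rule module.quot_module_facts(1)[OF module_regular submodule_regular[OF I]])
  note T = tensor_facts[OF k M]
  have Q: "module R (quot_module M (ideal_times R M I (carrier M)))"
    using ideal.Icarr[OF I]
    by (intro module.quot_module_facts(1)[OF M] module.submodule_ideal_times[OF M]) auto
  have b: "bilinear_map M k (tensor_module R k M) (\<lambda>m q. pure_tensor R k M q m)"
    using T(2) by (simp add: bilinear_map_def)
  have g: "t \<in> W" if "submodule R W (tensor_module R k M)"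
    "\<And>m q. \<lbrakk>m \<in> carrier M; q \<in> carrier k\<rbrakk> \<Longrightarrow> pure_tensor R k M q m \<in> W"
    "t \<in> carrier (tensor_module R k M)" for W t
    by (rule T(3)[OF that(1) _ that(3)]) (rule that(2))
  have u: "\<exists>\<theta>. mod_hom R (tensor_module R k M) (quot_module M (ideal_times R M I (carrier M))) \<theta> \<and>
        (\<forall>m\<in>carrier M. \<forall>q\<in>carrier k. \<theta> (pure_tensor R k M q m) = \<beta> m q)"
    if "bilinear_map M k (quot_module M (ideal_times R M I (carrier M))) \<beta>" for \<beta>
    using T(4)[OF Q, of "\<lambda>q m. \<beta> m q"] that by (auto simp: bilinear_map_def)
  note aux = tensor_quot_ring[OF M I T(1)[unfolded k_def] b[unfolded k_def] g[unfolded k_def] u[unfolded k_def], folded k_def]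
  show "mod_hom R M (tensor_module R k M) (pure_tensor R k M (quot_one I))"
    "carrier (tensor_module R k M) = pure_tensor R k M (quot_one I) ` carrier M"
    "x \<in> carrier M \<Longrightarrow> pure_tensor R k M (quot_one I) x = \<zero>\<^bsub>tensor_module R k M\<^esub> \<longleftrightarrow>
      x \<in> ideal_times R M I (carrier M)"
    by (rule aux; assumption)+
qed

end

section \<open>Betti numbers from minimal resolutions\<close>

subsection \<open>Comparison with an arbitrary resolution\<close>

context minimal_resolution
begin

text \<open>Tor may be computed from any resolution, so a minimal one has to be compared with an arbitrary
  one. Let \<open>\<phi>\<close> and \<open>\<psi>\<close> be chain maps in both directions, with homotopies from \<open>\<psi> \<phi>\<close> and \<open>\<phi> \<psi>\<close> to
  the identity. Modulo \<open>J\<close> the differential of the minimal resolution vanishes, so \<open>\<psi> \<phi>\<close> becomes the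
  identity, while \<open>\<phi> \<psi>\<close> moves cycles modulo \<open>J\<close> by boundaries only. Hence, modulo \<open>J\<close>, the map
  \<open>\<phi>\<close> sends every vector to a cycle, only vectors with coordinates in \<open>J\<close> to boundaries, and it meets
  every homology class. In other words, \<open>\<phi>\<close> induces an isomorphism from \<open>R\<^sup>n / J R\<^sup>n\<close> to homology,
  expressed here without tensor products.\<close>

lemma compare_resolutions:
  assumes G: "subquotient_resolution R M P N g \<gamma> \<zeta>"
  defines "T \<equiv> \<lambda>l. ideal_times R (free_power R l) J (carrier (free_power R l))"
  shows "\<exists>\<phi>. (\<forall>i. mod_hom R (F i) (free_power R (g i)) (\<phi> i)) \<and>
    (\<forall>i. \<forall>x\<in>carrier (F (Suc i)). \<gamma> i (\<phi> (Suc i) x) \<in> T (g i)) \<and>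
    (\<forall>i. \<forall>x\<in>carrier (F i). \<forall>u\<in>carrier (free_power R (g (Suc i))).
       \<phi> i x \<ominus>\<^bsub>free_power R (g i)\<^esub> \<gamma> i u \<in> T (g i) \<longrightarrow> x \<in> T (n i)) \<and>
    (\<forall>i. \<forall>w\<in>carrier (free_power R (g i)).
       (\<forall>j. i = Suc j \<longrightarrow> \<gamma> j w \<in> T (g j)) \<longrightarrow>
       (\<exists>x\<in>carrier (F i). \<exists>u\<in>carrier (free_power R (g (Suc i))).
          (\<phi> i x \<ominus>\<^bsub>free_power R (g i)\<^esub> w) \<ominus>\<^bsub>free_power R (g i)\<^esub> \<gamma> i u \<in> T (g i)))"
proof -
  interpret G: subquotient_resolution R M P N g \<gamma> \<zeta> by fact
  interpret J: ideal J R by (rule J_ideal)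
  interpret FF: module R "free_power R l" for l by (rule module_free_power)
  interpret e: mod_hom R "F 0" M \<epsilon> by (rule eps_hom)
  interpret z: mod_hom R "G.F 0" M \<zeta> by (rule G.eps_hom)
  interpret d: mod_hom R "F (Suc i)" "F i" "\<delta> i" for i by (rule delta_hom)
  interpret c: mod_hom R "G.F (Suc i)" "G.F i" "\<gamma> i" for i by (rule G.delta_hom)
  have Jc: "J \<subseteq> carrier R" using J.Icarr by blast
  have T: "submodule R (T l) (free_power R l)" for l
    unfolding T_def by (rule submodule_ideal_times_free_power[OF J_ideal])
  have T_image: "h x \<in> T l'" if "mod_hom R (free_power R l) (free_power R l') h" "x \<in> T l" for h l l' x
    unfolding T_def
    by (rule ideal_times_image[OF that(1) Jc subset_refl subset_refl _ that(2)[unfolded T_def]])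
      (use mod_hom.f_im[OF that(1)] in auto)
  have dT: "\<delta> i x \<in> T (n i)" if "x \<in> carrier (F (Suc i))" for i x
    using delta_minimal that unfolding minimal_map_def T_def by blast
  have Tc: "x \<in> carrier (free_power R l)" if "x \<in> T l" for x l using that submodule.subset[OF T] by blast
  obtain \<phi> where \<phi>: "\<And>i. mod_hom R (F i) (G.F i) (\<phi> i)"
    "\<And>x. x \<in> carrier (F 0) \<Longrightarrow> \<zeta> (\<phi> 0 x) \<ominus>\<^bsub>M\<^esub> \<epsilon> x \<in> N"
    "\<And>i x. x \<in> carrier (F (Suc i)) \<Longrightarrow> \<gamma> i (\<phi> (Suc i) x) = \<phi> i (\<delta> i x)"
    using G.lift_chain_map[OF delta_hom delta_delta eps_hom eps_P eps_delta] by blast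
  obtain \<psi> where \<psi>: "\<And>i. mod_hom R (G.F i) (F i) (\<psi> i)"
    "\<And>x. x \<in> carrier (G.F 0) \<Longrightarrow> \<epsilon> (\<psi> 0 x) \<ominus>\<^bsub>M\<^esub> \<zeta> x \<in> N"
    "\<And>i x. x \<in> carrier (G.F (Suc i)) \<Longrightarrow> \<delta> i (\<psi> (Suc i) x) = \<psi> i (\<gamma> i x)"
    using lift_chain_map[OF G.delta_hom G.delta_delta G.eps_hom G.eps_P G.eps_delta] by blast
  interpret p: mod_hom R "F i" "G.F i" "\<phi> i" for i by (rule \<phi>)
  interpret q: mod_hom R "G.F i" "F i" "\<psi> i" for i by (rule \<psi>)
  have eN: "\<epsilon> (\<psi> 0 (\<phi> 0 x) \<ominus>\<^bsub>F 0\<^esub> x) \<in> N" if "x \<in> carrier (F 0)" for x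
  proof -
    have "(\<epsilon> (\<psi> 0 (\<phi> 0 x)) \<ominus>\<^bsub>M\<^esub> \<zeta> (\<phi> 0 x)) \<oplus>\<^bsub>M\<^esub> (\<zeta> (\<phi> 0 x) \<ominus>\<^bsub>M\<^esub> \<epsilon> x) \<in> N"
      using \<psi>(2)[of "\<phi> 0 x"] \<phi>(2)[of x] that submodule.m_closed[OF sub_N] by simp
    then show ?thesis using that by (simp add: M.minus_eq M.a_assoc M.r_neg1)
  qed
  have zN: "\<zeta> (\<phi> 0 (\<psi> 0 x) \<ominus>\<^bsub>G.F 0\<^esub> x) \<in> N" if "x \<in> carrier (G.F 0)" for x
  proof -
    have "(\<zeta> (\<phi> 0 (\<psi> 0 x)) \<ominus>\<^bsub>M\<^esub> \<epsilon> (\<psi> 0 x)) \<oplus>\<^bsub>M\<^esub> (\<epsilon> (\<psi> 0 x) \<ominus>\<^bsub>M\<^esub> \<zeta> x) \<in> N"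
      using \<phi>(2)[of "\<psi> 0 x"] \<psi>(2)[of x] that submodule.m_closed[OF sub_N] by simp
    then show ?thesis using that by (simp add: M.minus_eq M.a_assoc M.r_neg1)
  qed
  have "mod_hom R (F i) (F i) (\<lambda>x. \<psi> i (\<phi> i x) \<ominus>\<^bsub>F i\<^esub> x)" for i
    by (intro mod_hom_diff mod_hom_comp[OF \<phi>(1) \<psi>(1)] mod_hom_ident module_free_power)
  from null_homotopy[OF delta_hom delta_delta this] eN
  obtain s where s: "\<And>i. mod_hom R (F i) (F (Suc i)) (s i)"
    "\<And>x. x \<in> carrier (F 0) \<Longrightarrow> \<psi> 0 (\<phi> 0 x) \<ominus>\<^bsub>F 0\<^esub> x = \<delta> 0 (s 0 x)"
    "\<And>i x. x \<in> carrier (F (Suc i)) \<Longrightarrow> \<psi> (Suc i) (\<phi> (Suc i) x) \<ominus>\<^bsub>F (Suc i)\<^esub> x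
       = \<delta> (Suc i) (s (Suc i) x) \<oplus>\<^bsub>F (Suc i)\<^esub> s i (\<delta> i x)"
    by (simp add: \<phi>(3) \<psi>(3)) blast
  have "mod_hom R (G.F i) (G.F i) (\<lambda>x. \<phi> i (\<psi> i x) \<ominus>\<^bsub>G.F i\<^esub> x)" for i
    by (intro mod_hom_diff mod_hom_comp[OF \<psi>(1) \<phi>(1)] mod_hom_ident module_free_power)
  from G.null_homotopy[OF G.delta_hom G.delta_delta this] zN
  obtain t where t: "\<And>i. mod_hom R (G.F i) (G.F (Suc i)) (t i)"
    "\<And>x. x \<in> carrier (G.F 0) \<Longrightarrow> \<phi> 0 (\<psi> 0 x) \<ominus>\<^bsub>G.F 0\<^esub> x = \<gamma> 0 (t 0 x)"
    "\<And>i x. x \<in> carrier (G.F (Suc i)) \<Longrightarrow> \<phi> (Suc i) (\<psi> (Suc i) x) \<ominus>\<^bsub>G.F (Suc i)\<^esub> x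
       = \<gamma> (Suc i) (t (Suc i) x) \<oplus>\<^bsub>G.F (Suc i)\<^esub> t i (\<gamma> i x)"
    by (simp add: \<phi>(3) \<psi>(3)) blast
  interpret s: mod_hom R "F i" "F (Suc i)" "s i" for i by (rule s)
  interpret t: mod_hom R "G.F i" "G.F (Suc i)" "t i" for i by (rule t)
  show ?thesis
  proof (intro exI[of _ \<phi>] conjI allI ballI impI)
    show "mod_hom R (F i) (G.F i) (\<phi> i)" for i by (rule \<phi>)
    show "\<gamma> i (\<phi> (Suc i) x) \<in> T (g i)" if "x \<in> carrier (F (Suc i))" for i x
      using that \<phi>(3) T_image[OF \<phi>(1) dT] by simp
  next
    fix i x u assume x: "x \<in> carrier (F i)" and u: "u \<in> carrier (G.F (Suc i))"
      and near: "\<phi> i x \<ominus>\<^bsub>G.F i\<^esub> \<gamma> i u \<in> T (g i)"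
    have "\<psi> i (\<phi> i x \<ominus>\<^bsub>G.F i\<^esub> \<gamma> i u) \<in> T (n i)" by (rule T_image[OF \<psi>(1) near])
    then have "\<psi> i (\<phi> i x) \<ominus>\<^bsub>F i\<^esub> \<delta> i (\<psi> (Suc i) u) \<in> T (n i)" using x u by (simp add: \<psi>(3))
    from FF.submodule_diff_iff[OF T _ _ this] have 1: "\<psi> i (\<phi> i x) \<in> T (n i)"
      using dT[of "\<psi> (Suc i) u" i] x u by simp
    have 2: "\<psi> i (\<phi> i x) \<ominus>\<^bsub>F i\<^esub> x \<in> T (n i)"
    proof (cases i)
      case 0
      then show ?thesis using s(2) dT x by simp
    next
      case (Suc j)
      have "s j (\<delta> j x) \<in> T (n i)" using T_image[OF s(1) dT] x Suc by simp
      then show ?thesis using s(3)[of x j] dT[of "s i x" i] x Suc submodule.m_closed[OF T] by simp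
    qed
    from FF.submodule_diff_iff[OF T _ _ 2] show "x \<in> T (n i)" using 1 x by simp
  next
    fix i w assume w: "w \<in> carrier (G.F i)" and cyc: "\<forall>j. i = Suc j \<longrightarrow> \<gamma> j w \<in> T (g j)"
    have "(\<phi> i (\<psi> i w) \<ominus>\<^bsub>G.F i\<^esub> w) \<ominus>\<^bsub>G.F i\<^esub> \<gamma> i (t i w) \<in> T (g i)"
    proof (cases i)
      case 0
      then show ?thesis
        using t(2)[of w] w submodule.zero_closed[OF T] by (simp add: FF.M.minus_eq FF.M.r_neg)
    next
      case (Suc j)
      have "t j (\<gamma> j w) \<in> T (g i)" using T_image[OF t(1)] cyc w Suc by simp
      moreover have "(\<phi> i (\<psi> i w) \<ominus>\<^bsub>G.F i\<^esub> w) \<ominus>\<^bsub>G.F i\<^esub> \<gamma> i (t i w) = t j (\<gamma> j w)"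
        unfolding Suc t(3)[OF w[unfolded Suc]]
        using w Suc by (simp add: FF.M.minus_eq FF.M.a_ac FF.M.r_neg1 FF.M.r_neg)
      ultimately show ?thesis by simp
    qed
    then show "\<exists>x\<in>carrier (F i). \<exists>u\<in>carrier (G.F (Suc i)).
        (\<phi> i x \<ominus>\<^bsub>G.F i\<^esub> w) \<ominus>\<^bsub>G.F i\<^esub> \<gamma> i u \<in> T (g i)"
      using w q.f_im t.f_im by blast
  qed
qed

end

subsection \<open>Dimension over the residue field\<close>

context module
begin

lemma lincomb_reindex:
  assumes "inj_on b {..<n}" "b ` {..<n} \<subseteq> carrier M" "a \<in> b ` {..<n} \<rightarrow> carrier R"
  shows "lincomb a (b ` {..<n}) = lin_comb M n b (\<lambda>j. a (b j))"
  unfolding lincomb_def lin_comb_def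
  by (rule M.finsum_reindex) (use assms in auto)

end

lemma (in ideal) quot_elem_exists:
  "X \<in> carrier (R Quot I) \<Longrightarrow> \<exists>c\<in>carrier R. X = I +> c"
  by (auto simp: FactRing_def A_RCOSETS_def')

context cring
begin

text \<open>If \<open>V\<close> is isomorphic to \<open>R\<^sup>n / J R\<^sup>n\<close>, then the images of the unit vectors form a basis of \<open>V\<close> over
  the field \<open>R/J\<close>.\<close>

lemma dim_coset_scalars:
  fixes V :: "('a, 'v) module"
  assumes J: "maximalideal J R" and \<theta>: "mod_hom R (free_power R n) V \<theta>"
    and surj: "carrier V = \<theta> ` carrier (free_power R n)"
    and ker: "\<And>x. x \<in> carrier (free_power R n) \<Longrightarrow> \<theta> x = \<zero>\<^bsub>V\<^esub> \<longleftrightarrow> (\<forall>j<n. x j \<in> J)"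
  shows "vectorspace.dim (R Quot J) (coset_scalars V) = n"
proof -
  interpret J: maximalideal J R by fact
  interpret t: mod_hom R "free_power R n" V \<theta> by fact
  let ?K = "R Quot J" and ?W = "coset_scalars V"
  have field: "field ?K" by (rule J.quotient_is_field) (rule is_cring)
  interpret K: field ?K by (rule field)
  have JV: "i \<odot>\<^bsub>V\<^esub> v = \<zero>\<^bsub>V\<^esub>" if i: "i \<in> J" and v: "v \<in> carrier V" for i v
  proof -
    have ic: "i \<in> carrier R" using J.Icarr[OF i] .
    obtain x where x: "x \<in> carrier (free_power R n)" "v = \<theta> x" using v surj by auto
    have "\<forall>j<n. (i \<odot>\<^bsub>free_power R n\<^esub> x) j \<in> J"
      using i x(1) J.I_r_closed by (simp add: free_power_coord)
    then have "\<theta> (i \<odot>\<^bsub>free_power R n\<^esub> x) = \<zero>\<^bsub>V\<^esub>"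
      by (intro ker[THEN iffD2]) (use ic x(1) in simp_all)
    then show ?thesis using ic x by simp
  qed
  have W: "carrier ?W = carrier V" "\<zero>\<^bsub>?W\<^esub> = \<zero>\<^bsub>V\<^esub>" "v \<oplus>\<^bsub>?W\<^esub> w = v \<oplus>\<^bsub>V\<^esub> w" for v w
    by (simp_all add: coset_scalars_def)
  \<comment> \<open>all representatives of a coset act in the same way, as \<open>J\<close> annihilates \<open>V\<close>\<close>
  have smult: "(J +> c) \<odot>\<^bsub>?W\<^esub> v = c \<odot>\<^bsub>V\<^esub> v" if c: "c \<in> carrier R" and v: "v \<in> carrier V" for c v
  proof -
    have const: "r \<odot>\<^bsub>V\<^esub> v = c \<odot>\<^bsub>V\<^esub> v" if "r \<in> J +> c" for r
    proof -
      from that obtain i where "i \<in> J" "r = i \<oplus> c" by (auto simp: a_r_coset_def')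
      then show ?thesis using JV[of i v] J.Icarr[of i] c v by (simp add: t.N.smult_l_distr)
    qed
    have "(THE w. \<forall>r\<in>J +> c. r \<odot>\<^bsub>V\<^esub> v = w) = c \<odot>\<^bsub>V\<^esub> v"
    proof (rule the_equality)
      fix w assume "\<forall>r\<in>J +> c. r \<odot>\<^bsub>V\<^esub> v = w"
      then have "c \<odot>\<^bsub>V\<^esub> v = w" using J.a_rcos_self[OF c] by blast
      then show "w = c \<odot>\<^bsub>V\<^esub> v" by (rule sym)
    qed (use const in blast)
    then show ?thesis by (simp add: coset_scalars_def)
  qed
  note el = J.quot_elem_exists
  have "vectorspace ?K ?W"
  proof (rule vs_criteria[OF field]; (unfold W)?)
    show "\<forall>c v. c \<in> carrier ?K \<and> v \<in> carrier V \<longrightarrow> c \<odot>\<^bsub>?W\<^esub> v \<in> carrier V"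
    proof (intro allI impI, elim conjE)
      fix c v assume "c \<in> carrier ?K" "v \<in> carrier V"
      then show "c \<odot>\<^bsub>?W\<^esub> v \<in> carrier V" using el[of c] smult by auto
    qed
    show "\<forall>a b v. a \<in> carrier ?K \<and> b \<in> carrier ?K \<and> v \<in> carrier V \<longrightarrow>
        (a \<otimes>\<^bsub>?K\<^esub> b) \<odot>\<^bsub>?W\<^esub> v = a \<odot>\<^bsub>?W\<^esub> (b \<odot>\<^bsub>?W\<^esub> v)"
    proof (intro allI impI, elim conjE)
      fix a b v assume "a \<in> carrier ?K" "b \<in> carrier ?K" and v: "v \<in> carrier V"
      then obtain x y where "x \<in> carrier R" "y \<in> carrier R" "a = J +> x" "b = J +> y"
        using el[of a] el[of b] by auto
      then show "(a \<otimes>\<^bsub>?K\<^esub> b) \<odot>\<^bsub>?W\<^esub> v = a \<odot>\<^bsub>?W\<^esub> (b \<odot>\<^bsub>?W\<^esub> v)"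
        using v by (simp add: FactRing_def J.rcoset_mult_add smult t.N.smult_assoc1)
    qed
    show "\<forall>v\<in>carrier V. \<one>\<^bsub>?K\<^esub> \<odot>\<^bsub>?W\<^esub> v = v"
      by (simp add: FactRing_def smult)
    show "\<forall>a b v. a \<in> carrier ?K \<and> b \<in> carrier ?K \<and> v \<in> carrier V \<longrightarrow>
        (a \<oplus>\<^bsub>?K\<^esub> b) \<odot>\<^bsub>?W\<^esub> v = a \<odot>\<^bsub>?W\<^esub> v \<oplus>\<^bsub>V\<^esub> b \<odot>\<^bsub>?W\<^esub> v"
    proof (intro allI impI, elim conjE)
      fix a b v assume "a \<in> carrier ?K" "b \<in> carrier ?K" and v: "v \<in> carrier V"
      then obtain x y where "x \<in> carrier R" "y \<in> carrier R" "a = J +> x" "b = J +> y"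
        using el[of a] el[of b] by auto
      then show "(a \<oplus>\<^bsub>?K\<^esub> b) \<odot>\<^bsub>?W\<^esub> v = a \<odot>\<^bsub>?W\<^esub> v \<oplus>\<^bsub>V\<^esub> b \<odot>\<^bsub>?W\<^esub> v"
        using v by (simp add: FactRing_def J.a_rcos_sum smult t.N.smult_l_distr)
    qed
    show "\<forall>a v w. a \<in> carrier ?K \<and> v \<in> carrier V \<and> w \<in> carrier V \<longrightarrow>
        a \<odot>\<^bsub>?W\<^esub> (v \<oplus>\<^bsub>V\<^esub> w) = a \<odot>\<^bsub>?W\<^esub> v \<oplus>\<^bsub>V\<^esub> a \<odot>\<^bsub>?W\<^esub> w"
    proof (intro allI impI, elim conjE)
      fix a v w assume "a \<in> carrier ?K" and vw: "v \<in> carrier V" "w \<in> carrier V"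
      then obtain x where "x \<in> carrier R" "a = J +> x" using el[of a] by auto
      then show "a \<odot>\<^bsub>?W\<^esub> (v \<oplus>\<^bsub>V\<^esub> w) = a \<odot>\<^bsub>?W\<^esub> v \<oplus>\<^bsub>V\<^esub> a \<odot>\<^bsub>?W\<^esub> w"
        using vw by (simp add: smult t.N.smult_r_distr)
    qed
    show "\<forall>v\<in>carrier V. \<exists>neg_v\<in>carrier V. v \<oplus>\<^bsub>V\<^esub> neg_v = \<zero>\<^bsub>V\<^esub>"
      using t.N.M.r_neg t.N.M.a_inv_closed by blast
  qed (simp_all add: t.N.M.a_ac)
  then interpret W: vectorspace ?K ?W .
  define b where "b j = \<theta> (unit_vec n j)" for j
  have b: "b j \<in> carrier ?W" for j by (simp add: b_def W unit_vec_closed)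
  have one: "\<one> \<notin> J" using J.one_imp_carrier J.I_notcarr by blast
  have "inj_on b {..<n}"
  proof (rule inj_onI, rule ccontr)
    fix i j assume ij: "i \<in> {..<n}" "j \<in> {..<n}" "b i = b j" "i \<noteq> j"
    let ?x = "unit_vec n i \<ominus>\<^bsub>free_power R n\<^esub> unit_vec n j"
    have x: "?x \<in> carrier (free_power R n)" by (simp add: unit_vec_closed)
    have "\<theta> ?x = \<zero>\<^bsub>V\<^esub>" using ij(3) by (simp add: b_def unit_vec_closed)
    then have "?x i \<in> J" using ker[OF x] ij(1) by simp
    moreover have "unit_vec n i = ?x \<oplus>\<^bsub>free_power R n\<^esub> unit_vec n j"
      by (simp add: t.M.M.minus_eq t.M.M.a_assoc t.M.M.l_neg unit_vec_closed)
    then have "unit_vec n i i = ?x i \<oplus> unit_vec n j i" using ij(1) free_power_coord(1) by (metis lessThan_iff)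
    ultimately show False
      using ij one x free_power_coord(4)[OF x, of i] by (simp add: unit_vec_coord)
  qed
  note inj = this
  \<comment> \<open>a combination with coset coefficients is the image of any vector of representatives\<close>
  have comb: "W.lincomb a (b ` {..<n}) = \<theta> x"
    if a: "a \<in> b ` {..<n} \<rightarrow> carrier ?K" and x: "x \<in> carrier (free_power R n)"
      "\<And>j. j < n \<Longrightarrow> a (b j) = J +> x j" for a x
  proof -
    have "W.lincomb a (b ` {..<n}) = K.lin_comb ?W n b (\<lambda>j. a (b j))"
      by (rule W.lincomb_reindex[OF inj]) (use a b in auto)
    also have "\<dots> = lin_comb V n b x"
    proof -
      have fs: "(\<Oplus>\<^bsub>?W\<^esub>j\<in>A. g j) = (\<Oplus>\<^bsub>V\<^esub>j\<in>A. g j)" for g :: "nat \<Rightarrow> 'v" and A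
        by (simp add: finsum_def finprod_def coset_scalars_def)
      have xc: "x j \<in> carrier R" if "j < n" for j using x(1) that by (rule free_power_coord(4))
      show ?thesis
        unfolding lin_comb_def K.lin_comb_def fs
        by (rule t.N.M.finsum_cong') (use x(2) xc b in \<open>auto simp: W smult\<close>)
    qed
    also have "\<dots> = \<theta> x"
      by (rule free_power_hom_eq[OF lin_comb_hom(1)[OF t.N.module_axioms] \<theta> _ x(1)])
        (use b lin_comb_hom(2)[OF t.N.module_axioms] in \<open>auto simp: W b_def\<close>)
    finally show ?thesis .
  qed
  have "W.basis (b ` {..<n})"
    unfolding W.basis_def
  proof (intro conjI)
    show sub: "b ` {..<n} \<subseteq> carrier ?W" using b by auto
    show "W.lin_indpt (b ` {..<n})"
    proof (rule W.finite_lin_indpt2[OF _ sub])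
      fix a assume a: "a \<in> b ` {..<n} \<rightarrow> carrier ?K" and zero: "W.lincomb a (b ` {..<n}) = \<zero>\<^bsub>?W\<^esub>"
      have "\<forall>j\<in>{..<n}. \<exists>c\<in>carrier R. a (b j) = J +> c" using a el by blast
      then obtain c where c: "\<And>j. j < n \<Longrightarrow> c j \<in> carrier R" "\<And>j. j < n \<Longrightarrow> a (b j) = J +> c j"
        by (metis lessThan_iff)
      let ?x = "\<lambda>j\<in>{..<n}. c j"
      have x: "?x \<in> carrier (free_power R n)" using c by (intro restrict_free_power)
      have "\<theta> ?x = \<zero>\<^bsub>V\<^esub>" using comb[OF a x] c zero by (simp add: W)
      then have "\<forall>j<n. c j \<in> J" using ker[OF x] by simp
      then show "\<forall>v\<in>b ` {..<n}. a v = \<zero>\<^bsub>?K\<^esub>" using c by (auto simp: FactRing_def J.a_rcos_const)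
    qed simp
    show "W.span (b ` {..<n}) = carrier ?W"
    proof
      show "W.span (b ` {..<n}) \<subseteq> carrier ?W" by (rule W.span_is_subset2[OF sub])
      show "carrier ?W \<subseteq> W.span (b ` {..<n})"
      proof
        fix v assume "v \<in> carrier ?W"
        then obtain x where x: "x \<in> carrier (free_power R n)" "v = \<theta> x" using surj by (auto simp: W)
        let ?a = "\<lambda>w. J +> x (the_inv_into {..<n} b w)"
        have inv: "the_inv_into {..<n} b (b j) = j" if "j < n" for j
          using the_inv_into_f_f[OF inj] that by simp
        have a: "?a \<in> b ` {..<n} \<rightarrow> carrier ?K"
          using inv x(1) by (auto simp: FactRing_def free_power_coord intro!: a_rcosetsI J.a_subset)
        have "v = W.lincomb ?a (b ` {..<n})" using comb[OF a x(1)] inv x(2) by simp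
        then show "v \<in> W.span (b ` {..<n})" using a unfolding W.span_def by blast
      qed
    qed
  qed
  then have "W.dim = card (b ` {..<n})" by (intro W.dim_basis) auto
  then show ?thesis by (simp add: card_image[OF inj])
qed

end

subsection \<open>Tor and Betti numbers\<close>

context cring
begin

lemma free_resolution_iff:
  fixes M :: "('a, 'm) module"
  assumes M: "module R M"
  shows "free_resolution R M g \<gamma> \<zeta> \<longleftrightarrow>
    subquotient_resolution R M (carrier M) {\<zero>\<^bsub>M\<^esub>} g \<gamma> \<zeta>"
proof -
  interpret M: module R M by fact
  have hom: "h \<in> module_hom R L L' \<longleftrightarrow> mod_hom R L L' h" if "module R L" "module R L'"
    for L :: "('a, 'x) module" and L' :: "('a, 'y) module" and h
    using that by (simp add: mod_hom_def mod_hom_axioms_def)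
  show ?thesis
  proof
    assume fr: "free_resolution R M g \<gamma> \<zeta>"
    then have z: "mod_hom R (free_power R (g 0)) M \<zeta>"
      and c: "\<And>i. mod_hom R (free_power R (g (Suc i))) (free_power R (g i)) (\<gamma> i)"
      by (simp_all add: free_resolution_def Let_def hom module_free_power M)
    interpret z: mod_hom R "free_power R (g 0)" M \<zeta> by (rule z)
    show "subquotient_resolution R M (carrier M) {\<zero>\<^bsub>M\<^esub>} g \<gamma> \<zeta>"
    proof (intro subquotient_resolution.intro subquotient_resolution_axioms.intro M z c
        M.submodule_carrier M.submodule_singleton_zero)
      fix p assume "p \<in> carrier M"
      moreover have "\<zeta> ` carrier (free_power R (g 0)) = carrier M"
        using fr by (simp add: free_resolution_def Let_def)
      ultimately obtain x where "x \<in> carrier (free_power R (g 0))" "p = \<zeta> x" by blast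
      then show "\<exists>x\<in>carrier (free_power R (g 0)). \<zeta> x \<ominus>\<^bsub>M\<^esub> p \<in> {\<zero>\<^bsub>M\<^esub>}" by auto
    next
      fix x assume "x \<in> carrier (free_power R (g 0))"
      then show "\<zeta> x \<in> {\<zero>\<^bsub>M\<^esub>} \<longleftrightarrow> x \<in> \<gamma> 0 ` carrier (free_power R (g (Suc 0)))"
        using fr by (simp add: free_resolution_def Let_def a_kernel_def' set_eq_iff) blast
    next
      fix i x assume "x \<in> carrier (free_power R (g (Suc i)))"
      then show "\<gamma> i x = \<zero>\<^bsub>free_power R (g i)\<^esub> \<longleftrightarrow>
          x \<in> \<gamma> (Suc i) ` carrier (free_power R (g (Suc (Suc i))))"
        using fr by (simp add: free_resolution_def Let_def a_kernel_def' set_eq_iff) blast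
    qed simp
  next
    assume "subquotient_resolution R M (carrier M) {\<zero>\<^bsub>M\<^esub>} g \<gamma> \<zeta>"
    then interpret G: subquotient_resolution R M "carrier M" "{\<zero>\<^bsub>M\<^esub>}" g \<gamma> \<zeta> .
    interpret z: mod_hom R "free_power R (g 0)" M \<zeta> by (rule G.eps_hom)
    have "\<zeta> ` carrier (free_power R (g 0)) = carrier M"
    proof
      show "carrier M \<subseteq> \<zeta> ` carrier (free_power R (g 0))" using G.eps_gen by fastforce
    qed auto
    moreover have "a_kernel (free_power R (g 0)) M \<zeta> = \<gamma> 0 ` carrier (free_power R (g 1))"
      using G.eps_exact G.delta_closed by (auto simp: a_kernel_def')
    moreover have "a_kernel (free_power R (g (Suc i))) (free_power R (g i)) (\<gamma> i) =
        \<gamma> (Suc i) ` carrier (free_power R (g (Suc (Suc i))))" for i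
      using G.delta_exact[of _ i] G.delta_closed[of _ "Suc i"] by (auto simp: a_kernel_def')
    ultimately show "free_resolution R M g \<gamma> \<zeta>"
      using G.eps_hom G.delta_hom
      by (simp add: free_resolution_def Let_def hom module_free_power M)
  qed
qed

text \<open>Betti numbers are read off from a minimal resolution. By the isomorphism \<open>F \<otimes> R/J \<cong> F/JF\<close>, the
  homology that defines Tor is that of a free resolution reduced modulo \<open>J\<close>, and the comparison of
  resolutions identifies it with \<open>R\<^sup>n / J R\<^sup>n\<close> where \<open>n\<close> is the rank in the minimal resolution.\<close>

theorem betti_minimal_resolution:
  fixes M :: "('a, 'm) module"
  assumes J: "maximalideal (max_ideal R) R"
    and res: "has_minimal_resolution R (max_ideal R) M (carrier M) {\<zero>\<^bsub>M\<^esub>} n"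
  shows "betti R i M = n i"
proof -
  let ?J = "max_ideal R"
  let ?k = "quot_module (regular_module R) ?J"
  interpret J: maximalideal ?J R by (rule J)
  have JI: "ideal ?J R" by (rule J.is_ideal)
  obtain \<delta> \<epsilon> where min: "minimal_resolution R M (carrier M) {\<zero>\<^bsub>M\<^esub>} n \<delta> \<epsilon> ?J"
    using res unfolding has_minimal_resolution_def by blast
  interpret F: minimal_resolution R M "carrier M" "{\<zero>\<^bsub>M\<^esub>}" n \<delta> \<epsilon> ?J by (rule min)
  note fr = free_resolution_iff[OF F.module_axioms]
  \<comment> \<open>the resolution chosen in the definition of Tor is a resolution, since there is one\<close>
  obtain g \<gamma> \<zeta> where some: "(SOME (n, \<delta>, \<epsilon>). free_resolution R M n \<delta> \<epsilon>) = (g, \<gamma>, \<zeta>)"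
    by (rule prod_cases3)
  have "case (SOME (n, \<delta>, \<epsilon>). free_resolution R M n \<delta> \<epsilon>) of (n, \<delta>, \<epsilon>) \<Rightarrow> free_resolution R M n \<delta> \<epsilon>"
    by (rule someI[of _ "(n, \<delta>, \<epsilon>)"]) (simp add: fr F.subquotient_resolution_axioms)
  then have Gres: "subquotient_resolution R M (carrier M) {\<zero>\<^bsub>M\<^esub>} g \<gamma> \<zeta>"
    unfolding some by (simp add: fr)
  interpret G: subquotient_resolution R M "carrier M" "{\<zero>\<^bsub>M\<^esub>}" g \<gamma> \<zeta> by (rule Gres)
  interpret FF: module R "free_power R l" for l by (rule module_free_power)
  interpret c: mod_hom R "G.F (Suc j)" "G.F j" "\<gamma> j" for j by (rule G.delta_hom)
  have k: "module R ?k"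
    by (rule module.quot_module_facts(1)[OF module_regular submodule_regular[OF JI]])
  define T where "T j = tensor_module R (G.F j) ?k" for j
  define \<tau> where "\<tau> j x = pure_tensor R (G.F j) ?k x (quot_one ?J)" for j x
  define D where "D j = tensor_map R (G.F (Suc j)) ?k (G.F j) ?k (\<gamma> j) (\<lambda>x. x)" for j
  note tq = tensor_quot_right[OF module_free_power JI]
  have \<tau>: "mod_hom R (G.F j) (T j) (\<tau> j)" "carrier (T j) = \<tau> j ` carrier (G.F j)" for j
    unfolding T_def \<tau>_def by (rule tq(1), rule tq(2))
  have \<tau>0: "\<tau> j x = \<zero>\<^bsub>T j\<^esub> \<longleftrightarrow> x \<in> ideal_times R (G.F j) ?J (carrier (G.F j))"
    if "x \<in> carrier (G.F j)" for j x
    unfolding T_def \<tau>_def by (rule tq(3)[OF that])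
  interpret \<tau>: mod_hom R "G.F j" "T j" "\<tau> j" for j by (rule \<tau>)
  have D: "mod_hom R (T (Suc j)) (T j) (D j)" for j
    unfolding T_def D_def
    by (rule tensor_map_facts(1)[OF module_free_power k module_free_power k G.delta_hom mod_hom_ident[OF k]])
  have one: "quot_one ?J \<in> carrier ?k"
    using module.quot_module_facts(3)[OF module_regular submodule_regular[OF JI]]
    by (auto simp: quot_one_def regular_module_simps)
  have D\<tau>: "D j (\<tau> (Suc j) x) = \<tau> j (\<gamma> j x)" if "x \<in> carrier (G.F (Suc j))" for j x
    unfolding \<tau>_def D_def
    by (rule tensor_map_facts(2)[OF module_free_power k module_free_power k G.delta_hom mod_hom_ident[OF k] that one])
  interpret D: mod_hom R "T (Suc j)" "T j" "D j" for j by (rule D)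
  let ?I = "\<lambda>l. ideal_times R (free_power R l) ?J (carrier (free_power R l))"
  obtain \<phi> where \<phi>: "\<And>j. mod_hom R (F.F j) (G.F j) (\<phi> j)"
    "\<And>j x. x \<in> carrier (F.F (Suc j)) \<Longrightarrow> \<gamma> j (\<phi> (Suc j) x) \<in> ?I (g j)"
    "\<And>j x u. \<lbrakk>x \<in> carrier (F.F j); u \<in> carrier (G.F (Suc j)); \<phi> j x \<ominus>\<^bsub>G.F j\<^esub> \<gamma> j u \<in> ?I (g j)\<rbrakk>
      \<Longrightarrow> x \<in> ?I (n j)"
    "\<And>j w. \<lbrakk>w \<in> carrier (G.F j); \<And>j'. j = Suc j' \<Longrightarrow> \<gamma> j' w \<in> ?I (g j')\<rbrakk> \<Longrightarrow>
       \<exists>x\<in>carrier (F.F j). \<exists>u\<in>carrier (G.F (Suc j)).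
          (\<phi> j x \<ominus>\<^bsub>G.F j\<^esub> w) \<ominus>\<^bsub>G.F j\<^esub> \<gamma> j u \<in> ?I (g j)"
    using F.compare_resolutions[OF Gres] by blast
  interpret p: mod_hom R "F.F j" "G.F j" "\<phi> j" for j by (rule \<phi>)
  \<comment> \<open>the cycles and boundaries in degree \<open>i\<close>; in degree 0 everything is a cycle\<close>
  define Z where "Z = {z \<in> carrier (T i). \<forall>j. i = Suc j \<longrightarrow> D j z = \<zero>\<^bsub>T j\<^esub>}"
  define B where "B = D i ` carrier (T (Suc i))"
  define C where "C = (T i)\<lparr>carrier := Z\<rparr>"
  have "(case i of 0 \<Rightarrow> carrier (T 0) | Suc j \<Rightarrow> a_kernel (T (Suc j)) (T j) (D j)) = Z"
    by (cases i) (auto simp: Z_def a_kernel_def')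
  then have tor: "tor_module R i M ?k = quot_module C B"
    unfolding tor_module_def some Let_def prod.case homology_def C_def B_def T_def D_def by simp
  have Z: "submodule R Z (T i)"
  proof (cases i)
    case 0
    then show ?thesis using \<tau>.N.submodule_carrier by (simp add: Z_def)
  next
    case (Suc j)
    then have "Z = {z \<in> carrier (T (Suc j)). D j z \<in> {\<zero>\<^bsub>T j\<^esub>}}" by (auto simp: Z_def)
    then show ?thesis using submodule_vimage[OF D[of j] \<tau>.N.submodule_singleton_zero] Suc by simp
  qed
  have C: "module R C" unfolding C_def by (rule \<tau>.N.submodule_is_module[OF Z])
  interpret C: module R C by (rule C)
  have DD: "D j (D (Suc j) t) = \<zero>\<^bsub>T j\<^esub>" if "t \<in> carrier (T (Suc (Suc j)))" for j t
  proof -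
    from that obtain x where "x \<in> carrier (G.F (Suc (Suc j)))" "t = \<tau> (Suc (Suc j)) x"
      unfolding \<tau>(2) by blast
    then show ?thesis by (simp add: D\<tau> G.delta_closed G.delta_delta)
  qed
  have BZ: "B \<subseteq> Z" unfolding B_def Z_def using DD by auto
  have BT: "submodule R B (T i)" unfolding B_def by (rule submodule_image[OF D \<tau>.N.submodule_carrier])
  have Bsub: "submodule R B C"
    by (rule C.submodule_criterion)
      (use BZ submodule.zero_closed[OF BT] submodule.m_closed[OF BT] submodule.smult_closed[OF BT]
        in \<open>simp_all add: C_def\<close>)
  note Q = C.quot_module_facts[OF Bsub]
  define \<theta> where "\<theta> x = B +>\<^bsub>C\<^esub> \<tau> i (\<phi> i x)" for x
  have cyc: "\<tau> i (\<phi> i x) \<in> Z" if x: "x \<in> carrier (F.F i)" for x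
  proof -
    have "D j (\<tau> i (\<phi> i x)) = \<zero>\<^bsub>T j\<^esub>" if "i = Suc j" for j
      using x \<phi>(2)[of x j] \<tau>0 that p.f_im[of x "Suc j"] by (simp add: D\<tau> G.delta_closed)
    then show ?thesis using x by (simp add: Z_def)
  qed
  have "mod_hom R (F.F i) C (\<lambda>x. \<tau> i (\<phi> i x))"
    by (rule mod_homI[OF module_free_power C]) (use cyc in \<open>simp_all add: C_def\<close>)
  then have \<theta>_hom: "mod_hom R (F.F i) (quot_module C B) \<theta>"
    unfolding \<theta>_def by (rule mod_hom_comp[OF _ Q(2)])
  have "\<theta> x = \<zero>\<^bsub>quot_module C B\<^esub> \<longleftrightarrow> (\<forall>j<n i. x j \<in> ?J)" if x: "x \<in> carrier (F.F i)" for x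
  proof -
    have "\<theta> x = \<zero>\<^bsub>quot_module C B\<^esub> \<longleftrightarrow> \<tau> i (\<phi> i x) \<in> B"
      unfolding \<theta>_def using Q(4) cyc[OF x] by (simp add: C_def)
    also have "\<dots> \<longleftrightarrow> x \<in> ?I (n i)"
    proof
      assume "\<tau> i (\<phi> i x) \<in> B"
      then obtain u where u: "u \<in> carrier (G.F (Suc i))" "\<tau> i (\<phi> i x) = \<tau> i (\<gamma> i u)"
        unfolding B_def \<tau>(2) using D\<tau> by auto
      have "\<tau> i (\<phi> i x \<ominus>\<^bsub>G.F i\<^esub> \<gamma> i u) = \<zero>\<^bsub>T i\<^esub>" using u x by (simp add: G.delta_closed)
      then have "\<phi> i x \<ominus>\<^bsub>G.F i\<^esub> \<gamma> i u \<in> ?I (g i)"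
        using \<tau>0[of "\<phi> i x \<ominus>\<^bsub>G.F i\<^esub> \<gamma> i u" i] u(1) x by (simp add: G.delta_closed)
      then show "x \<in> ?I (n i)" by (rule \<phi>(3)[OF x u(1)])
    next
      assume "x \<in> ?I (n i)"
      then have "\<phi> i x \<in> ?I (g i)"
        by (rule ideal_times_image[OF \<phi>(1) _ subset_refl subset_refl, rotated 2]) (use J.a_subset in auto)
      then have "\<tau> i (\<phi> i x) = \<zero>\<^bsub>T i\<^esub>" using \<tau>0 x by simp
      then show "\<tau> i (\<phi> i x) \<in> B" using submodule.zero_closed[OF BT] by simp
    qed
    also have "\<dots> \<longleftrightarrow> (\<forall>j<n i. x j \<in> ?J)"
      using x by (simp add: ideal_times_free_power[OF JI])
    finally show ?thesis .
  qed
  moreover have "carrier (quot_module C B) = \<theta> ` carrier (F.F i)"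
  proof
    show "\<theta> ` carrier (F.F i) \<subseteq> carrier (quot_module C B)" using mod_hom.f_im[OF \<theta>_hom] by blast
    show "carrier (quot_module C B) \<subseteq> \<theta> ` carrier (F.F i)"
    proof
      fix q assume "q \<in> carrier (quot_module C B)"
      then obtain z where z: "z \<in> Z" "q = B +>\<^bsub>C\<^esub> z" using Q(3) by (auto simp: C_def)
      then obtain w where w: "w \<in> carrier (G.F i)" "z = \<tau> i w" using \<tau>(2) by (auto simp: Z_def)
      have "\<gamma> j w \<in> ?I (g j)" if ij: "i = Suc j" for j
      proof -
        have "D j z = \<zero>\<^bsub>T j\<^esub>" using z ij by (simp add: Z_def)
        then have "\<tau> j (\<gamma> j w) = \<zero>\<^bsub>T j\<^esub>" using D\<tau>[of w j] w ij by simp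
        then show ?thesis using \<tau>0[OF G.delta_closed] w ij by simp
      qed
      from \<phi>(4)[OF w(1) this] obtain x u where x: "x \<in> carrier (F.F i)" and u: "u \<in> carrier (G.F (Suc i))"
        and xu: "(\<phi> i x \<ominus>\<^bsub>G.F i\<^esub> w) \<ominus>\<^bsub>G.F i\<^esub> \<gamma> i u \<in> ?I (g i)" by blast
      have gu: "\<gamma> i u \<in> carrier (G.F i)" using u by (rule G.delta_closed)
      have "\<tau> i ((\<phi> i x \<ominus>\<^bsub>G.F i\<^esub> w) \<ominus>\<^bsub>G.F i\<^esub> \<gamma> i u) = \<zero>\<^bsub>T i\<^esub>"
        using \<tau>0[of "(\<phi> i x \<ominus>\<^bsub>G.F i\<^esub> w) \<ominus>\<^bsub>G.F i\<^esub> \<gamma> i u" i] xu x w(1) gu by simp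
      then have "\<tau> i (\<phi> i x) \<ominus>\<^bsub>T i\<^esub> z = \<tau> i (\<gamma> i u)" using x w gu by simp
      also have "\<dots> = D i (\<tau> (Suc i) u)" using D\<tau>[OF u] by simp
      finally have inB: "\<tau> i (\<phi> i x) \<ominus>\<^bsub>T i\<^esub> z \<in> B" unfolding B_def using u by simp
      have zC: "z \<in> carrier C" "\<tau> i (\<phi> i x) \<in> carrier C" using z cyc[OF x] by (simp_all add: C_def)
      have zT: "z \<in> carrier (T i)" using w by simp
      have "\<tau> i (\<phi> i x) = (\<tau> i (\<phi> i x) \<ominus>\<^bsub>T i\<^esub> z) \<oplus>\<^bsub>T i\<^esub> z"
        using zT x by (simp add: \<tau>.N.M.minus_eq \<tau>.N.M.a_assoc \<tau>.N.M.l_neg)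
      then have split: "\<tau> i (\<phi> i x) = (\<tau> i (\<phi> i x) \<ominus>\<^bsub>T i\<^esub> z) \<oplus>\<^bsub>C\<^esub> z" by (simp add: C_def)
      have inC: "\<tau> i (\<phi> i x) \<ominus>\<^bsub>T i\<^esub> z \<in> carrier C" using inB BZ by (auto simp: C_def)
      have "\<theta> x = q"
        unfolding \<theta>_def z(2) using split mod_hom_add[OF Q(2) inC zC(1)] Q(4)[OF inC] inB
          mod_hom.f_im[OF Q(2) zC(1)] module.axioms(2)[OF Q(1)]
        by (metis abelian_group.axioms(1) abelian_monoid.l_zero)
      then show "q \<in> \<theta> ` carrier (F.F i)" using x by blast
    qed
  qed
  ultimately show ?thesis
    unfolding betti_def tor by (intro dim_coset_scalars[OF J \<theta>_hom]) auto
qed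

end

section \<open>Resolutions built from generators and relations\<close>

lemma (in module) mem_plusI: "\<lbrakk>v \<in> V; w \<in> W\<rbrakk> \<Longrightarrow> v \<oplus>\<^bsub>M\<^esub> w \<in> V <+>\<^bsub>M\<^esub> W"
  by (auto simp: set_add_def')

lemma (in module) mem_plusE:
  assumes "x \<in> V <+>\<^bsub>M\<^esub> W"
  obtains v w where "v \<in> V" "w \<in> W" "x = v \<oplus>\<^bsub>M\<^esub> w"
  using assms by (auto simp: set_add_def')

lemma (in module) plus_assoc:
  assumes "U \<subseteq> carrier M" "V \<subseteq> carrier M" "W \<subseteq> carrier M"
  shows "(U <+>\<^bsub>M\<^esub> V) <+>\<^bsub>M\<^esub> W = U <+>\<^bsub>M\<^esub> (V <+>\<^bsub>M\<^esub> W)"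
proof -
  have 1: "u \<oplus>\<^bsub>M\<^esub> v \<oplus>\<^bsub>M\<^esub> w = u \<oplus>\<^bsub>M\<^esub> (v \<oplus>\<^bsub>M\<^esub> w)" if "u \<in> U" "v \<in> V" "w \<in> W" for u v w
    using that assms by (intro M.a_assoc) auto
  show ?thesis
  proof (intro equalityI subsetI)
    fix x assume "x \<in> (U <+>\<^bsub>M\<^esub> V) <+>\<^bsub>M\<^esub> W"
    then obtain y w where y: "y \<in> U <+>\<^bsub>M\<^esub> V" "w \<in> W" "x = y \<oplus>\<^bsub>M\<^esub> w" by (rule mem_plusE)
    obtain u v where "u \<in> U" "v \<in> V" "y = u \<oplus>\<^bsub>M\<^esub> v" by (rule mem_plusE[OF y(1)])
    with y show "x \<in> U <+>\<^bsub>M\<^esub> (V <+>\<^bsub>M\<^esub> W)" by (simp add: 1 mem_plusI)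
  next
    fix x assume "x \<in> U <+>\<^bsub>M\<^esub> (V <+>\<^bsub>M\<^esub> W)"
    then obtain u y where y: "u \<in> U" "y \<in> V <+>\<^bsub>M\<^esub> W" "x = u \<oplus>\<^bsub>M\<^esub> y" by (rule mem_plusE)
    obtain v w where "v \<in> V" "w \<in> W" "y = v \<oplus>\<^bsub>M\<^esub> w" by (rule mem_plusE[OF y(2)])
    with y show "x \<in> (U <+>\<^bsub>M\<^esub> V) <+>\<^bsub>M\<^esub> W" by (simp add: 1[symmetric] mem_plusI)
  qed
qed

lemma (in module) plus_zero_right:
  assumes "U \<subseteq> carrier M" shows "U <+>\<^bsub>M\<^esub> {\<zero>\<^bsub>M\<^esub>} = U"
proof -
  have "u \<oplus>\<^bsub>M\<^esub> \<zero>\<^bsub>M\<^esub> = u" if "u \<in> U" for u using that assms by (intro M.r_zero) auto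
  then show ?thesis by (auto simp: set_add_def')
qed

context cring
begin

definition ideal_vecs :: "'a set \<Rightarrow> nat \<Rightarrow> (nat \<Rightarrow> 'a) set"
  where "ideal_vecs I r = {a \<in> carrier (free_power R r). \<forall>j<r. a j \<in> I}"

lemma ideal_vecs_carrier: "ideal_vecs (carrier R) r = carrier (free_power R r)"
  by (auto simp: ideal_vecs_def free_power_coord)

lemma submodule_ideal_vecs:
  assumes "ideal I R" shows "submodule R (ideal_vecs I r) (free_power R r)"
  using submodule_ideal_times_free_power[OF assms, of r] unfolding ideal_times_free_power[OF assms] ideal_vecs_def .

lemma image_ideal_vecs_0:
  assumes "mod_hom R (free_power R 0) M E"
  shows "E ` ideal_vecs I 0 = {\<zero>\<^bsub>M\<^esub>}"
proof -
  interpret E: mod_hom R "free_power R 0" M E by fact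
  have "ideal_vecs I 0 = {\<zero>\<^bsub>free_power R 0\<^esub>}"
    using free_power_0 E.M.M.zero_closed by (auto simp: ideal_vecs_def)
  then show ?thesis by simp
qed

text \<open>Splits off the last unit vector, so that generators and relations can be adjoined one at a
  time.\<close>

lemma image_ideal_vecs_Suc:
  assumes E: "mod_hom R (free_power R (Suc r)) M E" and I: "ideal I R"
  shows "E ` ideal_vecs I (Suc r) =
    (\<lambda>a. E (vec_inl r (Suc 0) a)) ` ideal_vecs I r <+>\<^bsub>M\<^esub> {s \<odot>\<^bsub>M\<^esub> E (unit_vec (Suc r) r) |s. s \<in> I}"
proof -
  interpret E: mod_hom R "free_power R (Suc r)" M E by fact
  interpret I: ideal I R by fact
  interpret FF: module R "free_power R l" for l by (rule module_free_power)
  have inl: "vec_inl r (Suc 0) a \<in> carrier (free_power R (Suc r))" if "a \<in> carrier (free_power R r)" for a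
    using mod_hom.f_im[OF vec_homs(1)[of r "Suc 0"] that] by simp
  have fst: "vec_fst r a \<in> carrier (free_power R r)" if "a \<in> carrier (free_power R (Suc r))" for a
    using mod_hom.f_im[OF vec_homs(3)[of r "Suc 0"]] that by simp
  have split: "E (vec_inl r (Suc 0) a \<oplus>\<^bsub>free_power R (Suc r)\<^esub> s \<odot>\<^bsub>free_power R (Suc r)\<^esub> unit_vec (Suc r) r)
      = E (vec_inl r (Suc 0) a) \<oplus>\<^bsub>M\<^esub> s \<odot>\<^bsub>M\<^esub> E (unit_vec (Suc r) r)"
    if "a \<in> carrier (free_power R r)" "s \<in> carrier R" for a s
    using that inl by (simp add: unit_vec_closed)
  show ?thesis
  proof (intro equalityI subsetI)
    fix x assume "x \<in> E ` ideal_vecs I (Suc r)"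
    then obtain a where a: "a \<in> carrier (free_power R (Suc r))" "\<And>j. j < Suc r \<Longrightarrow> a j \<in> I" "x = E a"
      by (auto simp: ideal_vecs_def)
    have ar: "a r \<in> carrier R" using a(2)[of r] I.Icarr by simp
    have "a = vec_inl r (Suc 0) (vec_fst r a) \<oplus>\<^bsub>free_power R (Suc r)\<^esub>
        a r \<odot>\<^bsub>free_power R (Suc r)\<^esub> unit_vec (Suc r) r"
    proof (rule free_power_eqI[OF a(1)])
      show "vec_inl r (Suc 0) (vec_fst r a) \<oplus>\<^bsub>free_power R (Suc r)\<^esub>
        a r \<odot>\<^bsub>free_power R (Suc r)\<^esub> unit_vec (Suc r) r \<in> carrier (free_power R (Suc r))"
        using inl[OF fst[OF a(1)]] ar by (simp add: unit_vec_closed)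
      fix j assume j: "j < Suc r"
      then show "a j = (vec_inl r (Suc 0) (vec_fst r a) \<oplus>\<^bsub>free_power R (Suc r)\<^esub>
        a r \<odot>\<^bsub>free_power R (Suc r)\<^esub> unit_vec (Suc r) r) j"
        using ar free_power_coord(4)[OF a(1) j]
        by (auto simp: free_power_coord unit_vec_coord vec_inl_def vec_fst_def less_Suc_eq)
    qed
    then have "x = E (vec_inl r (Suc 0) (vec_fst r a)) \<oplus>\<^bsub>M\<^esub> a r \<odot>\<^bsub>M\<^esub> E (unit_vec (Suc r) r)"
      using a(3) split[OF fst[OF a(1)] ar] by simp
    moreover have "vec_fst r a \<in> ideal_vecs I r"
      using fst[OF a(1)] a(2) by (simp add: ideal_vecs_def vec_fst_def)
    ultimately show "x \<in> (\<lambda>a. E (vec_inl r (Suc 0) a)) ` ideal_vecs I r <+>\<^bsub>M\<^esub>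
        {s \<odot>\<^bsub>M\<^esub> E (unit_vec (Suc r) r) |s. s \<in> I}"
      unfolding E.N.mem_plus_iff using a(2)[of r] by blast
  next
    fix x assume "x \<in> (\<lambda>a. E (vec_inl r (Suc 0) a)) ` ideal_vecs I r <+>\<^bsub>M\<^esub>
        {s \<odot>\<^bsub>M\<^esub> E (unit_vec (Suc r) r) |s. s \<in> I}"
    then obtain a s where a: "a \<in> ideal_vecs I r" "s \<in> I"
      "x = E (vec_inl r (Suc 0) a) \<oplus>\<^bsub>M\<^esub> s \<odot>\<^bsub>M\<^esub> E (unit_vec (Suc r) r)"
      unfolding E.N.mem_plus_iff by blast
    have ac: "a \<in> carrier (free_power R r)" "\<And>j. j < r \<Longrightarrow> a j \<in> I" using a(1) by (simp_all add: ideal_vecs_def)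
    have sc: "s \<in> carrier R" using a(2) by (rule I.Icarr)
    let ?v = "vec_inl r (Suc 0) a \<oplus>\<^bsub>free_power R (Suc r)\<^esub> s \<odot>\<^bsub>free_power R (Suc r)\<^esub> unit_vec (Suc r) r"
    have "?v j \<in> I" if "j < Suc r" for j
      using that ac a(2) sc I.Icarr[OF ac(2)]
      by (auto simp: free_power_coord unit_vec_coord vec_inl_def less_Suc_eq)
    then have "?v \<in> ideal_vecs I (Suc r)"
      using inl[OF ac(1)] sc by (simp add: ideal_vecs_def unit_vec_closed)
    then show "x \<in> E ` ideal_vecs I (Suc r)" using a(3) split[OF ac(1) sc] by (metis imageI)
  qed
qed

lemma vec_inl_eq_0:
  assumes "a \<in> carrier (free_power R r)" "vec_inl r k a = \<zero>\<^bsub>free_power R (r + k)\<^esub>"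
  shows "a = \<zero>\<^bsub>free_power R r\<^esub>"
  using vec_simps(1)[OF assms(1), of k] assms(2) mod_hom.f0_is_0[OF vec_homs(3)[of r k]] by simp

text \<open>Generators that are independent of \<open>P\<close> and of each other, subject to the relations
  \<open>I\<close> times each of them, add a direct summand \<open>(R/I)\<^sup>r\<close>.\<close>

lemma adjoin_generators:
  fixes M :: "('a, 'm) module"
  assumes K: "has_minimal_resolution R J (regular_module R) (carrier R) I k" and I: "ideal I R"
    and res: "has_minimal_resolution R J M P N n" and NP: "N \<subseteq> P"
    and E: "mod_hom R (free_power R r) M E"
    and indep: "\<And>a. \<lbrakk>a \<in> carrier (free_power R r); E a \<in> P\<rbrakk> \<Longrightarrow> a = \<zero>\<^bsub>free_power R r\<^esub>"
  shows "has_minimal_resolution R J M (P <+>\<^bsub>M\<^esub> E ` carrier (free_power R r))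
    (N <+>\<^bsub>M\<^esub> E ` ideal_vecs I r) (\<lambda>i. n i + r * k i)"
  using E indep
proof (induction r arbitrary: E)
  case 0
  interpret E: mod_hom R "free_power R 0" M E by (rule 0)
  obtain \<delta> \<epsilon> where "minimal_resolution R M P N n \<delta> \<epsilon> J"
    using res unfolding has_minimal_resolution_def by blast
  then interpret F: minimal_resolution R M P N n \<delta> \<epsilon> J .
  have "E ` carrier (free_power R 0) = {\<zero>\<^bsub>M\<^esub>}" "E ` ideal_vecs I 0 = {\<zero>\<^bsub>M\<^esub>}"
    using image_ideal_vecs_0[OF 0(1)] ideal_vecs_carrier by metis+
  then show ?case
    using res submodule.subset[OF F.sub_P] submodule.subset[OF F.sub_N] by (simp add: E.N.plus_zero_right)
next
  case (Suc r)
  interpret E: mod_hom R "free_power R (Suc r)" M E by (rule Suc.prems)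
  interpret I: ideal I R by fact
  interpret FF: module R "free_power R l" for l by (rule module_free_power)
  let ?E = "\<lambda>a. E (vec_inl r (Suc 0) a)" and ?e = "E (unit_vec (Suc r) r)"
  have inl_hom: "mod_hom R (free_power R r) (free_power R (Suc r)) (vec_inl r (Suc 0))"
    using vec_homs(1)[of r "Suc 0"] by simp
  interpret inl: mod_hom R "free_power R r" "free_power R (Suc r)" "vec_inl r (Suc 0)" by (rule inl_hom)
  have Eh: "mod_hom R (free_power R r) M ?E" by (rule mod_hom_comp[OF inl_hom Suc.prems(1)])
  have "has_minimal_resolution R J M (P <+>\<^bsub>M\<^esub> ?E ` carrier (free_power R r))
    (N <+>\<^bsub>M\<^esub> ?E ` ideal_vecs I r) (\<lambda>i. n i + r * k i)"
  proof (rule Suc.IH[OF Eh])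
    fix a assume a: "a \<in> carrier (free_power R r)" "?E a \<in> P"
    have "vec_inl r (Suc 0) a = \<zero>\<^bsub>free_power R (Suc r)\<^esub>" by (rule Suc.prems(2)) (use a in simp_all)
    then show "a = \<zero>\<^bsub>free_power R r\<^esub>" using vec_inl_eq_0[OF a(1), of "Suc 0"] by simp
  qed
  then obtain \<delta> \<epsilon> where "minimal_resolution R M (P <+>\<^bsub>M\<^esub> ?E ` carrier (free_power R r))
    (N <+>\<^bsub>M\<^esub> ?E ` ideal_vecs I r) (\<lambda>i. n i + r * k i) \<delta> \<epsilon> J" unfolding has_minimal_resolution_def by blast
  then interpret F: minimal_resolution R M "P <+>\<^bsub>M\<^esub> ?E ` carrier (free_power R r)"
    "N <+>\<^bsub>M\<^esub> ?E ` ideal_vecs I r" "\<lambda>i. n i + r * k i" \<delta> \<epsilon> J .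
  obtain \<kappa> \<eta> where Km: "minimal_resolution R (regular_module R) (carrier R) I k \<kappa> \<eta> J"
    using K unfolding has_minimal_resolution_def by blast
  obtain \<delta>' \<epsilon>' where "minimal_resolution R M P N n \<delta>' \<epsilon>' J"
    using res unfolding has_minimal_resolution_def by blast
  then interpret F': minimal_resolution R M P N n \<delta>' \<epsilon>' J .
  interpret P: submodule R P M by (rule F'.sub_P)
  have Pc: "P \<subseteq> carrier M" and Nc: "N \<subseteq> carrier M"
    using submodule.subset[OF F'.sub_P] submodule.subset[OF F'.sub_N] by auto
  have e: "?e \<in> carrier M" by (simp add: unit_vec_closed)
  have "has_minimal_resolution R J M
      ((P <+>\<^bsub>M\<^esub> ?E ` carrier (free_power R r)) <+>\<^bsub>M\<^esub> {s \<odot>\<^bsub>M\<^esub> ?e |s. s \<in> carrier R})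
      ((N <+>\<^bsub>M\<^esub> ?E ` ideal_vecs I r) <+>\<^bsub>M\<^esub> {s \<odot>\<^bsub>M\<^esub> ?e |s. s \<in> I}) (\<lambda>i. (n i + r * k i) + k i)"
  proof (rule F.direct_sum_resolution[OF Km I e])
    show "N <+>\<^bsub>M\<^esub> ?E ` ideal_vecs I r \<subseteq> P <+>\<^bsub>M\<^esub> ?E ` carrier (free_power R r)"
      unfolding set_add_def' ideal_vecs_def using NP by blast
    fix s assume s: "s \<in> carrier R" and "s \<odot>\<^bsub>M\<^esub> ?e \<in> P <+>\<^bsub>M\<^esub> ?E ` carrier (free_power R r)"
    then obtain p a where p: "p \<in> P" "a \<in> carrier (free_power R r)" "s \<odot>\<^bsub>M\<^esub> ?e = p \<oplus>\<^bsub>M\<^esub> ?E a"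
      unfolding E.N.mem_plus_iff by blast
    let ?v = "s \<odot>\<^bsub>free_power R (Suc r)\<^esub> unit_vec (Suc r) r \<ominus>\<^bsub>free_power R (Suc r)\<^esub> vec_inl r (Suc 0) a"
    have v: "?v \<in> carrier (free_power R (Suc r))" using s p(2) by (simp add: unit_vec_closed)
    have pc: "p \<in> carrier M" using p(1) Pc by blast
    have "E ?v = p"
      using s p pc by (simp add: unit_vec_closed E.N.M.minus_eq E.N.M.a_assoc E.N.M.r_neg)
    then have v0: "?v = \<zero>\<^bsub>free_power R (Suc r)\<^esub>" using Suc.prems(2)[OF v] p(1) by simp
    then have "s \<odot>\<^bsub>free_power R (Suc r)\<^esub> unit_vec (Suc r) r = vec_inl r (Suc 0) a"
      using s p(2) by (simp add: unit_vec_closed)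
    then have "(s \<odot>\<^bsub>free_power R (Suc r)\<^esub> unit_vec (Suc r) r) r = vec_inl r (Suc 0) a r" by simp
    then show "s = \<zero>" using s by (simp add: free_power_coord unit_vec_coord vec_inl_def)
  qed
  moreover have "?E ` carrier (free_power R r) \<subseteq> carrier M" "?E ` ideal_vecs I r \<subseteq> carrier M"
    "{s \<odot>\<^bsub>M\<^esub> ?e |s. s \<in> I} \<subseteq> carrier M" "{s \<odot>\<^bsub>M\<^esub> ?e |s. s \<in> carrier R} \<subseteq> carrier M"
    using e I.Icarr by (auto simp: ideal_vecs_def)
  ultimately show ?case
    using Pc Nc image_ideal_vecs_Suc[OF Suc.prems(1) I] image_ideal_vecs_Suc[OF Suc.prems(1) oneideal]
    by (simp add: E.N.plus_assoc ideal_vecs_carrier algebra_simps)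
qed

text \<open>Adding \<open>r\<close> relations that generate a copy of \<open>(R/I)\<^sup>r\<close> in the resolved module. Taking the
  quotient by the first ones leaves the annihilator of the next one equal to \<open>I\<close>: a multiple of it
  that becomes zero is part of a linear relation between all of them, whose coefficients lie in \<open>I\<close>.
  So the mapping cone for a single relation can be used \<open>r\<close> times.\<close>

lemma adjoin_relations:
  fixes M :: "('a, 'm) module"
  assumes K: "has_minimal_resolution R J (regular_module R) (carrier R) I k" and I: "ideal I R"
    and res: "has_minimal_resolution R J M P N n"
    and IP: "\<And>a p. \<lbrakk>a \<in> I; p \<in> P\<rbrakk> \<Longrightarrow> a \<odot>\<^bsub>M\<^esub> p \<in> N"
    and G: "mod_hom R (free_power R r) M G"
    and Gmin: "\<And>j. j < r \<Longrightarrow> G (unit_vec r j) \<in> ideal_times R M J P"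
    and indep: "\<And>a. \<lbrakk>a \<in> carrier (free_power R r); G a \<in> N\<rbrakk> \<Longrightarrow> a \<in> ideal_vecs I r"
  shows "has_minimal_resolution R J M P (N <+>\<^bsub>M\<^esub> G ` carrier (free_power R r))
    (\<lambda>i. n i + (case i of 0 \<Rightarrow> 0 | Suc j \<Rightarrow> r * k j))"
  using G Gmin indep
proof (induction r arbitrary: G)
  case 0
  interpret G: mod_hom R "free_power R 0" M G by (rule 0)
  obtain \<delta> \<epsilon> where "minimal_resolution R M P N n \<delta> \<epsilon> J"
    using res unfolding has_minimal_resolution_def by blast
  then interpret F: minimal_resolution R M P N n \<delta> \<epsilon> J .
  have "G ` carrier (free_power R 0) = {\<zero>\<^bsub>M\<^esub>}"
    using image_ideal_vecs_0[OF 0(1)] ideal_vecs_carrier by metis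
  moreover have "(\<lambda>i. n i + (case i of 0 \<Rightarrow> 0 | Suc j \<Rightarrow> 0 * k j)) = n" by (auto split: nat.split)
  ultimately show ?case
    using res submodule.subset[OF F.sub_N] by (simp add: G.N.plus_zero_right)
next
  case (Suc r)
  interpret G: mod_hom R "free_power R (Suc r)" M G by (rule Suc.prems)
  interpret I: ideal I R by fact
  interpret FF: module R "free_power R l" for l by (rule module_free_power)
  let ?G = "\<lambda>a. G (vec_inl r (Suc 0) a)" and ?e = "G (unit_vec (Suc r) r)"
  have inl_hom: "mod_hom R (free_power R r) (free_power R (Suc r)) (vec_inl r (Suc 0))"
    using vec_homs(1)[of r "Suc 0"] by simp
  interpret inl: mod_hom R "free_power R r" "free_power R (Suc r)" "vec_inl r (Suc 0)" by (rule inl_hom)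
  have Gh: "mod_hom R (free_power R r) M ?G" by (rule mod_hom_comp[OF inl_hom Suc.prems(1)])
  have inl_unit: "vec_inl r (Suc 0) (unit_vec r j) = unit_vec (Suc r) j" if "j < r" for j
    by (rule free_power_eqI[OF inl.f_im[OF unit_vec_closed] unit_vec_closed])
      (use that in \<open>auto simp: unit_vec_coord vec_inl_def less_Suc_eq\<close>)
  have "has_minimal_resolution R J M P (N <+>\<^bsub>M\<^esub> ?G ` carrier (free_power R r))
    (\<lambda>i. n i + (case i of 0 \<Rightarrow> 0 | Suc j \<Rightarrow> r * k j))"
  proof (rule Suc.IH[OF Gh])
    fix j assume "j < r"
    then show "?G (unit_vec r j) \<in> ideal_times R M J P"
      using Suc.prems(2)[of j] by (simp add: inl_unit)
  next
    fix a assume a: "a \<in> carrier (free_power R r)" "?G a \<in> N"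
    have "vec_inl r (Suc 0) a \<in> ideal_vecs I (Suc r)" by (rule Suc.prems(3)) (use a in simp_all)
    then have "\<forall>j<r. vec_inl r (Suc 0) a j \<in> I" by (simp add: ideal_vecs_def)
    then show "a \<in> ideal_vecs I r" using a(1) by (simp add: ideal_vecs_def vec_inl_def)
  qed
  then obtain \<delta> \<epsilon> where "minimal_resolution R M P (N <+>\<^bsub>M\<^esub> ?G ` carrier (free_power R r))
    (\<lambda>i. n i + (case i of 0 \<Rightarrow> 0 | Suc j \<Rightarrow> r * k j)) \<delta> \<epsilon> J" unfolding has_minimal_resolution_def by blast
  then interpret F: minimal_resolution R M P "N <+>\<^bsub>M\<^esub> ?G ` carrier (free_power R r)"
    "\<lambda>i. n i + (case i of 0 \<Rightarrow> 0 | Suc j \<Rightarrow> r * k j)" \<delta> \<epsilon> J .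
  obtain \<kappa> \<eta> where Km: "minimal_resolution R (regular_module R) (carrier R) I k \<kappa> \<eta> J"
    using K unfolding has_minimal_resolution_def by blast
  obtain \<delta>' \<epsilon>' where "minimal_resolution R M P N n \<delta>' \<epsilon>' J"
    using res unfolding has_minimal_resolution_def by blast
  then interpret F': minimal_resolution R M P N n \<delta>' \<epsilon>' J .
  have Pc: "P \<subseteq> carrier M" and Nc: "N \<subseteq> carrier M"
    using submodule.subset[OF F'.sub_P] submodule.subset[OF F'.sub_N] by auto
  have e: "?e \<in> carrier M" by (simp add: unit_vec_closed)
  have NN: "N \<subseteq> N <+>\<^bsub>M\<^esub> ?G ` carrier (free_power R r)"
    by (rule G.N.subset_plus(1)[OF F'.sub_N submodule_image[OF Gh FF.submodule_carrier]])
  have "has_minimal_resolution R J M P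
      ((N <+>\<^bsub>M\<^esub> ?G ` carrier (free_power R r)) <+>\<^bsub>M\<^esub> {s \<odot>\<^bsub>M\<^esub> ?e |s. s \<in> carrier R})
      (\<lambda>i. case i of 0 \<Rightarrow> n 0 + (case 0 of 0 \<Rightarrow> 0 | Suc j \<Rightarrow> r * k j)
        | Suc j \<Rightarrow> (n (Suc j) + (case Suc j of 0 \<Rightarrow> 0 | Suc j \<Rightarrow> r * k j)) + k j)"
  proof (rule F.cone_resolution[OF Km])
    show "a \<odot>\<^bsub>M\<^esub> p \<in> N <+>\<^bsub>M\<^esub> ?G ` carrier (free_power R r)" if "a \<in> I" "p \<in> P" for a p
      using IP[OF that] NN by blast
    show "?e \<in> ideal_times R M J P" by (rule Suc.prems(2)) simp
    fix s assume s: "s \<in> carrier R" and "s \<odot>\<^bsub>M\<^esub> ?e \<in> N <+>\<^bsub>M\<^esub> ?G ` carrier (free_power R r)"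
    then obtain z a where z: "z \<in> N" "a \<in> carrier (free_power R r)" "s \<odot>\<^bsub>M\<^esub> ?e = z \<oplus>\<^bsub>M\<^esub> ?G a"
      unfolding G.N.mem_plus_iff by blast
    let ?v = "s \<odot>\<^bsub>free_power R (Suc r)\<^esub> unit_vec (Suc r) r \<oplus>\<^bsub>free_power R (Suc r)\<^esub>
      vec_inl r (Suc 0) (\<ominus>\<^bsub>free_power R r\<^esub> a)"
    have v: "?v \<in> carrier (free_power R (Suc r))" using s z(2) by (simp add: unit_vec_closed)
    have zc: "z \<in> carrier M" using z(1) Nc by blast
    have "G ?v = z"
      using s z zc by (simp add: unit_vec_closed G.N.M.a_assoc G.N.M.r_neg)
    then have "?v \<in> ideal_vecs I (Suc r)" using Suc.prems(3)[OF v] z(1) by simp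
    then have "?v r \<in> I" by (simp add: ideal_vecs_def)
    then show "s \<in> I" using s by (simp add: free_power_coord unit_vec_coord vec_inl_def)
  qed
  moreover have "?G ` carrier (free_power R r) \<subseteq> carrier M" "{s \<odot>\<^bsub>M\<^esub> ?e |s. s \<in> carrier R} \<subseteq> carrier M"
    using e by auto
  moreover have "(\<lambda>i. case i of 0 \<Rightarrow> n 0 + (case 0 of 0 \<Rightarrow> 0 | Suc j \<Rightarrow> r * k j)
        | Suc j \<Rightarrow> (n (Suc j) + (case Suc j of 0 \<Rightarrow> 0 | Suc j \<Rightarrow> r * k j)) + k j) =
      (\<lambda>i. n i + (case i of 0 \<Rightarrow> 0 | Suc j \<Rightarrow> Suc r * k j))"
    by (auto split: nat.split)
  ultimately show ?case
    using Nc image_ideal_vecs_Suc[OF Suc.prems(1) oneideal]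
    by (simp add: G.N.plus_assoc ideal_vecs_carrier)
qed

subsection \<open>The Koszul resolution\<close>

lemma ideal_of_submodule_regular:
  assumes "submodule R W (regular_module R)" shows "ideal W R"
proof -
  interpret M: module R "regular_module R" by (rule module_regular)
  interpret W: submodule R W "regular_module R" by fact
  have Wc: "x \<in> carrier R" if "x \<in> W" for x using W.subset that by (auto simp: regular_module_simps)
  have inv: "\<ominus> x \<in> W" if "x \<in> W" for x
    using W.smult_closed[of "\<ominus> \<one>" x] that Wc[OF that] by (simp add: regular_module_simps l_minus)
  show ?thesis
  proof (rule idealI[OF ring_axioms])
    show "subgroup W (add_monoid R)"
    proof
      show "inv\<^bsub>add_monoid R\<^esub> x \<in> W" if "x \<in> W" for x using inv[OF that] by (simp add: a_inv_def)
    qed (use Wc W.m_closed W.zero_closed in \<open>auto simp: regular_module_simps\<close>)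
    show "x \<otimes> a \<in> W" "a \<otimes> x \<in> W" if "a \<in> W" "x \<in> carrier R" for a x
      using W.smult_closed[of x a] that Wc[OF that(1)] by (simp_all add: regular_module_simps m_comm)
  qed
qed

lemma f_ideal_ideal:
  assumes "f \<in> {1..c} \<rightarrow> carrier R" "p \<le> c"
  shows "ideal (f_ideal R f p) R"
  unfolding f_ideal_def by (rule genideal_ideal) (use assms in auto)

lemma f_ideal_0: "f_ideal R f 0 = {\<zero>}"
proof
  show "f_ideal R f 0 \<subseteq> {\<zero>}" unfolding f_ideal_def by (rule genideal_minimal[OF zeroideal]) auto
  have "ideal (f_ideal R f 0) R" unfolding f_ideal_def by (rule genideal_ideal) auto
  then show "{\<zero>} \<subseteq> f_ideal R f 0" using additive_subgroup.zero_closed[OF ideal.axioms(1)] by blast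
qed

lemma f_ideal_mem:
  assumes "f \<in> {1..c} \<rightarrow> carrier R" "p \<le> c" "q \<in> {1..p}"
  shows "f q \<in> f_ideal R f p"
  unfolding f_ideal_def using genideal_self[of "f ` {1..p}"] assms by fastforce

lemma f_ideal_mono:
  assumes "f \<in> {1..c} \<rightarrow> carrier R" "q \<le> p" "p \<le> c"
  shows "f_ideal R f q \<subseteq> f_ideal R f p"
  unfolding f_ideal_def[of R f q]
proof (rule genideal_minimal[OF f_ideal_ideal[OF assms(1,3)]], rule image_subsetI)
  fix x assume "x \<in> {1..q}"
  then have "x \<in> {1..p}" using assms(2) by simp
  then show "f x \<in> f_ideal R f p" by (rule f_ideal_mem[OF assms(1,3)])
qed

lemma f_ideal_Suc:
  assumes f: "f \<in> {1..c} \<rightarrow> carrier R" and p: "Suc p \<le> c"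
  shows "f_ideal R f (Suc p) = f_ideal R f p <+>\<^bsub>regular_module R\<^esub>
    {a \<odot>\<^bsub>regular_module R\<^esub> f (Suc p) |a. a \<in> carrier R}" (is "_ = ?W")
proof
  interpret M: module R "regular_module R" by (rule module_regular)
  interpret A: ideal "f_ideal R f (Suc p)" R by (rule f_ideal_ideal[OF f p])
  have fc: "f (Suc p) \<in> carrier (regular_module R)" using f p by (auto simp: regular_module_simps)
  have fp: "submodule R (f_ideal R f p) (regular_module R)"
    using f_ideal_ideal[OF f, of p] p by (intro submodule_regular) simp
  note cyc = M.submodule_cyclic[OF fc oneideal]
  have W: "submodule R ?W (regular_module R)" by (rule M.submodule_plus[OF fp cyc])
  show "f_ideal R f (Suc p) \<subseteq> ?W"
    unfolding f_ideal_def[of R f "Suc p"]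
  proof (rule genideal_minimal[OF ideal_of_submodule_regular[OF W]], rule image_subsetI)
    fix q assume q: "q \<in> {1..Suc p}"
    show "f q \<in> ?W"
    proof (cases "q = Suc p")
      case True
      have "f (Suc p) = \<one> \<odot>\<^bsub>regular_module R\<^esub> f (Suc p)" using fc by simp
      then have "f (Suc p) \<in> {a \<odot>\<^bsub>regular_module R\<^esub> f (Suc p) |a. a \<in> carrier R}"
        using one_closed by blast
      then show ?thesis using subsetD[OF M.subset_plus(2)[OF fp cyc]] True by simp
    next
      case False
      have "f q \<in> f_ideal R f p" by (intro f_ideal_mem[where c = c, OF f]) (use q p False in auto)
      then show ?thesis using M.subset_plus(1)[OF fp cyc] by blast
    qed
  qed
  have "f (Suc p) \<in> f_ideal R f (Suc p)" by (rule f_ideal_mem[OF f p]) simp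
  then have "{a \<odot>\<^bsub>regular_module R\<^esub> f (Suc p) |a. a \<in> carrier R} \<subseteq> f_ideal R f (Suc p)"
    using A.I_l_closed by (auto simp: regular_module_simps)
  moreover have "f_ideal R f p \<subseteq> f_ideal R f (Suc p)" by (rule f_ideal_mono[OF f _ p]) simp_all
  ultimately show "?W \<subseteq> f_ideal R f (Suc p)"
    by (intro M.plus_least[OF submodule_regular[OF A.ideal_axioms]])
qed

text \<open>The Koszul complex of \<open>f 1, \<dots>, f (p + 1)\<close> is the mapping cone of multiplication by \<open>f (p + 1)\<close>
  on the one for \<open>f 1, \<dots>, f p\<close>. Regularity says that the annihilator of \<open>f (p + 1)\<close> in
  \<open>R/(f 1, \<dots>, f p)\<close> is zero, and the ranks follow Pascal's triangle.\<close>

lemma koszul_resolution: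
  assumes J: "ideal J R" and f: "f \<in> {1..c} \<rightarrow> carrier R"
    and reg: "\<And>p x. \<lbrakk>p \<in> {1..c}; x \<in> carrier R; f p \<otimes> x \<in> f_ideal R f (p - 1)\<rbrakk> \<Longrightarrow> x \<in> f_ideal R f (p - 1)"
    and fJ: "\<And>p. p \<in> {1..c} \<Longrightarrow> f p \<in> J"
  shows "p \<le> c \<Longrightarrow> has_minimal_resolution R J (regular_module R) (carrier R) (f_ideal R f p) (\<lambda>i. p choose i)"
proof (induction p)
  case 0
  interpret M: module R "regular_module R" by (rule module_regular)
  have "has_minimal_resolution R J (regular_module R) (carrier R) {\<zero>} (\<lambda>i. if i = 0 then 1 else 0)"
  proof (rule minimal_resolution_free[OF J, where \<epsilon> = "\<lambda>x. x 0"])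
    show "submodule R (carrier R) (regular_module R)" by (rule submodule_regular[OF oneideal])
    show "submodule R {\<zero>} (regular_module R)" by (rule submodule_regular[OF zeroideal])
    show "mod_hom R (free_power R 1) (regular_module R) (\<lambda>x. x 0)"
      by (rule mod_homI[OF module_free_power module_regular])
        (simp_all add: regular_module_simps free_power_coord)
    show "x 0 \<in> carrier R" if "x \<in> carrier (free_power R 1)" for x using that by (simp add: free_power_coord)
    show "\<exists>x\<in>carrier (free_power R 1). x 0 \<ominus>\<^bsub>regular_module R\<^esub> r \<in> {\<zero>}" if "r \<in> carrier R" for r
    proof
      show "(\<lambda>j\<in>{..<1}. r) \<in> carrier (free_power R 1)" using that by (intro restrict_free_power)
      show "(\<lambda>j\<in>{..<1::nat}. r) 0 \<ominus>\<^bsub>regular_module R\<^esub> r \<in> {\<zero>}"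
        using that by (simp add: regular_module_minus)
    qed
    show "x 0 \<in> {\<zero>} \<longleftrightarrow> x = \<zero>\<^bsub>free_power R 1\<^esub>" if x: "x \<in> carrier (free_power R 1)" for x
    proof
      assume "x 0 \<in> {\<zero>}"
      then show "x = \<zero>\<^bsub>free_power R 1\<^esub>"
        by (intro free_power_eqI[OF x]) (auto simp: free_power_coord
            intro: mod_hom.f_im[OF mod_hom_zero[OF module_free_power module_free_power] x])
    qed (simp add: free_power_coord)
  qed
  moreover have "(\<lambda>i. if i = 0 then 1 else 0) = (\<lambda>i. 0 choose i)" by (auto simp: fun_eq_iff binomial_eq_0)
  ultimately show ?case by (simp add: f_ideal_0)
next
  case (Suc p)
  interpret M: module R "regular_module R" by (rule module_regular)
  have p: "p \<le> c" "Suc p \<in> {1..c}" using Suc.prems by auto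
  interpret I: ideal "f_ideal R f p" R by (rule f_ideal_ideal[OF f p(1)])
  have fc: "f (Suc p) \<in> carrier R" using f p by blast
  obtain \<kappa> \<eta> where K: "minimal_resolution R (regular_module R) (carrier R) (f_ideal R f p) (\<lambda>i. p choose i) \<kappa> \<eta> J"
    using Suc.IH[OF p(1)] unfolding has_minimal_resolution_def by blast
  interpret K: minimal_resolution R "regular_module R" "carrier R" "f_ideal R f p" "\<lambda>i. p choose i" \<kappa> \<eta> J by (rule K)
  interpret J: ideal J R by (rule J)
  have Jc: "J \<subseteq> carrier R" using J.Icarr by blast
  have "has_minimal_resolution R J (regular_module R) (carrier R)
    (f_ideal R f p <+>\<^bsub>regular_module R\<^esub> {a \<odot>\<^bsub>regular_module R\<^esub> f (Suc p) |a. a \<in> carrier R})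
    (\<lambda>i. case i of 0 \<Rightarrow> p choose 0 | Suc j \<Rightarrow> (p choose Suc j) + (p choose j))"
  proof (rule K.cone_resolution[OF K])
    show "a \<odot>\<^bsub>regular_module R\<^esub> r \<in> f_ideal R f p" if "a \<in> f_ideal R f p" "r \<in> carrier R" for a r
      using that I.I_r_closed by (simp add: regular_module_simps)
    have "f (Suc p) \<odot>\<^bsub>regular_module R\<^esub> \<one> \<in> ideal_times R (regular_module R) J (carrier R)"
      by (rule M.ideal_timesI) (use Jc fJ p in \<open>auto simp: regular_module_simps\<close>)
    then show "f (Suc p) \<in> ideal_times R (regular_module R) J (carrier R)"
      using fc by (simp add: regular_module_simps)
    show "a \<in> f_ideal R f p" if "a \<in> carrier R" "a \<odot>\<^bsub>regular_module R\<^esub> f (Suc p) \<in> f_ideal R f p" for a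
      using reg[OF p(2) that(1)] that fc by (simp add: regular_module_simps m_comm)
  qed
  moreover have "(\<lambda>i. case i of 0 \<Rightarrow> p choose 0 | Suc j \<Rightarrow> (p choose Suc j) + (p choose j)) = (\<lambda>i. Suc p choose i)"
    by (auto simp: fun_eq_iff split: nat.split)
  ultimately show ?case using f_ideal_Suc[OF f Suc.prems] by simp
qed

end

section \<open>Ranks of free modules\<close>

context cring
begin

lemma finite_basis_iso:
  fixes M :: "('a, 'm) module"
  assumes M: "module R M" and B: "finite_basis R M B"
  shows "\<exists>g. mod_hom R (free_power R (card B)) M g \<and> g ` carrier (free_power R (card B)) = carrier M \<and>
    (\<forall>a\<in>carrier (free_power R (card B)). g a = \<zero>\<^bsub>M\<^esub> \<longrightarrow> a = \<zero>\<^bsub>free_power R (card B)\<^esub>)"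
proof -
  interpret M: module R M by fact
  have B': "finite B" "B \<subseteq> carrier M" "\<not> M.lin_dep B" "M.span B = carrier M"
    using B by (simp_all add: finite_basis_def)
  let ?r = "card B"
  obtain b where b: "bij_betw b {..<?r} B" using ex_bij_betw_nat_finite[OF B'(1)] by (auto simp: lessThan_atLeast0)
  have inj: "inj_on b {..<?r}" and im: "b ` {..<?r} = B" using b by (auto simp: bij_betw_def)
  have bc: "b j \<in> carrier M" if "j < ?r" for j using im B'(2) that by auto
  let ?g = "lin_comb M ?r b"
  have g: "mod_hom R (free_power R ?r) M ?g" by (rule lin_comb_hom(1)[OF M bc])
  have comb: "M.lincomb a B = ?g (\<lambda>j\<in>{..<?r}. a (b j))" if "a \<in> B \<rightarrow> carrier R" for a
  proof -
    have "M.lincomb a B = lin_comb M ?r b (\<lambda>j. a (b j))"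
      using M.lincomb_reindex[OF inj] im B'(2) that by simp
    also have "\<dots> = ?g (\<lambda>j\<in>{..<?r}. a (b j))"
    proof -
      have "a (b j) \<in> carrier R" if "j < ?r" for j using \<open>a \<in> B \<rightarrow> carrier R\<close> im that by blast
      then show ?thesis unfolding lin_comb_def by (intro M.finsum_cong') (use bc in auto)
    qed
    finally show ?thesis .
  qed
  have "carrier M \<subseteq> ?g ` carrier (free_power R ?r)"
  proof
    fix v assume "v \<in> carrier M"
    then obtain a where a: "a \<in> B \<rightarrow> carrier R" "v = M.lincomb a B"
      using M.finite_in_span[OF B'(1,2)] B'(4) by metis
    have "(\<lambda>j\<in>{..<?r}. a (b j)) \<in> carrier (free_power R ?r)"
      by (rule restrict_free_power) (use a(1) im in auto)
    then show "v \<in> ?g ` carrier (free_power R ?r)" using comb[OF a(1)] a(2) by blast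
  qed
  then have surj: "?g ` carrier (free_power R ?r) = carrier M" using mod_hom.f_im[OF g] by blast
  have "a = \<zero>\<^bsub>free_power R ?r\<^esub>" if a: "a \<in> carrier (free_power R ?r)" "?g a = \<zero>\<^bsub>M\<^esub>" for a
  proof -
    let ?a = "\<lambda>v. a (the_inv_into {..<?r} b v)"
    have inv: "the_inv_into {..<?r} b (b j) = j" if "j < ?r" for j using the_inv_into_f_f[OF inj] that by simp
    have ac: "?a \<in> B \<rightarrow> carrier R"
    proof
      fix v assume "v \<in> B"
      then obtain j where "j < ?r" "v = b j" using im by blast
      then show "?a v \<in> carrier R" using inv free_power_coord(4)[OF a(1)] by simp
    qed
    have "(\<lambda>j\<in>{..<?r}. ?a (b j)) = a"
      by (rule free_power_eqI[OF restrict_free_power a(1)]) (use inv a(1) in \<open>auto simp: free_power_coord\<close>)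
    then have zero: "M.lincomb ?a B = \<zero>\<^bsub>M\<^esub>" using comb[OF ac] a(2) by simp
    have "?a v = \<zero>" if "v \<in> B" for v
      using M.lin_dep_crit[OF B'(1) subset_refl ac that _ zero] B'(3) by blast
    then have "a j = \<zero>" if "j < ?r" for j using im inv that by force
    then show ?thesis
      by (intro free_power_eqI[OF a(1)])
        (auto simp: free_power_coord intro: mod_hom.f_im[OF mod_hom_zero[OF module_free_power module_free_power] a(1)])
  qed
  with g surj show ?thesis by blast
qed

text \<open>The rank is defined by a definite description, so all bases must be shown to have the same
  number of elements. A basis gives a minimal resolution of length zero, hence its cardinality is the
  Betti number in degree 0, which does not refer to the basis.\<close>

lemma free_rank_eq_card:
  fixes M :: "('a, 'm) module"
  assumes J: "maximalideal (max_ideal R) R" and M: "module R M" and B: "finite_basis R M B"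
  shows "free_rank R M = card B"
proof -
  interpret M: module R M by fact
  have betti: "betti R 0 M = card B'" if B': "finite_basis R M B'" for B'
  proof -
    obtain g where g: "mod_hom R (free_power R (card B')) M g" "g ` carrier (free_power R (card B')) = carrier M"
      "\<And>a. \<lbrakk>a \<in> carrier (free_power R (card B')); g a = \<zero>\<^bsub>M\<^esub>\<rbrakk> \<Longrightarrow> a = \<zero>\<^bsub>free_power R (card B')\<^esub>"
      using finite_basis_iso[OF M B'] by blast
    interpret g: mod_hom R "free_power R (card B')" M g by (rule g)
    have "has_minimal_resolution R (max_ideal R) M (carrier M) {\<zero>\<^bsub>M\<^esub>} (\<lambda>i. if i = 0 then card B' else 0)"
    proof (rule minimal_resolution_free[OF maximalideal.axioms(1)[OF J] M.submodule_carrier M.submodule_singleton_zero g(1)])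
      fix p assume "p \<in> carrier M"
      then obtain x where "x \<in> carrier (free_power R (card B'))" "p = g x" using g(2) by blast
      then show "\<exists>x\<in>carrier (free_power R (card B')). g x \<ominus>\<^bsub>M\<^esub> p \<in> {\<zero>\<^bsub>M\<^esub>}" by auto
    qed (use g(3) in auto)
    from betti_minimal_resolution[OF J this, of 0] show ?thesis by simp
  qed
  show ?thesis unfolding free_rank_def
    by (rule the_equality) (use B betti in metis)+
qed

end

section \<open>The maximal ideal\<close>

text \<open>Zorn's lemma, where the union of a chain is a member of it because the ring is Noetherian.\<close>

lemma (in noetherian_ring) proper_ideal_in_maximal:
  assumes I: "ideal I R" "I \<noteq> carrier R"
  shows "\<exists>J. maximalideal J R \<and> I \<subseteq> J"
proof -
  let ?A = "{K. ideal K R \<and> I \<subseteq> K \<and> \<one> \<notin> K}"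
  have one: "\<one> \<notin> I" using I ideal.one_imp_carrier by blast
  have "\<exists>M\<in>?A. \<forall>X\<in>?A. M \<subseteq> X \<longrightarrow> X = M"
  proof (rule subset_Zorn_nonempty)
    show "?A \<noteq> {}" using I one by blast
    fix C assume C: "C \<noteq> {}" "subset.chain ?A C"
    then have "subset.chain {I. ideal I R} C" by (auto simp: pred_on.chain_def)
    then have "\<Union>C \<in> C" by (rule ideal_chain_is_trivial[OF C(1)])
    then show "\<Union>C \<in> ?A" using C(2) by (auto simp: pred_on.chain_def)
  qed
  then obtain M where M: "ideal M R" "I \<subseteq> M" "\<one> \<notin> M" "\<forall>X\<in>?A. M \<subseteq> X \<longrightarrow> X = M"
    by (elim bexE CollectE conjE) (rule that; assumption)
  have "maximalideal M R"
  proof (rule maximalidealI[OF M(1)])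
    show "carrier R \<noteq> M" using M(3) by auto
    fix K assume K: "ideal K R" "M \<subseteq> K" "K \<subseteq> carrier R"
    show "K = M \<or> K = carrier R"
    proof (cases "\<one> \<in> K")
      case True
      then show ?thesis using ideal.one_imp_carrier[OF K(1)] by blast
    next
      case False
      then show ?thesis using M(2,4) K by blast
    qed
  qed
  then show ?thesis using M(2) by blast
qed

lemma (in noetherian_local_ring) maximalideal_max_ideal: "maximalideal (max_ideal R) R"
  unfolding max_ideal_def by (rule theI'[OF unique_maximal])

lemma (in noetherian_local_ring) proper_ideal_subset_max_ideal:
  assumes "ideal I R" "I \<noteq> carrier R"
  shows "I \<subseteq> max_ideal R"
  using proper_ideal_in_maximal[OF assms] maximalideal_max_ideal unique_maximal by blast

section \<open>Free filtrations\<close>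

lemma (in module) submodule_trans:
  assumes "submodule R P M" "submodule R W (M\<lparr>carrier := P\<rparr>)"
  shows "submodule R W M"
proof -
  interpret W: submodule R W "M\<lparr>carrier := P\<rparr>" by fact
  have "W \<subseteq> P" using W.subset by simp
  then show ?thesis
    using W.m_closed W.zero_closed W.smult_closed submodule.subset[OF assms(1)]
    by (intro submodule_criterion) auto
qed

lemma (in module) mod_hom_submodule:
  fixes L :: "('a, 'l, 'x) module_scheme"
  assumes "submodule R P M"
  shows "mod_hom R L (M\<lparr>carrier := P\<rparr>) g \<longleftrightarrow> mod_hom R L M g \<and> g ` carrier L \<subseteq> P"
proof
  assume "mod_hom R L (M\<lparr>carrier := P\<rparr>) g"
  then interpret g: mod_hom R L "M\<lparr>carrier := P\<rparr>" g .
  have "g x \<in> P" if "x \<in> carrier L" for x using g.f_im[OF that] by simp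
  then show "mod_hom R L M g \<and> g ` carrier L \<subseteq> P"
    using submodule.subset[OF assms] g.M.module_axioms module_axioms g.f_add g.f_smult
    by (auto intro!: mod_homI)
next
  assume g: "mod_hom R L M g \<and> g ` carrier L \<subseteq> P"
  then interpret g: mod_hom R L M g by blast
  show "mod_hom R L (M\<lparr>carrier := P\<rparr>) g"
    by (rule mod_homI[OF g.M.module_axioms submodule_is_module[OF assms]]) (use g in auto)
qed

context cring
begin

lemma free_filtration_facts:
  fixes A :: "('a, 'm) module"
  assumes filt: "free_filtration R c A F"
  shows "module R A" and "p \<le> c \<Longrightarrow> submodule R (F p) A"
    and "\<lbrakk>q \<le> p; p \<le> c\<rbrakk> \<Longrightarrow> F q \<subseteq> F p"
proof -
  show A: "module R A" using filt by (simp add: free_filtration_def fg_free_def)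
  interpret A: module R A by (rule A)
  show "p \<le> c \<Longrightarrow> submodule R (F p) A"
    using filt A.submodule_singleton_zero by (cases "p = 0") (auto simp: free_filtration_def)
  have step: "F p \<subseteq> F (Suc p)" if "Suc p \<le> c" for p
  proof -
    have "free_summand R (A\<lparr>carrier := F (Suc p)\<rparr>) (F p)"
      using filt that by (auto simp: free_filtration_def dest: bspec[of _ _ "Suc p"])
    then show ?thesis using submodule.subset[of R "F p"] by (fastforce simp: free_summand_def)
  qed
  show "q \<le> p \<Longrightarrow> p \<le> c \<Longrightarrow> F q \<subseteq> F p"
    by (induction p rule: dec_induct) (use step in \<open>auto dest: Suc_leD\<close>)
qed

lemma graded_piece_facts:
  fixes A :: "('a, 'm) module"
  assumes filt: "free_filtration R c A F" and p: "p \<in> {1..c}"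
  defines "\<pi> \<equiv> \<lambda>x. F (p - 1) +>\<^bsub>A\<^esub> x"
  shows "mod_hom R (A\<lparr>carrier := F p\<rparr>) (graded_piece A F p) \<pi>"
    and "carrier (graded_piece A F p) = \<pi> ` F p"
    and "x \<in> F p \<Longrightarrow> \<pi> x = \<zero>\<^bsub>graded_piece A F p\<^esub> \<longleftrightarrow> x \<in> F (p - 1)"
proof -
  note ff = free_filtration_facts[OF filt]
  interpret A: module R A by (rule ff)
  have Fp: "submodule R (F p) A" using ff(2) p by simp
  interpret P: module R "A\<lparr>carrier := F p\<rparr>" by (rule A.submodule_is_module[OF Fp])
  have "submodule R (F (p - 1)) (A\<lparr>carrier := F p\<rparr>)"
    using filt p by (simp add: free_filtration_def free_summand_def)
  note Q = P.quot_module_facts[OF this, folded graded_piece_def]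
  have c: "F (p - 1) +>\<^bsub>A\<lparr>carrier := F p\<rparr>\<^esub> x = \<pi> x" for x by (simp add: a_r_coset_def' \<pi>_def)
  then have c': "(\<lambda>x. F (p - 1) +>\<^bsub>A\<lparr>carrier := F p\<rparr>\<^esub> x) = \<pi>" by (rule ext)
  show "mod_hom R (A\<lparr>carrier := F p\<rparr>) (graded_piece A F p) \<pi>"
    "carrier (graded_piece A F p) = \<pi> ` F p"
    using Q(2,3) by (simp_all only: c' A.carrier_vs_is_self)
  show "x \<in> F p \<Longrightarrow> \<pi> x = \<zero>\<^bsub>graded_piece A F p\<^esub> \<longleftrightarrow> x \<in> F (p - 1)"
    using Q(4)[of x] by (simp only: c A.carrier_vs_is_self)
qed

text \<open>A basis of \<open>F p / F (p - 1)\<close>, lifted to \<open>F p\<close> and recorded as the linear map \<open>E\<close> from \<open>R\<^sup>r\<close> that it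
  defines.\<close>

definition graded_basis ::
    "('a, 'm) module \<Rightarrow> (nat \<Rightarrow> 'm set) \<Rightarrow> nat \<Rightarrow> nat \<Rightarrow> ((nat \<Rightarrow> 'a) \<Rightarrow> 'm) \<Rightarrow> bool"
  where "graded_basis A F p r E \<longleftrightarrow>
    mod_hom R (free_power R r) A E \<and> E ` carrier (free_power R r) \<subseteq> F p \<and>
    (\<forall>x\<in>F p. \<exists>y\<in>F (p - 1). \<exists>a\<in>carrier (free_power R r). x = y \<oplus>\<^bsub>A\<^esub> E a) \<and>
    (\<forall>a\<in>carrier (free_power R r). E a \<in> F (p - 1) \<longrightarrow> a = \<zero>\<^bsub>free_power R r\<^esub>)"

lemma graded_basis_exists:
  fixes A :: "('a, 'm) module"
  assumes J: "maximalideal (max_ideal R) R" and filt: "free_filtration R c A F" and p: "p \<in> {1..c}"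
  shows "\<exists>E. graded_basis A F p (free_rank R (graded_piece A F p)) E"
proof -
  define B where "B = graded_piece A F p"
  define r where "r = free_rank R B"
  note ff = free_filtration_facts[OF filt] and gp = graded_piece_facts[OF filt p, folded B_def]
  interpret A: module R A by (rule ff)
  have Fp: "submodule R (F p) A" using ff(2) p by simp
  interpret pi: mod_hom R "A\<lparr>carrier := F p\<rparr>" B "\<lambda>x. F (p - 1) +>\<^bsub>A\<^esub> x" by (rule gp(1))
  have "fg_free R B" using filt p by (simp add: free_filtration_def B_def)
  then obtain X where X: "finite_basis R B X" by (auto simp: fg_free_def)
  have r: "r = card X" unfolding r_def by (rule free_rank_eq_card[OF J pi.N.module_axioms X])
  obtain g where g: "mod_hom R (free_power R r) B g" "g ` carrier (free_power R r) = carrier B"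
    "\<forall>a\<in>carrier (free_power R r). g a = \<zero>\<^bsub>B\<^esub> \<longrightarrow> a = \<zero>\<^bsub>free_power R r\<^esub>"
    using finite_basis_iso[OF pi.N.module_axioms X, folded r]
    by (elim exE conjE) (rule that; assumption)
  have gx: "g x \<in> (\<lambda>x. F (p - 1) +>\<^bsub>A\<^esub> x) ` carrier (A\<lparr>carrier := F p\<rparr>)"
    if "x \<in> carrier (free_power R r)" for x
  proof -
    have "carrier B = (\<lambda>x. F (p - 1) +>\<^bsub>A\<^esub> x) ` carrier (A\<lparr>carrier := F p\<rparr>)" using gp(2) by simp
    then show ?thesis using mod_hom.f_im[OF g(1) that] by (rule subst)
  qed
  have "\<exists>E. mod_hom R (free_power R r) (A\<lparr>carrier := F p\<rparr>) E \<and>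
      (\<forall>x\<in>carrier (free_power R r). F (p - 1) +>\<^bsub>A\<^esub> E x = g x)"
    by (rule free_power_hom_lift[OF g(1) gp(1)]) (rule gx)
  then obtain E where E: "mod_hom R (free_power R r) (A\<lparr>carrier := F p\<rparr>) E"
    "\<forall>x\<in>carrier (free_power R r). F (p - 1) +>\<^bsub>A\<^esub> E x = g x"
    by (elim exE conjE) (rule that; assumption)
  have EF: "E a \<in> F p" if "a \<in> carrier (free_power R r)" for a
    using mod_hom.f_im[OF E(1) that] by simp
  have "\<exists>y\<in>F (p - 1). \<exists>a\<in>carrier (free_power R r). x = y \<oplus>\<^bsub>A\<^esub> E a" if x: "x \<in> F p" for x
  proof -
    have "F (p - 1) +>\<^bsub>A\<^esub> x \<in> g ` carrier (free_power R r)" using pi.f_im[of x] x g(2) by simp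
    then obtain a where a: "F (p - 1) +>\<^bsub>A\<^esub> x = g a" "a \<in> carrier (free_power R r)" by (rule imageE)
    have car: "x \<in> carrier A" "E a \<in> carrier A" using x EF[OF a(2)] submodule.subset[OF Fp] by auto
    define y where "y = x \<ominus>\<^bsub>A\<^esub> E a"
    have yF: "y \<in> F p" unfolding y_def by (rule A.submodule_diff[OF Fp x EF[OF a(2)]])
    have xy: "x = y \<oplus>\<^bsub>A\<^esub> E a" using car by (simp add: y_def A.M.minus_eq A.M.a_assoc A.M.l_neg)
    have "F (p - 1) +>\<^bsub>A\<^esub> (y \<oplus>\<^bsub>A\<^esub> E a) = (F (p - 1) +>\<^bsub>A\<^esub> y) \<oplus>\<^bsub>B\<^esub> g a"
      using mod_hom_add[OF gp(1), of y "E a"] yF EF[OF a(2)] E(2) a(2) by simp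
    then have "g a = (F (p - 1) +>\<^bsub>A\<^esub> y) \<oplus>\<^bsub>B\<^esub> g a" using a(1) xy by metis
    moreover have "F (p - 1) +>\<^bsub>A\<^esub> y \<in> carrier B" using pi.f_im[of y] yF by simp
    ultimately have "F (p - 1) +>\<^bsub>A\<^esub> y = \<zero>\<^bsub>B\<^esub>"
      using mod_hom.f_im[OF g(1) a(2)] by (metis pi.N.M.add.r_cancel_one')
    then have "y \<in> F (p - 1)" using gp(3)[OF yF] by blast
    then show ?thesis using xy a(2) by blast
  qed
  moreover have "a = \<zero>\<^bsub>free_power R r\<^esub>" if a: "a \<in> carrier (free_power R r)" "E a \<in> F (p - 1)" for a
    using gp(3)[OF EF[OF a(1)]] a g(3) E(2) by simp
  ultimately show ?thesis
    using E(1) unfolding A.mod_hom_submodule[OF Fp] graded_basis_def B_def[symmetric] r_def[symmetric]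
    by blast
qed

text \<open>A direct summand \<open>F\<close> of \<open>A\<close> satisfies \<open>F \<inter> J A = J F\<close>. Therefore minimality
  of \<open>d\<close>, which only says that its image lies in \<open>J A\<^sub>0\<close>, passes to the steps of the filtration.\<close>

lemma free_filtration_ideal_times:
  fixes A :: "('a, 'm) module"
  assumes J: "ideal J R" and filt: "free_filtration R c A F"
    and p: "p \<le> c" and x: "x \<in> F p" "x \<in> ideal_times R A J (carrier A)"
  shows "x \<in> ideal_times R A J (F p)"
proof -
  note ff = free_filtration_facts[OF filt]
  interpret A: module R A by (rule ff)
  interpret J: ideal J R by fact
  have Jc: "J \<subseteq> carrier R" using J.Icarr by blast
  have Fc: "F q \<subseteq> carrier A" if "q \<le> c" for q using ff(2)[OF that] submodule.subset by blast
  have descend: "z \<in> ideal_times R A J (F q)"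
    if q: "Suc q \<le> c" and z: "z \<in> F q" "z \<in> ideal_times R A J (F (Suc q))" for q z
  proof -
    have "free_summand R (A\<lparr>carrier := F (Suc q)\<rparr>) (F q)"
      using filt q by (auto simp: free_filtration_def dest: bspec[of _ _ "Suc q"])
    then obtain C where C: "submodule R C (A\<lparr>carrier := F (Suc q)\<rparr>)" "F q \<inter> C = {\<zero>\<^bsub>A\<^esub>}"
      "F q <+>\<^bsub>A\<^esub> C = F (Suc q)"
      by (auto simp: free_summand_def set_add_def')
    have CA: "submodule R C A" by (rule A.submodule_trans[OF ff(2)[OF q] C(1)])
    have Fq: "submodule R (F q) A" using ff(2) q by simp
    have JF: "submodule R (ideal_times R A J (F q)) A"
      using Fc q by (intro A.submodule_ideal_times[OF Jc]) simp
    have "ideal_times R A J (F (Suc q)) \<subseteq> ideal_times R A J (F q) <+>\<^bsub>A\<^esub> C"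
    proof (rule A.ideal_times_least[OF A.submodule_plus[OF JF CA]])
      fix a y assume a: "a \<in> J" and "y \<in> F (Suc q)"
      then obtain u v where u: "u \<in> F q" "v \<in> C" "y = u \<oplus>\<^bsub>A\<^esub> v"
        unfolding C(3)[symmetric] A.mem_plus_iff by blast
      have "u \<in> carrier A" "v \<in> carrier A" using u submodule.subset[OF Fq] submodule.subset[OF CA] by auto
      then have "a \<odot>\<^bsub>A\<^esub> y = a \<odot>\<^bsub>A\<^esub> u \<oplus>\<^bsub>A\<^esub> a \<odot>\<^bsub>A\<^esub> v"
        using a Jc u(3) by (simp add: A.smult_r_distr subset_iff)
      moreover have "a \<odot>\<^bsub>A\<^esub> u \<in> ideal_times R A J (F q)"
        by (rule A.ideal_timesI[OF Jc submodule.subset[OF Fq] a u(1)])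
      moreover have "a \<odot>\<^bsub>A\<^esub> v \<in> C" using submodule.smult_closed[OF CA] a Jc u(2) by blast
      ultimately show "a \<odot>\<^bsub>A\<^esub> y \<in> ideal_times R A J (F q) <+>\<^bsub>A\<^esub> C" unfolding A.mem_plus_iff by blast
    qed
    from subsetD[OF this z(2)]
    obtain u v where u: "u \<in> ideal_times R A J (F q)" "v \<in> C" "z = u \<oplus>\<^bsub>A\<^esub> v"
      unfolding A.mem_plus_iff by blast
    have uF: "u \<in> F q" using A.ideal_times_subset[OF Jc Fq] u(1) by blast
    have uv: "u \<in> carrier A" "v \<in> carrier A" using uF u submodule.subset[OF Fq] submodule.subset[OF CA] by auto
    have "v \<oplus>\<^bsub>A\<^esub> u \<in> F q" using z(1) u(3) uv by (simp add: A.M.a_comm)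
    then have "v \<in> F q" using A.submodule_add_cancel[OF Fq uv(2) uF] by blast
    then have "v = \<zero>\<^bsub>A\<^esub>" using C(2) u(2) by blast
    then show ?thesis using u uv by simp
  qed
  have "x \<in> F p \<longrightarrow> x \<in> ideal_times R A J (F p)"
    using p
  proof (induction rule: inc_induct)
    case base
    then show ?case using x(2) filt by (simp add: free_filtration_def)
  next
    case (step q)
    then show ?case using descend[of q x]
        ff(3)[of q "Suc q"] by auto
  qed
  then show ?thesis using x(1) by blast
qed

end

section \<open>Higher matrix factorizations\<close>

context higher_matrix_factorization
begin

abbreviation prev_ideal :: "nat \<Rightarrow> 'a set" where "prev_ideal p \<equiv> f_ideal S f (p - 1)"

text \<open>The module \<open>M(p) = A\<^sub>0(p) / ((f 1, \<dots>, f p) A\<^sub>0(p) + d A\<^sub>1(p))\<close> of the \<open>p\<close>-th stage is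
  represented by the pair of \<open>F0 p\<close> and \<open>hmf_relations p\<close>, and \<open>hmf_rank p\<close> lists the Betti numbers that it will turn out to have.\<close>

definition hmf_relations :: "nat \<Rightarrow> 'm set"
  where "hmf_relations p = ideal_times S A0 (f_ideal S f p) (F0 p) <+>\<^bsub>A0\<^esub> d ` F1 p"

definition hmf_rank :: "nat \<Rightarrow> nat \<Rightarrow> nat"
  where "hmf_rank p i = (\<Sum>q=1..p. free_rank S (graded_piece A0 F0 q) * (q - 1 choose i) +
    (case i of 0 \<Rightarrow> 0 | Suc j \<Rightarrow> free_rank S (graded_piece A1 F1 q) * (q - 1 choose j)))"

lemmas filt0_facts = free_filtration_facts[OF filt0]
lemmas filt1_facts = free_filtration_facts[OF filt1]

lemma d_mod_hom: "mod_hom S A1 A0 d"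
  using d_hom filt0_facts(1) filt1_facts(1) by (simp add: mod_hom_def mod_hom_axioms_def)

lemma d_filtration: "p \<le> c \<Longrightarrow> x \<in> F1 p \<Longrightarrow> d x \<in> F0 p"
proof (cases "p = 0")
  case True
  assume "x \<in> F1 p"
  then show ?thesis
    using True filt0 filt1 mod_hom.f0_is_0[OF d_mod_hom] by (simp add: free_filtration_def)
qed (use d_filt[of p] in auto)

lemma h_component:
  assumes p: "p \<in> {1..c}"
  shows "mod_hom S (A0\<lparr>carrier := F0 p\<rparr>) (A1\<lparr>carrier := F1 p\<rparr>) (\<lambda>a. h (hmf_incl c A0 p a))"
proof -
  interpret A0: module S A0 by (rule filt0_facts)
  interpret A1: module S A1 by (rule filt1_facts)
  have F0p: "submodule S (F0 p) A0" and F1p: "submodule S (F1 p) A1"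
    using filt0_facts(2) filt1_facts(2) p by auto
  have F0c: "F0 p \<subseteq> carrier A0" using submodule.subset[OF F0p] .
  have zero: "\<zero>\<^bsub>A0\<^esub> \<in> F0 q" if "q \<in> {1..c}" for q
    using submodule.zero_closed[OF filt0_facts(2)[of q]] that by simp
  have incl: "hmf_incl c A0 p a \<in> carrier (hmf_source c A0 F0)" if "a \<in> F0 p" for a
    using that zero by (auto simp: hmf_incl_def hmf_source_def dsum_module_def)
  have hF1: "h (hmf_incl c A0 p a) \<in> F1 p" if "a \<in> F0 p" for a
  proof -
    have "hmf_incl c A0 p a \<in> hmf_source_filt c A0 F0 p"
      using incl[OF that] by (auto simp: hmf_source_filt_def hmf_incl_def)
    then show ?thesis using h_filt[OF p] by blast
  qed
  show ?thesis
  proof (rule mod_homI[OF A0.submodule_is_module[OF F0p] A1.submodule_is_module[OF F1p]])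
    fix a assume a: "a \<in> carrier (A0\<lparr>carrier := F0 p\<rparr>)"
    then show "h (hmf_incl c A0 p a) \<in> carrier (A1\<lparr>carrier := F1 p\<rparr>)" using hF1 by simp
    { fix b assume b: "b \<in> carrier (A0\<lparr>carrier := F0 p\<rparr>)"
      have "hmf_incl c A0 p (a \<oplus>\<^bsub>A0\<^esub> b) = hmf_incl c A0 p a \<oplus>\<^bsub>hmf_source c A0 F0\<^esub> hmf_incl c A0 p b"
        by (auto simp: hmf_incl_def hmf_source_def dsum_module_def fun_eq_iff)
      then show "h (hmf_incl c A0 p (a \<oplus>\<^bsub>A0\<lparr>carrier := F0 p\<rparr>\<^esub> b)) =
          h (hmf_incl c A0 p a) \<oplus>\<^bsub>A1\<lparr>carrier := F1 p\<rparr>\<^esub> h (hmf_incl c A0 p b)"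
        using module_hom_add[OF h_hom incl incl] a b by simp }
    { fix r assume r: "r \<in> carrier S"
      have "hmf_incl c A0 p (r \<odot>\<^bsub>A0\<^esub> a) = r \<odot>\<^bsub>hmf_source c A0 F0\<^esub> hmf_incl c A0 p a"
        using r by (auto simp: hmf_incl_def hmf_source_def dsum_module_def fun_eq_iff)
      then show "h (hmf_incl c A0 p (r \<odot>\<^bsub>A0\<lparr>carrier := F0 p\<rparr>\<^esub> a)) =
          r \<odot>\<^bsub>A1\<lparr>carrier := F1 p\<rparr>\<^esub> h (hmf_incl c A0 p a)"
        using module_hom_smult[OF h_hom r incl] a by simp }
  qed
qed

lemma f_Pi: "f \<in> {1..c} \<rightarrow> carrier S"
  using f_closed by blast

lemma f_ideal_closed: "p \<le> c \<Longrightarrow> f_ideal S f p \<subseteq> carrier S"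
  using ideal.Icarr[OF f_ideal_ideal[OF f_Pi]] by blast

text \<open>Write \<open>R(q)\<close> for the quotient of the ring by \<open>(f 1, \<dots>, f q)\<close>. The claim is that \<open>R(p - 1) \<otimes> B\<^sub>1(p)\<close> is
  embedded by \<open>d\<close> into the quotient of \<open>R(p - 1) \<otimes> A\<^sub>0(p)\<close> by the image of \<open>A\<^sub>1(p - 1)\<close>. If \<open>d (E a)\<close> vanishes
  there, then \<open>E a\<close> can be corrected by an element of \<open>A\<^sub>1(p - 1)\<close> to an \<open>x\<close> for which \<open>d x\<close> lies in
  \<open>(f 1, \<dots>, f (p - 1)) A\<^sub>0(p)\<close>. Then \<open>\<pi> (h (d x))\<close> is zero modulo \<open>(f 1, \<dots>, f (p - 1))\<close>, but it is
  also congruent to \<open>f p \<pi> x\<close>. Hence \<open>f p a\<close> has its coordinates in \<open>(f 1, \<dots>, f (p - 1))\<close>, and by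
  regularity \<open>a\<close> has them there too.\<close>

lemma relation_coefficients:
  fixes r :: nat
  assumes p: "p \<in> {1..c}" and reg: "regular_sequence S c f"
    and E_basis: "graded_basis A1 F1 p r E"
    and a: "a \<in> carrier (free_power S r)"
    and rel: "d (E a) \<in> ideal_times S A0 (prev_ideal p) (F0 p) <+>\<^bsub>A0\<^esub> d ` F1 (p - 1)"
  shows "a \<in> ideal_vecs (prev_ideal p) r"
proof -
  let ?I = "prev_ideal p" and ?B = "graded_piece A1 F1 p"
  let ?\<pi> = "\<lambda>y. F1 (p - 1) +>\<^bsub>A1\<^esub> y" and ?h = "\<lambda>a. h (hmf_incl c A0 p a)"
  have p': "p \<le> c" "p - 1 \<le> c" using p by auto
  interpret A0: module S A0 by (rule filt0_facts)
  interpret A1: module S A1 by (rule filt1_facts)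
  interpret d: mod_hom S A1 A0 d by (rule d_mod_hom)
  have E: "mod_hom S (free_power S r) A1 E" "E ` carrier (free_power S r) \<subseteq> F1 p"
    and E_span: "\<And>x. x \<in> F1 p \<Longrightarrow> \<exists>y\<in>F1 (p - 1). \<exists>a\<in>carrier (free_power S r). x = y \<oplus>\<^bsub>A1\<^esub> E a"
    and E_indep: "\<And>a. \<lbrakk>a \<in> carrier (free_power S r); E a \<in> F1 (p - 1)\<rbrakk> \<Longrightarrow> a = \<zero>\<^bsub>free_power S r\<^esub>"
    using E_basis unfolding graded_basis_def by blast+
  interpret E: mod_hom S "free_power S r" A1 E by (rule E)
  have I: "ideal ?I S" by (rule f_ideal_ideal[OF f_Pi p'(2)])
  interpret I: ideal ?I S by (rule I)
  have Ic: "?I \<subseteq> carrier S" by (rule f_ideal_closed[OF p'(2)])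
  have fp: "f p \<in> carrier S" by (rule f_closed[OF p])
  have F0p: "submodule S (F0 p) A0" and F1p: "submodule S (F1 p) A1" and F1p': "submodule S (F1 (p - 1)) A1"
    using filt0_facts(2) filt1_facts(2) p' by auto
  have F01: "F1 (p - 1) \<subseteq> F1 p" using filt1_facts(3)[of "p - 1" p] p' by simp
  note gp = graded_piece_facts[OF filt1 p]
  interpret pi: mod_hom S "A1\<lparr>carrier := F1 p\<rparr>" ?B ?\<pi> by (rule gp(1))
  let ?g = "\<lambda>a. ?\<pi> (E a)"
  have EF: "E a \<in> carrier (A1\<lparr>carrier := F1 p\<rparr>)" if "a \<in> carrier (free_power S r)" for a
    using E(2) that by auto
  have "mod_hom S (free_power S r) (A1\<lparr>carrier := F1 p\<rparr>) E"
    unfolding A1.mod_hom_submodule[OF F1p] using E by blast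
  then have g: "mod_hom S (free_power S r) ?B ?g" by (rule mod_hom_comp[OF _ gp(1)])
  interpret g: mod_hom S "free_power S r" ?B ?g by (rule g)
  have mod_prev: "?\<pi> (u \<oplus>\<^bsub>A1\<^esub> v) = ?\<pi> v" if u: "u \<in> F1 (p - 1)" and v: "v \<in> F1 p" for u v
  proof -
    have uF: "u \<in> F1 p" using u F01 by blast
    have "?\<pi> (u \<oplus>\<^bsub>A1\<^esub> v) = ?\<pi> u \<oplus>\<^bsub>?B\<^esub> ?\<pi> v" using mod_hom_add[OF gp(1), of u v] uF v by simp
    also have "?\<pi> u = \<zero>\<^bsub>?B\<^esub>" using gp(3)[OF uF] u by blast
    finally show ?thesis using pi.f_im[of v] v by simp
  qed
  have IB: "submodule S (ideal_times S ?B ?I (carrier ?B)) ?B"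
    by (rule pi.N.submodule_ideal_times[OF Ic subset_refl])
  from rel obtain w y where w: "w \<in> ideal_times S A0 ?I (F0 p)" and y: "y \<in> F1 (p - 1)"
    and dEa: "d (E a) = w \<oplus>\<^bsub>A0\<^esub> d y" unfolding A0.mem_plus_iff by blast
  have wF: "w \<in> F0 p" using A0.ideal_times_subset[OF Ic F0p] w by blast
  have wc: "w \<in> carrier A0" and yc: "y \<in> carrier A1"
    using wF y submodule.subset[OF F0p] submodule.subset[OF F1p'] by auto
  \<comment> \<open>\<open>d x\<close> vanishes modulo \<open>(f 1, \<dots>, f (p - 1))\<close>, while \<open>x\<close> and \<open>E a\<close> have the same class in
    \<open>B\<^sub>1(p)\<close>\<close>
  define x where "x = E a \<ominus>\<^bsub>A1\<^esub> y"
  have xF: "x \<in> F1 p"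
    unfolding x_def by (rule A1.submodule_diff[OF F1p]) (use E(2) a y F01 in auto)
  have dx: "d x = w"
    using dEa a wc yc by (simp add: x_def A0.M.minus_eq A0.M.a_assoc A0.M.r_neg)
  have "E a = y \<oplus>\<^bsub>A1\<^esub> x"
    using a yc by (simp add: x_def A1.M.minus_eq A1.M.a_lcomm[of y] A1.M.r_neg)
  then have \<pi>x: "?\<pi> x = ?g a" using mod_prev[OF y xF] by simp
  have hw: "?\<pi> (?h w) \<in> ideal_times S ?B ?I (carrier ?B)"
  proof -
    have comp: "mod_hom S (A0\<lparr>carrier := F0 p\<rparr>) ?B (\<lambda>a. ?\<pi> (?h a))"
      by (rule mod_hom_comp[OF h_component[OF p] gp(1)])
    let ?W = "{a \<in> carrier (A0\<lparr>carrier := F0 p\<rparr>). ?\<pi> (?h a) \<in> ideal_times S ?B ?I (carrier ?B)}"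
    have "submodule S ?W A0"
      by (rule A0.submodule_trans[OF F0p submodule_vimage[OF comp IB]])
    moreover have "i \<odot>\<^bsub>A0\<^esub> b \<in> ?W" if i: "i \<in> ?I" and b: "b \<in> F0 p" for i b
    proof -
      have ic: "i \<in> carrier S" using i Ic by blast
      have bc: "b \<in> carrier (A0\<lparr>carrier := F0 p\<rparr>)" using b by simp
      have "?\<pi> (?h (i \<odot>\<^bsub>A0\<^esub> b)) = i \<odot>\<^bsub>?B\<^esub> ?\<pi> (?h b)" using mod_hom_smult[OF comp ic bc] by simp
      also have "\<dots> \<in> ideal_times S ?B ?I (carrier ?B)"
        by (rule pi.N.ideal_timesI[OF Ic subset_refl i mod_hom.f_im[OF comp bc]])
      finally show ?thesis using submodule.smult_closed[OF F0p ic b] by simp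
    qed
    ultimately have "ideal_times S A0 ?I (F0 p) \<subseteq> ?W" by (rule A0.ideal_times_least)
    then show ?thesis using w by blast
  qed
  have xc: "x \<in> carrier (A1\<lparr>carrier := F1 p\<rparr>)" using xF by simp
  have hx: "?h w \<in> carrier (A1\<lparr>carrier := F1 p\<rparr>)"
    using mod_hom.f_im[OF h_component[OF p], of w] wF by simp
  have "?\<pi> (?h (d x)) \<ominus>\<^bsub>?B\<^esub> (f p \<odot>\<^bsub>?B\<^esub> ?\<pi> x) \<in> ideal_times S ?B ?I (carrier ?B)"
    using hd[OF p xF] by (simp add: Let_def)
  then have "?\<pi> (?h w) \<ominus>\<^bsub>?B\<^esub> (f p \<odot>\<^bsub>?B\<^esub> ?g a) \<in> ideal_times S ?B ?I (carrier ?B)"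
    by (simp only: dx \<pi>x)
  from pi.N.submodule_diff_iff[OF IB _ _ this]
  have "f p \<odot>\<^bsub>?B\<^esub> ?g a \<in> ideal_times S ?B ?I (carrier ?B)"
    using hw pi.f_im[OF hx] pi.N.smult_closed[OF fp g.f_im[OF a]] by blast
  moreover have "ideal_times S ?B ?I (carrier ?B) \<subseteq> ?g ` ideal_vecs ?I r"
  proof (rule pi.N.ideal_times_least[OF submodule_image[OF g submodule_ideal_vecs[OF I]]])
    fix i b assume i: "i \<in> ?I" and "b \<in> carrier ?B"
    then obtain z where z: "z \<in> F1 p" "b = ?\<pi> z" unfolding gp(2) by blast
    obtain u v where uv: "u \<in> F1 (p - 1)" "v \<in> carrier (free_power S r)" "z = u \<oplus>\<^bsub>A1\<^esub> E v"
      using E_span[OF z(1)] by blast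
    have v: "v \<in> carrier (free_power S r)" "b = ?g v"
      using uv z(2) mod_prev[OF uv(1), of "E v"] EF[OF uv(2)] by simp_all
    have ic: "i \<in> carrier S" using i Ic by blast
    have "i \<odot>\<^bsub>free_power S r\<^esub> v \<in> ideal_vecs ?I r"
      using v(1) i ic I.I_r_closed by (simp add: ideal_vecs_def free_power_coord)
    moreover have "i \<odot>\<^bsub>?B\<^esub> b = ?g (i \<odot>\<^bsub>free_power S r\<^esub> v)"
      using mod_hom_smult[OF g ic v(1)] v(2) by (simp only:)
    ultimately show "i \<odot>\<^bsub>?B\<^esub> b \<in> ?g ` ideal_vecs ?I r" by blast
  qed
  ultimately obtain u where u: "u \<in> ideal_vecs ?I r" "f p \<odot>\<^bsub>?B\<^esub> ?g a = ?g u" by blast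
  have uc: "u \<in> carrier (free_power S r)" using u(1) by (simp add: ideal_vecs_def)
  let ?v = "(f p \<odot>\<^bsub>free_power S r\<^esub> a) \<ominus>\<^bsub>free_power S r\<^esub> u"
  have vc: "?v \<in> carrier (free_power S r)" using uc a fp by simp
  have "?g ?v = ?g (f p \<odot>\<^bsub>free_power S r\<^esub> a) \<ominus>\<^bsub>?B\<^esub> ?g u" by (rule g.f_minus) (use uc a fp in simp_all)
  also have "?g (f p \<odot>\<^bsub>free_power S r\<^esub> a) = ?g u" using mod_hom_smult[OF g fp a] u(2) by simp
  also have "?g u \<ominus>\<^bsub>?B\<^esub> ?g u = \<zero>\<^bsub>?B\<^esub>" using g.f_im[OF uc] by simp
  finally have "E ?v \<in> F1 (p - 1)" using gp(3)[of "E ?v"] EF[OF vc] by simp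
  then have "?v = \<zero>\<^bsub>free_power S r\<^esub>" by (rule E_indep[OF vc])
  then have fa: "f p \<odot>\<^bsub>free_power S r\<^esub> a = u" using uc a fp by simp
  have "a j \<in> ?I" if j: "j < r" for j
  proof -
    have "f p \<otimes> a j \<in> ?I" using u(1) j unfolding fa[symmetric] by (simp add: ideal_vecs_def free_power_coord)
    moreover have "a j \<in> carrier S" using a j by (rule free_power_coord(4))
    ultimately show ?thesis using reg p unfolding regular_sequence_def by blast
  qed
  then show ?thesis using a by (simp add: ideal_vecs_def)
qed

text \<open>The congruence \<open>d h \<equiv> f p\<close> shows that \<open>f p A\<^sub>0(p)\<close> already lies in the right-hand side. So \<open>M(p)\<close> is a
  cokernel over \<open>R(p - 1)\<close> rather than over \<open>R(p)\<close>, which makes it comparable with \<open>M(p - 1)\<close>.\<close>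

lemma hmf_relations_eq:
  assumes p: "p \<in> {1..c}"
  shows "hmf_relations p = ideal_times S A0 (prev_ideal p) (F0 p) <+>\<^bsub>A0\<^esub> d ` F1 p"
proof
  let ?N = "ideal_times S A0 (prev_ideal p) (F0 p) <+>\<^bsub>A0\<^esub> d ` F1 p"
  have p': "p \<le> c" "p - 1 \<le> c" "Suc (p - 1) = p" using p by auto
  interpret A0: module S A0 by (rule filt0_facts)
  interpret A1: module S A1 by (rule filt1_facts)
  have F0p: "submodule S (F0 p) A0" and F1p: "submodule S (F1 p) A1"
    using filt0_facts(2) filt1_facts(2) p' by auto
  have F0c: "F0 p \<subseteq> carrier A0" using submodule.subset[OF F0p] .
  note Ic = f_ideal_closed[OF p'(1)] f_ideal_closed[OF p'(2)]
  have dF: "submodule S (d ` F1 p) A0" by (rule submodule_image[OF d_mod_hom F1p])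
  have IF: "submodule S (ideal_times S A0 (prev_ideal p) (F0 p)) A0"
    by (rule A0.submodule_ideal_times[OF Ic(2) F0c])
  have N: "submodule S ?N A0" by (rule A0.submodule_plus[OF IF dF])
  note sub = A0.subset_plus[OF IF dF]
  have fN: "f p \<odot>\<^bsub>A0\<^esub> x \<in> ?N" if x: "x \<in> F0 p" for x
  proof -
    let ?y = "d (h (hmf_incl c A0 p x))"
    have "h (hmf_incl c A0 p x) \<in> F1 p" using mod_hom.f_im[OF h_component[OF p], of x] x by simp
    then have y: "?y \<in> d ` F1 p" by blast
    have car: "?y \<in> carrier A0" "f p \<odot>\<^bsub>A0\<^esub> x \<in> carrier A0"
      using y submodule.subset[OF dF] x F0c f_closed[OF p] by auto
    have "?y \<ominus>\<^bsub>A0\<^esub> f p \<odot>\<^bsub>A0\<^esub> x \<in> ?N" using dh[OF p x] sub(1) by blast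
    from A0.submodule_diff_iff[OF N car this] show ?thesis using y sub(2) by blast
  qed
  have IN: "a \<odot>\<^bsub>A0\<^esub> x \<in> ?N" if "a \<in> f_ideal S f p" "x \<in> F0 p" for a x
  proof -
    have "a \<in> prev_ideal p <+>\<^bsub>regular_module S\<^esub> {s \<odot>\<^bsub>regular_module S\<^esub> f p |s. s \<in> carrier S}"
      using f_ideal_Suc[OF f_Pi, of "p - 1"] that(1) unfolding p'(3) using p'(1) by blast
    then obtain i s where split: "i \<in> prev_ideal p" "s \<in> carrier S" "a = i \<oplus> s \<otimes> f p"
      by (auto simp: set_add_def' regular_module_simps)
    have xc: "x \<in> carrier A0" and ic: "i \<in> carrier S" using that(2) F0c split(1) Ic(2) by auto
    have "a \<odot>\<^bsub>A0\<^esub> x = i \<odot>\<^bsub>A0\<^esub> x \<oplus>\<^bsub>A0\<^esub> s \<odot>\<^bsub>A0\<^esub> (f p \<odot>\<^bsub>A0\<^esub> x)"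
      using split xc ic f_closed[OF p] by (simp add: A0.smult_l_distr A0.smult_assoc1)
    moreover have "i \<odot>\<^bsub>A0\<^esub> x \<in> ?N"
      using A0.ideal_timesI[OF Ic(2) F0c split(1) that(2)] sub(1) by blast
    moreover have "s \<odot>\<^bsub>A0\<^esub> (f p \<odot>\<^bsub>A0\<^esub> x) \<in> ?N"
      using submodule.smult_closed[OF N split(2) fN[OF that(2)]] .
    ultimately show ?thesis using submodule.m_closed[OF N] by simp
  qed
  show "hmf_relations p \<subseteq> ?N" unfolding hmf_relations_def
    by (rule A0.plus_least[OF N A0.ideal_times_least[OF N IN] sub(2)])
  have IF': "submodule S (ideal_times S A0 (f_ideal S f p) (F0 p)) A0"
    by (rule A0.submodule_ideal_times[OF Ic(1) F0c])
  have "ideal_times S A0 (prev_ideal p) (F0 p) \<subseteq> ideal_times S A0 (f_ideal S f p) (F0 p)"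
    by (rule A0.ideal_times_mono[OF f_ideal_mono[OF f_Pi] Ic(1) subset_refl F0c]) (use p in auto)
  then show "?N \<subseteq> hmf_relations p" unfolding hmf_relations_def
    using A0.subset_plus[OF IF' dF] by (intro A0.plus_least[OF A0.submodule_plus[OF IF' dF]]) auto
qed

text \<open>The exact sequence
  \<open>0 \<rightarrow> R(p - 1) \<otimes> B\<^sub>1(p) \<rightarrow> M(p - 1) \<oplus> R(p - 1) \<otimes> B\<^sub>0(p) \<rightarrow> M(p) \<rightarrow> 0\<close> at work: its middle term arises from
  \<open>M(p - 1)\<close> by adjoining a basis of \<open>B\<^sub>0(p)\<close>, and \<open>M(p)\<close> from the middle term by adjoining the images of
  a basis of \<open>B\<^sub>1(p)\<close> as relations.\<close>

lemma hmf_resolution_step: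
  assumes J: "maximalideal (max_ideal S) S" and reg: "regular_sequence S c f"
    and fJ: "\<And>p. p \<in> {1..c} \<Longrightarrow> f p \<in> max_ideal S"
    and dmin: "d ` carrier A1 \<subseteq> ideal_times S A0 (max_ideal S) (carrier A0)"
    and p: "p \<in> {1..c}"
    and res: "has_minimal_resolution S (max_ideal S) A0 (F0 (p - 1)) (hmf_relations (p - 1)) n"
  shows "has_minimal_resolution S (max_ideal S) A0 (F0 p) (hmf_relations p)
    (\<lambda>i. (n i + free_rank S (graded_piece A0 F0 p) * (p - 1 choose i)) +
      (case i of 0 \<Rightarrow> 0 | Suc j \<Rightarrow> free_rank S (graded_piece A1 F1 p) * (p - 1 choose j)))"
proof -
  let ?J = "max_ideal S" and ?I = "prev_ideal p"
  let ?r0 = "free_rank S (graded_piece A0 F0 p)" and ?r1 = "free_rank S (graded_piece A1 F1 p)"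
  have p': "p \<le> c" "p - 1 \<le> c" using p by auto
  have JI: "ideal ?J S" by (rule maximalideal.axioms(1)[OF J])
  interpret A0: module S A0 by (rule filt0_facts)
  interpret A1: module S A1 by (rule filt1_facts)
  interpret d: mod_hom S A1 A0 d by (rule d_mod_hom)
  have I: "ideal ?I S" by (rule f_ideal_ideal[OF f_Pi p'(2)])
  interpret I: ideal ?I S by (rule I)
  have Ic: "?I \<subseteq> carrier S" by (rule f_ideal_closed[OF p'(2)])
  have F0p: "submodule S (F0 p) A0" and F1p: "submodule S (F1 p) A1"
    and F0p': "submodule S (F0 (p - 1)) A0" and F1p': "submodule S (F1 (p - 1)) A1"
    using filt0_facts(2) filt1_facts(2) p' by auto
  have F00: "F0 (p - 1) \<subseteq> F0 p" and F11: "F1 (p - 1) \<subseteq> F1 p"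
    using filt0_facts(3)[of "p - 1" p] filt1_facts(3)[of "p - 1" p] p' by simp_all
  have c0: "F0 p \<subseteq> carrier A0" "F0 (p - 1) \<subseteq> carrier A0"
    using submodule.subset[OF F0p] submodule.subset[OF F0p'] .
  have c1: "F1 p \<subseteq> carrier A1" "F1 (p - 1) \<subseteq> carrier A1"
    using submodule.subset[OF F1p] submodule.subset[OF F1p'] .
  have K: "has_minimal_resolution S ?J (regular_module S) (carrier S) ?I (\<lambda>i. p - 1 choose i)"
  proof (rule koszul_resolution[OF JI f_Pi _ _ p'(2)])
    show "x \<in> f_ideal S f (q - 1)"
      if "q \<in> {1..c}" "x \<in> carrier S" "f q \<otimes> x \<in> f_ideal S f (q - 1)" for q x
      using reg that unfolding regular_sequence_def by blast
  qed (rule fJ)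
  obtain E0 where E0_basis: "graded_basis A0 F0 p ?r0 E0" using graded_basis_exists[OF J filt0 p] by blast
  have E0: "mod_hom S (free_power S ?r0) A0 E0" "E0 ` carrier (free_power S ?r0) \<subseteq> F0 p"
    and E0_span: "\<And>x. x \<in> F0 p \<Longrightarrow> \<exists>y\<in>F0 (p - 1). \<exists>a\<in>carrier (free_power S ?r0). x = y \<oplus>\<^bsub>A0\<^esub> E0 a"
    using E0_basis unfolding graded_basis_def by blast+
  have E0_indep: "a = \<zero>\<^bsub>free_power S ?r0\<^esub>" if "a \<in> carrier (free_power S ?r0)" "E0 a \<in> F0 (p - 1)" for a
    using E0_basis that unfolding graded_basis_def by blast
  obtain E1 where E1_basis: "graded_basis A1 F1 p ?r1 E1" using graded_basis_exists[OF J filt1 p] by blast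
  have E1: "mod_hom S (free_power S ?r1) A1 E1" "E1 ` carrier (free_power S ?r1) \<subseteq> F1 p"
    and E1_span: "\<And>x. x \<in> F1 p \<Longrightarrow> \<exists>y\<in>F1 (p - 1). \<exists>a\<in>carrier (free_power S ?r1). x = y \<oplus>\<^bsub>A1\<^esub> E1 a"
    using E1_basis unfolding graded_basis_def by blast+
  interpret E0: mod_hom S "free_power S ?r0" A0 E0 by (rule E0)
  interpret E1: mod_hom S "free_power S ?r1" A1 E1 by (rule E1)
  let ?N = "hmf_relations (p - 1)"
  define T where "T = ideal_times S A0 ?I (F0 p) <+>\<^bsub>A0\<^esub> d ` F1 (p - 1)"
  have IF: "submodule S (ideal_times S A0 ?I (F0 p)) A0" by (rule A0.submodule_ideal_times[OF Ic c0(1)])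
  have IF': "submodule S (ideal_times S A0 ?I (F0 (p - 1))) A0"
    by (rule A0.submodule_ideal_times[OF Ic c0(2)])
  have dF: "submodule S (d ` F1 (p - 1)) A0" "submodule S (d ` F1 p) A0"
    using submodule_image[OF d_mod_hom F1p'] submodule_image[OF d_mod_hom F1p] .
  have T: "submodule S T A0" unfolding T_def by (rule A0.submodule_plus[OF IF dF(1)])
  have N: "submodule S ?N A0" unfolding hmf_relations_def by (rule A0.submodule_plus[OF IF' dF(1)])
  have NF: "?N \<subseteq> F0 (p - 1)" unfolding hmf_relations_def
    by (rule A0.plus_least[OF F0p' A0.ideal_times_subset[OF Ic F0p']]) (use d_filtration[OF p'(2)] in auto)
  \<comment> \<open>the middle term is the subquotient given by \<open>F0 p\<close> and \<open>T\<close>\<close>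
  have P: "F0 (p - 1) <+>\<^bsub>A0\<^esub> E0 ` carrier (free_power S ?r0) = F0 p"
  proof
    show "F0 (p - 1) <+>\<^bsub>A0\<^esub> E0 ` carrier (free_power S ?r0) \<subseteq> F0 p"
      by (rule A0.plus_least[OF F0p F00 E0(2)])
    show "F0 p \<subseteq> F0 (p - 1) <+>\<^bsub>A0\<^esub> E0 ` carrier (free_power S ?r0)"
    proof
      fix x assume "x \<in> F0 p"
      then obtain y a where "y \<in> F0 (p - 1)" "a \<in> carrier (free_power S ?r0)" "x = y \<oplus>\<^bsub>A0\<^esub> E0 a"
        using E0_span by blast
      then show "x \<in> F0 (p - 1) <+>\<^bsub>A0\<^esub> E0 ` carrier (free_power S ?r0)"
        unfolding A0.mem_plus_iff by blast
    qed
  qed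
  have Evec: "E0 ` ideal_vecs ?I ?r0 \<subseteq> ideal_times S A0 ?I (F0 p)"
  proof
    fix z assume "z \<in> E0 ` ideal_vecs ?I ?r0"
    then obtain v where v: "v \<in> ideal_vecs ?I ?r0" "z = E0 v" by blast
    have "v \<in> ideal_times S (free_power S ?r0) ?I (carrier (free_power S ?r0))"
      using v(1) by (simp only: ideal_times_free_power[OF I] ideal_vecs_def)
    from ideal_times_image[OF E0(1) Ic subset_refl c0(1) E0(2) this] show "z \<in> ideal_times S A0 ?I (F0 p)"
      by (simp add: v(2))
  qed
  have EvN: "submodule S (E0 ` ideal_vecs ?I ?r0) A0" by (rule submodule_image[OF E0(1) submodule_ideal_vecs[OF I]])
  have NT: "?N <+>\<^bsub>A0\<^esub> E0 ` ideal_vecs ?I ?r0 = T"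
  proof
    have "ideal_times S A0 ?I (F0 (p - 1)) \<subseteq> ideal_times S A0 ?I (F0 p)"
      by (rule A0.ideal_times_mono[OF subset_refl Ic F00 c0(1)])
    then have "?N \<subseteq> T" unfolding hmf_relations_def
      using A0.subset_plus[OF IF dF(1), folded T_def] by (intro A0.plus_least[OF T]) auto
    then show "?N <+>\<^bsub>A0\<^esub> E0 ` ideal_vecs ?I ?r0 \<subseteq> T"
      using Evec A0.subset_plus(1)[OF IF dF(1), folded T_def] by (intro A0.plus_least[OF T]) auto
    let ?W = "?N <+>\<^bsub>A0\<^esub> E0 ` ideal_vecs ?I ?r0"
    have W: "submodule S ?W A0" by (rule A0.submodule_plus[OF N EvN])
    have NW: "?N \<subseteq> ?W" by (rule A0.subset_plus(1)[OF N EvN])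
    have "i \<odot>\<^bsub>A0\<^esub> x \<in> ?W" if i: "i \<in> ?I" and x: "x \<in> F0 p" for i x
    proof -
      obtain y a where y: "y \<in> F0 (p - 1)" "a \<in> carrier (free_power S ?r0)" "x = y \<oplus>\<^bsub>A0\<^esub> E0 a"
        using E0_span[OF x] by blast
      have ic: "i \<in> carrier S" using i Ic by blast
      have "y \<in> carrier A0" using y(1) c0(2) by blast
      then have "i \<odot>\<^bsub>A0\<^esub> x = i \<odot>\<^bsub>A0\<^esub> y \<oplus>\<^bsub>A0\<^esub> E0 (i \<odot>\<^bsub>free_power S ?r0\<^esub> a)"
        using ic y by (simp add: A0.smult_r_distr)
      moreover have "i \<odot>\<^bsub>A0\<^esub> y \<in> ?N" unfolding hmf_relations_def
        using A0.ideal_timesI[OF Ic c0(2) i y(1)] A0.subset_plus(1)[OF IF' dF(1)] by blast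
      moreover have "i \<odot>\<^bsub>free_power S ?r0\<^esub> a \<in> ideal_vecs ?I ?r0"
        using y(2) i ic I.I_r_closed by (simp add: ideal_vecs_def free_power_coord)
      ultimately show ?thesis unfolding A0.mem_plus_iff by blast
    qed
    then have "ideal_times S A0 ?I (F0 p) \<subseteq> ?W" by (rule A0.ideal_times_least[OF W])
    moreover have "d ` F1 (p - 1) \<subseteq> ?W"
      using A0.subset_plus(2)[OF IF' dF(1)] NW unfolding hmf_relations_def by blast
    ultimately show "T \<subseteq> ?W" unfolding T_def by (rule A0.plus_least[OF W])
  qed
  have "has_minimal_resolution S ?J A0 (F0 (p - 1) <+>\<^bsub>A0\<^esub> E0 ` carrier (free_power S ?r0))
    (?N <+>\<^bsub>A0\<^esub> E0 ` ideal_vecs ?I ?r0) (\<lambda>i. n i + ?r0 * (p - 1 choose i))"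
    by (rule adjoin_generators[OF K I res NF E0(1) E0_indep])
  then have gens: "has_minimal_resolution S ?J A0 (F0 p) T (\<lambda>i. n i + ?r0 * (p - 1 choose i))"
    by (simp only: P NT)
  \<comment> \<open>the cokernel of the map from \<open>R(p - 1) \<otimes> B\<^sub>1(p)\<close> to the middle term\<close>
  let ?G = "\<lambda>a. d (E1 a)"
  have E1F: "E1 a \<in> F1 p" if "a \<in> carrier (free_power S ?r1)" for a using E1(2) that by blast
  have "has_minimal_resolution S ?J A0 (F0 p) (T <+>\<^bsub>A0\<^esub> ?G ` carrier (free_power S ?r1))
    (\<lambda>i. (n i + ?r0 * (p - 1 choose i)) + (case i of 0 \<Rightarrow> 0 | Suc j \<Rightarrow> ?r1 * (p - 1 choose j)))"
  proof (rule adjoin_relations[OF K I gens _ mod_hom_comp[OF E1(1) d_mod_hom]])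
    show "i \<odot>\<^bsub>A0\<^esub> x \<in> T" if "i \<in> ?I" "x \<in> F0 p" for i x
      using A0.ideal_timesI[OF Ic c0(1) that] A0.subset_plus(1)[OF IF dF(1), folded T_def] by blast
    fix j assume "j < ?r1"
    have "?G (unit_vec ?r1 j) \<in> F0 p" by (rule d_filtration[OF p'(1) E1F[OF unit_vec_closed]])
    then show "?G (unit_vec ?r1 j) \<in> ideal_times S A0 ?J (F0 p)"
      by (rule free_filtration_ideal_times[OF JI filt0 p'(1)])
        (use dmin E1.f_im[OF unit_vec_closed] in blast)
  next
    fix a assume a: "a \<in> carrier (free_power S ?r1)" "?G a \<in> T"
    show "a \<in> ideal_vecs ?I ?r1"
      by (rule relation_coefficients[OF p reg E1_basis a[unfolded T_def]])
  qed
  moreover have "T <+>\<^bsub>A0\<^esub> ?G ` carrier (free_power S ?r1) = hmf_relations p"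
    unfolding hmf_relations_eq[OF p]
  proof
    let ?W = "ideal_times S A0 ?I (F0 p) <+>\<^bsub>A0\<^esub> d ` F1 p"
    have W: "submodule S ?W A0" by (rule A0.submodule_plus[OF IF dF(2)])
    note sub = A0.subset_plus[OF IF dF(2)]
    have "T \<subseteq> ?W" unfolding T_def using sub F11 by (intro A0.plus_least[OF W]) blast+
    moreover have "?G ` carrier (free_power S ?r1) \<subseteq> ?W" using sub(2) E1F by blast
    ultimately show "T <+>\<^bsub>A0\<^esub> ?G ` carrier (free_power S ?r1) \<subseteq> ?W" by (rule A0.plus_least[OF W])
    let ?V = "T <+>\<^bsub>A0\<^esub> ?G ` carrier (free_power S ?r1)"
    have GS: "submodule S (?G ` carrier (free_power S ?r1)) A0"
      by (rule submodule_image[OF mod_hom_comp[OF E1(1) d_mod_hom] E1.M.submodule_carrier])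
    have V: "submodule S ?V A0" by (rule A0.submodule_plus[OF T GS])
    have "d x \<in> ?V" if x: "x \<in> F1 p" for x
    proof -
      obtain y a where y: "y \<in> F1 (p - 1)" "a \<in> carrier (free_power S ?r1)" "x = y \<oplus>\<^bsub>A1\<^esub> E1 a"
        using E1_span[OF x] by blast
      have "d x = d y \<oplus>\<^bsub>A0\<^esub> d (E1 a)" using y c1(2) by (simp add: subset_iff)
      moreover have "d y \<in> T" using A0.subset_plus(2)[OF IF dF(1), folded T_def] y(1) by blast
      ultimately show ?thesis unfolding A0.mem_plus_iff using y(2) by blast
    qed
    moreover have "ideal_times S A0 ?I (F0 p) \<subseteq> ?V"
      using A0.subset_plus(1)[OF IF dF(1), folded T_def] A0.subset_plus(1)[OF T GS] by blast
    ultimately show "?W \<subseteq> ?V" by (intro A0.plus_least[OF V]) auto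
  qed
  ultimately show ?thesis by simp
qed

theorem hmf_resolution:
  assumes J: "maximalideal (max_ideal S) S" and reg: "regular_sequence S c f"
    and fJ: "\<And>p. p \<in> {1..c} \<Longrightarrow> f p \<in> max_ideal S"
    and dmin: "d ` carrier A1 \<subseteq> ideal_times S A0 (max_ideal S) (carrier A0)"
  shows "p \<le> c \<Longrightarrow> has_minimal_resolution S (max_ideal S) A0 (F0 p) (hmf_relations p) (hmf_rank p)"
proof (induction p)
  case 0
  interpret A0: module S A0 by (rule filt0_facts)
  interpret A1: module S A1 by (rule filt1_facts)
  interpret d: mod_hom S A1 A0 d by (rule d_mod_hom)
  interpret FF: module S "free_power S 0" by (rule module_free_power)
  have F: "F0 0 = {\<zero>\<^bsub>A0\<^esub>}" "F1 0 = {\<zero>\<^bsub>A1\<^esub>}" using filt0 filt1 by (simp_all add: free_filtration_def)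
  have "ideal_times S A0 {\<zero>} {\<zero>\<^bsub>A0\<^esub>} \<subseteq> {\<zero>\<^bsub>A0\<^esub>}"
    by (rule A0.ideal_times_subset[OF _ A0.submodule_singleton_zero]) simp
  moreover have "submodule S (ideal_times S A0 {\<zero>} {\<zero>\<^bsub>A0\<^esub>}) A0"
    by (rule A0.submodule_ideal_times) auto
  ultimately have "ideal_times S A0 {\<zero>} {\<zero>\<^bsub>A0\<^esub>} = {\<zero>\<^bsub>A0\<^esub>}" using submodule.zero_closed by blast
  then have N: "hmf_relations 0 = {\<zero>\<^bsub>A0\<^esub>}"
    by (simp add: hmf_relations_def F f_ideal_0 A0.plus_zero_right)
  have "has_minimal_resolution S (max_ideal S) A0 {\<zero>\<^bsub>A0\<^esub>} {\<zero>\<^bsub>A0\<^esub>} (\<lambda>i. if i = 0 then 0 else 0)"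
    by (rule minimal_resolution_free[OF maximalideal.axioms(1)[OF J] A0.submodule_singleton_zero
          A0.submodule_singleton_zero mod_hom_zero[OF module_free_power A0.module_axioms]])
      (use free_power_0 FF.M.zero_closed in \<open>auto simp: A0.M.minus_eq A0.M.r_neg\<close>)
  moreover have "hmf_rank 0 = (\<lambda>i. if i = 0 then 0 else 0)" by (simp add: hmf_rank_def fun_eq_iff)
  ultimately show ?case by (simp only: F N)
next
  case (Suc p)
  have "has_minimal_resolution S (max_ideal S) A0 (F0 (Suc p)) (hmf_relations (Suc p))
    (\<lambda>i. (hmf_rank p i + free_rank S (graded_piece A0 F0 (Suc p)) * (Suc p - 1 choose i)) +
      (case i of 0 \<Rightarrow> 0 | Suc j \<Rightarrow> free_rank S (graded_piece A1 F1 (Suc p)) * (Suc p - 1 choose j)))"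
    by (rule hmf_resolution_step[OF J reg fJ dmin]) (use Suc in simp_all)
  moreover have "(\<lambda>i. (hmf_rank p i + free_rank S (graded_piece A0 F0 (Suc p)) * (Suc p - 1 choose i)) +
      (case i of 0 \<Rightarrow> 0 | Suc j \<Rightarrow> free_rank S (graded_piece A1 F1 (Suc p)) * (Suc p - 1 choose j)))
      = hmf_rank (Suc p)"
    by (simp add: hmf_rank_def fun_eq_iff)
  ultimately show ?case by simp
qed

text \<open>The cokernel of \<open>R \<otimes> d\<close>, computed through \<open>R \<otimes> A \<cong> A/(f 1, \<dots>, f c) A\<close>.\<close>

lemma hmf_module_presentation:
  defines "M \<equiv> hmf_module S c f A0 A1 d"
  shows "\<exists>q. mod_hom S A0 M q \<and> q ` carrier A0 = carrier M \<and>
    (\<forall>x\<in>carrier A0. q x = \<zero>\<^bsub>M\<^esub> \<longleftrightarrow> x \<in> hmf_relations c)"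
proof -
  let ?I = "f_ideal S f c"
  let ?R = "quot_module (regular_module S) ?I"
  let ?T0 = "tensor_module S ?R A0" and ?T1 = "tensor_module S ?R A1"
  let ?D = "tensor_map S ?R A1 ?R A0 (\<lambda>x. x) d"
  interpret A0: module S A0 by (rule filt0_facts)
  interpret A1: module S A1 by (rule filt1_facts)
  interpret d: mod_hom S A1 A0 d by (rule d_mod_hom)
  have I: "ideal ?I S" by (rule f_ideal_ideal[OF f_Pi]) simp_all
  have Ic: "?I \<subseteq> carrier S" by (rule f_ideal_closed) simp
  have R: "module S ?R" by (rule module.quot_module_facts(1)[OF module_regular submodule_regular[OF I]])
  have one: "quot_one ?I \<in> carrier ?R"
    using module.quot_module_facts(3)[OF module_regular submodule_regular[OF I]]
    by (auto simp: quot_one_def regular_module_simps)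
  define t0 where "t0 = pure_tensor S ?R A0 (quot_one ?I)"
  define t1 where "t1 = pure_tensor S ?R A1 (quot_one ?I)"
  note T0 = tensor_quot_left[OF A0.module_axioms I, folded t0_def]
  note T1 = tensor_quot_left[OF A1.module_axioms I, folded t1_def]
  interpret t0: mod_hom S A0 ?T0 t0 by (rule T0)
  interpret t1: mod_hom S A1 ?T1 t1 by (rule T1)
  have D: "mod_hom S ?T1 ?T0 ?D"
    by (rule tensor_map_facts(1)[OF R A1.module_axioms R A0.module_axioms mod_hom_ident[OF R] d_mod_hom])
  have Dt: "?D (t1 y) = t0 (d y)" if "y \<in> carrier A1" for y
    unfolding t0_def t1_def
    by (rule tensor_map_facts(2)[OF R A1.module_axioms R A0.module_axioms mod_hom_ident[OF R] d_mod_hom one that])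
  let ?W = "?D ` carrier ?T1"
  have W: "submodule S ?W ?T0" by (rule submodule_image[OF D t1.N.submodule_carrier])
  have M: "M = quot_module ?T0 ?W" unfolding M_def hmf_module_def Let_def ..
  note Q = t0.N.quot_module_facts[OF W, folded M]
  let ?q = "\<lambda>x. ?W +>\<^bsub>?T0\<^esub> t0 x"
  have F: "F0 c = carrier A0" "F1 c = carrier A1" using filt0 filt1 by (simp_all add: free_filtration_def)
  have ker: "?q x = \<zero>\<^bsub>M\<^esub> \<longleftrightarrow> x \<in> hmf_relations c" if x: "x \<in> carrier A0" for x
  proof -
    have "?q x = \<zero>\<^bsub>M\<^esub> \<longleftrightarrow> t0 x \<in> ?W" using Q(4)[of "t0 x"] x by simp
    also have "\<dots> \<longleftrightarrow> (\<exists>y\<in>carrier A1. t0 x = t0 (d y))" unfolding T1(2) using Dt by auto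
    also have "\<dots> \<longleftrightarrow> (\<exists>y\<in>carrier A1. x \<ominus>\<^bsub>A0\<^esub> d y \<in> ideal_times S A0 ?I (carrier A0))"
    proof (rule bex_cong[OF refl])
      fix y assume y: "y \<in> carrier A1"
      have "t0 x = t0 (d y) \<longleftrightarrow> t0 (x \<ominus>\<^bsub>A0\<^esub> d y) = \<zero>\<^bsub>?T0\<^esub>" using x y by simp
      also have "\<dots> \<longleftrightarrow> x \<ominus>\<^bsub>A0\<^esub> d y \<in> ideal_times S A0 ?I (carrier A0)"
        by (rule T0(3)) (use x y in simp)
      finally show "t0 x = t0 (d y) \<longleftrightarrow> x \<ominus>\<^bsub>A0\<^esub> d y \<in> ideal_times S A0 ?I (carrier A0)" .
    qed
    also have "\<dots> \<longleftrightarrow> x \<in> hmf_relations c"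
    proof
      assume "\<exists>y\<in>carrier A1. x \<ominus>\<^bsub>A0\<^esub> d y \<in> ideal_times S A0 ?I (carrier A0)"
      then obtain y where y: "y \<in> carrier A1" "x \<ominus>\<^bsub>A0\<^esub> d y \<in> ideal_times S A0 ?I (carrier A0)" by blast
      have "x = (x \<ominus>\<^bsub>A0\<^esub> d y) \<oplus>\<^bsub>A0\<^esub> d y"
        using x y(1) by (simp add: A0.M.minus_eq A0.M.a_assoc A0.M.l_neg)
      then show "x \<in> hmf_relations c" unfolding hmf_relations_def A0.mem_plus_iff F using y by blast
    next
      assume "x \<in> hmf_relations c"
      then obtain w y where w: "w \<in> ideal_times S A0 ?I (carrier A0)" "y \<in> carrier A1" "x = w \<oplus>\<^bsub>A0\<^esub> d y"
        unfolding hmf_relations_def A0.mem_plus_iff F by blast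
      have "w \<in> carrier A0" using A0.ideal_times_subset[OF Ic A0.submodule_carrier] w(1) by blast
      then have "x \<ominus>\<^bsub>A0\<^esub> d y = w" using w by (simp add: A0.M.minus_eq A0.M.a_assoc A0.M.r_neg)
      then show "\<exists>y\<in>carrier A1. x \<ominus>\<^bsub>A0\<^esub> d y \<in> ideal_times S A0 ?I (carrier A0)" using w by blast
    qed
    finally show ?thesis .
  qed
  have "?q ` carrier A0 = carrier M" unfolding Q(3) T0(2) image_image ..
  then show ?thesis using mod_hom_comp[OF T0(1) Q(2)] ker by blast
qed

end

section \<open>The Poincare series\<close>

lemma fps_nth_one_plus_X_power:
  "fps_nth ((1 + fps_X :: 'a :: comm_ring_1 fps) ^ p) i = of_nat (p choose i)"
proof (induction p arbitrary: i)
  case 0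
  then show ?case by (cases i) simp_all
next
  case (Suc p)
  then show ?case by (cases i) (simp_all add: distrib_right)
qed

theorem corollary3p10:
  fixes S :: "('a, 'b) ring_scheme"
    and c :: nat and f :: "nat \<Rightarrow> 'a"
    and A0 :: "('a, 'm) module" and F0 :: "nat \<Rightarrow> 'm set"
    and A1 :: "('a, 'n) module" and F1 :: "nat \<Rightarrow> 'n set"
    and d :: "'n \<Rightarrow> 'm" and h :: "(nat \<Rightarrow> 'm) \<Rightarrow> 'n"
  assumes "noetherian_local_ring S"
    and "regular_sequence S c f"
    and "higher_matrix_factorization S c f A0 F0 A1 F1 d h"
    and "minimal_hmf S c A0 F0 A1 d h"
  shows "poincare_series S (hmf_module S c f A0 A1 d) =
    (\<Sum>p=1..c. (1 + fps_X) ^ (p - 1) *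
       (fps_X * of_nat (free_rank S (graded_piece A1 F1 p)) +
        of_nat (free_rank S (graded_piece A0 F0 p))))"
proof -
  interpret S: noetherian_local_ring S by fact
  interpret H: higher_matrix_factorization S c f A0 F0 A1 F1 d h by fact
  let ?M = "hmf_module S c f A0 A1 d"
  note J = S.maximalideal_max_ideal
  have "f_ideal S f c \<subseteq> max_ideal S"
    by (rule S.proper_ideal_subset_max_ideal[OF S.f_ideal_ideal[OF H.f_Pi]])
      (use assms(2) in \<open>simp_all add: regular_sequence_def\<close>)
  then have fJ: "f p \<in> max_ideal S" if "p \<in> {1..c}" for p
    using S.f_ideal_mem[OF H.f_Pi order_refl that] by blast
  have "d ` carrier A1 \<subseteq> ideal_times S A0 (max_ideal S) (carrier A0)"
    using assms(4) by (simp add: minimal_hmf_def)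
  from H.hmf_resolution[OF J assms(2) fJ this order_refl]
  have res: "has_minimal_resolution S (max_ideal S) A0 (carrier A0) (H.hmf_relations c) (H.hmf_rank c)"
    using H.filt0 by (simp add: free_filtration_def)
  obtain q where q: "mod_hom S A0 ?M q" "q ` carrier A0 = carrier ?M"
    "\<forall>x\<in>carrier A0. q x = \<zero>\<^bsub>?M\<^esub> \<longleftrightarrow> x \<in> H.hmf_relations c"
    using H.hmf_module_presentation by (elim exE conjE) (rule that; assumption)
  have "has_minimal_resolution S (max_ideal S) ?M (carrier ?M) {\<zero>\<^bsub>?M\<^esub>} (H.hmf_rank c)"
    by (rule S.minimal_resolution_quotient[OF res q(1,2)]) (rule bspec[OF q(3)])
  then have betti: "betti S i ?M = H.hmf_rank c i" for i by (rule S.betti_minimal_resolution[OF J])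
  show ?thesis
  proof (rule fps_ext)
    fix i
    have "fps_nth ((1 + fps_X) ^ (p - 1) * (fps_X * of_nat b1 + of_nat b0)) i =
        int (b0 * (p - 1 choose i) + (case i of 0 \<Rightarrow> 0 | Suc j \<Rightarrow> b1 * (p - 1 choose j)))"
      for p b0 b1 :: nat
    proof -
      have e: "(1 + fps_X) ^ (p - 1) * (fps_X * of_nat b1 + of_nat b0) =
          fps_X * ((1 + fps_X) ^ (p - 1) * fps_const (int b1)) + (1 + fps_X) ^ (p - 1) * fps_const (int b0)"
        by (simp add: algebra_simps fps_of_nat[symmetric])
      show ?thesis unfolding e by (cases i) (simp_all add: fps_nth_one_plus_X_power)
    qed
    then show "fps_nth (poincare_series S ?M) i = fps_nth (\<Sum>p=1..c. (1 + fps_X) ^ (p - 1) *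
       (fps_X * of_nat (free_rank S (graded_piece A1 F1 p)) +
        of_nat (free_rank S (graded_piece A0 F0 p)))) i"
      by (simp add: poincare_series_def betti H.hmf_rank_def fps_sum_nth)
  qed
qed

end
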